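(* Let $l>0$ and $\rho^2-\rho^1>0$ (the Rayleigh–Taylor stable regime). Let $f_0\in H^3_l(\mathbb R)$ be a smooth initial datum and let $f(x,t)$ be the classical solution with $f(x,0)=f_0(x)$ of the confined Muskat equation $$\partial_t f(x,t)=\frac{\rho^2-\rho^1}{8l}\,\mathrm{P.V.}\int_{\mathbb R}\Big[\big(\partial_xf(x)-\partial_xf(x-\eta)\big)\Xi_1(x,\eta)+\big(\partial_xf(x)+\partial_xf(x-\eta)\big)\Xi_2(x,\eta)\Big]d\eta .$$ (i) Suppose that the following three conditions hold: $$\|\partial_xf_0\|_{L^\infty}\le1,$$ $$\tan\left(\frac{\pi\|f_0\|_{L^\infty}}{2l}\right)<\|\partial_xf_0\|_{L^\infty}\tanh\left(\frac{\pi}{4l}\right),$$ and $$\left(\|\partial_xf_0\|_{L^\infty}+\left|2\left(\cos\left(\tfrac{\pi}{2l}\right)-2\right)\sec^4\left(\tfrac{\pi}{4l}\right)\right|\|\partial_xf_0\|_{L^\infty}^3\right)\frac{\pi^3}{8l^3}\cdot\frac{1+\|\partial_xf_0\|_{L^\infty}\left(\|\partial_xf_0\|_{L^\infty}+\frac{\tan\left(\frac{\pi}{2l}\frac{\|\partial_xf_0\|_{L^\infty}}{2}\right)}{\tanh\left(\frac{\pi}{4l}\right)}\right)}{6\tanh\left(\frac{\pi}{4l}\right)}\cdot\frac{\pi^2}{4l^2}$$ $$+4\tan\left(\frac{\pi}{2l}\|f_0\|_{L^\infty}\right)-4\|\partial_xf_0\|_{L^\infty}\cos\left(\frac{\pi}{l}\|f_0\|_{L^\infty}\right)\le0.$$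 Then, for all times $t\ge0$ at which the solution exists, $\|\partial_xf(t)\|_{L^\infty}\le\|\partial_xf_0\|_{L^\infty}$. (ii) Let $(x(l),y(l))$, with $0<x(l)<l$ and $0<y(l)\le1$, be the solution of the system $$\left\{\begin{array}{l}\tan\left(\frac{\pi x}{2l}\right)-y\tanh\left(\frac{\pi}{4l}\right)=0,\\[2mm] \left(y+\left|2\left(\cos\left(\frac{\pi}{2l}\right)-2\right)\sec^4\left(\frac{\pi}{4l}\right)\right|y^3\right)\dfrac{1+y\left(y+\frac{\tan\left(\frac{\pi}{2l}\frac{y}{2}\right)}{\tanh\left(\frac{\pi}{4l}\right)}\right)}{6\tanh\left(\frac{\pi}{4l}\right)}\left(\dfrac{\pi}{2l}\right)^5+4\tan\left(\frac{\pi}{2l}x\right)-4y\cos\left(\frac{\pi}{l}x\right)=0.\end{array}\right.$$ If $\|f_0\|_{L^\infty}<x(l)$ and $\|\partial_xf_0\|_{L^\infty}<y(l)$, then, for all times $t\ge0$ at which the solution exists, $\|\partial_xf(t)\|_{L^\infty}\le1$.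
   Context: The strip is $\mathbb R\times(-l,l)$, $l>0$; $\rho^1,\rho^2$ are the constant densities of the upper and lower fluid, and the interface is the graph of $f(\cdot,t)$. Function space: $H^s_l(\mathbb R)=H^s(\mathbb R)\cap\{f:\|f\|_{L^\infty}<l\}$. Kernels (with time dependence suppressed): $$\Xi_1(x,\eta)=\frac{\sinh\left(\frac{\pi}{2l}\eta\right)}{\cosh\left(\frac{\pi}{2l}\eta\right)-\cos\left(\frac{\pi}{2l}(f(x)-f(x-\eta))\right)},\qquad \Xi_2(x,\eta)=\frac{\sinh\left(\frac{\pi}{2l}\eta\right)}{\cosh\left(\frac{\pi}{2l}\eta\right)+\cos\left(\frac{\pi}{2l}(f(x)+f(x-\eta))\right)}.$$ P.V. denotes principal value (at $\eta=0$ and at infinity). For $\rho^2-\rho^1>0$ and $f_0\in H^3_l(\mathbb R)$ the classical solution is the unique solution $f\in C([0,T],H^3_l(\mathbb R))\cap C^1([0,T],C(\mathbb R))\cap C([0,T],C^2(\mathbb R))$, which exists on some time interval $[0,T]$, $T>0$. *)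

theory Defs
  imports "HOL-Probability.Essential_Supremum"
begin

section \<open>Function spaces on the real line\<close>

text \<open>Extended-real valued, so that an unbounded function has norm \<open>\<infinity>\<close>.\<close>

definition Linf_norm :: "(real \<Rightarrow> real) \<Rightarrow> ereal" where
  "Linf_norm g = esssup lborel (\<lambda>x. ereal \<bar>g x\<bar>)"

definition L2_function :: "(real \<Rightarrow> real) \<Rightarrow> bool" where
  "L2_function g \<longleftrightarrow> g \<in> borel_measurable lborel \<and> integrable lborel (\<lambda>x. (g x)\<^sup>2)"

definition test_function :: "(real \<Rightarrow> real) \<Rightarrow> bool" where
  "test_function \<phi> \<longleftrightarrow>
     (\<forall>n x. (deriv ^^ n) \<phi> field_differentiable (at x)) \<and> compact (closure {x. \<phi> x \<noteq> 0})"

definition locally_integrable :: "(real \<Rightarrow> real) \<Rightarrow> bool" where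
  "locally_integrable g \<longleftrightarrow> (\<forall>R. set_integrable lborel {-R..R} g)"

definition is_weak_deriv :: "nat \<Rightarrow> (real \<Rightarrow> real) \<Rightarrow> (real \<Rightarrow> real) \<Rightarrow> bool" where
  "is_weak_deriv k g h \<longleftrightarrow>
     locally_integrable g \<and> locally_integrable h \<and>
     (\<forall>\<phi>. test_function \<phi> \<longrightarrow>
        (LINT x|lborel. g x * (deriv ^^ k) \<phi> x) = (-1) ^ k * (LINT x|lborel. h x * \<phi> x))"

text \<open>The Sobolev space \<open>H\<^sup>k\<close> for integer \<open>k\<close>.\<close>

definition sobolev :: "nat \<Rightarrow> (real \<Rightarrow> real) set" where
  "sobolev k = {g. \<forall>j\<le>k. \<exists>h. is_weak_deriv j g h \<and> L2_function h}"

text \<open>Weak derivatives are unique up to null sets, so the norm does not depend on the choice.\<close>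

definition weak_deriv :: "nat \<Rightarrow> (real \<Rightarrow> real) \<Rightarrow> real \<Rightarrow> real" where
  "weak_deriv k g = (SOME h. is_weak_deriv k g h)"

definition sobolev_norm :: "nat \<Rightarrow> (real \<Rightarrow> real) \<Rightarrow> real" where
  "sobolev_norm k g = sqrt (\<Sum>j\<le>k. LINT x|lborel. (weak_deriv j g x)\<^sup>2)"

definition sobolev_strip :: "nat \<Rightarrow> real \<Rightarrow> (real \<Rightarrow> real) set" where
  "sobolev_strip k l = {g \<in> sobolev k. Linf_norm g < ereal l}"


section \<open>Curves in function spaces\<close>

text \<open>A curve is given as \<open>f t x\<close>, with the time variable first.
  The space \<open>C\<^sup>k(\<real>)\<close> carries the norm given by the supremum norms of the derivatives up to order \<open>k\<close>.\<close>

definition continuous_in_sobolev_strip ::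
  "nat \<Rightarrow> real \<Rightarrow> real set \<Rightarrow> (real \<Rightarrow> real \<Rightarrow> real) \<Rightarrow> bool" where
  "continuous_in_sobolev_strip k l I f \<longleftrightarrow>
     (\<forall>t\<in>I. f t \<in> sobolev_strip k l) \<and>
     (\<forall>t\<in>I. ((\<lambda>s. sobolev_norm k (\<lambda>x. f s x - f t x)) \<longlongrightarrow> 0) (at t within I))"

definition continuous_in_Ck :: "nat \<Rightarrow> real set \<Rightarrow> (real \<Rightarrow> real \<Rightarrow> real) \<Rightarrow> bool" where
  "continuous_in_Ck k I f \<longleftrightarrow>
     (\<exists>F :: nat \<Rightarrow> real \<Rightarrow> (real \<Rightarrow>\<^sub>C real).
        (\<forall>j\<le>k. continuous_on I (F j)) \<and>
        (\<forall>t\<in>I. apply_bcontfun (F 0 t) = f t) \<and>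
        (\<forall>t\<in>I. \<forall>j<k. \<forall>x.
           (apply_bcontfun (F j t) has_real_derivative apply_bcontfun (F (Suc j) t) x) (at x)))"

definition C1_in_C :: "real set \<Rightarrow> (real \<Rightarrow> real \<Rightarrow> real) \<Rightarrow> bool" where
  "C1_in_C I f \<longleftrightarrow>
     (\<exists>F F' :: real \<Rightarrow> (real \<Rightarrow>\<^sub>C real).
        (\<forall>t\<in>I. apply_bcontfun (F t) = f t) \<and>
        (\<forall>t\<in>I. (F has_vector_derivative F' t) (at t within I)) \<and>
        continuous_on I F')"


section \<open>The confined Muskat equation\<close>

definition has_PV_integral :: "(real \<Rightarrow> real) \<Rightarrow> real \<Rightarrow> bool" where
  "has_PV_integral g c \<longleftrightarrow>
     (\<forall>\<epsilon>>0. \<forall>R. set_integrable lborel {\<eta>. \<epsilon> < \<bar>\<eta>\<bar> \<and> \<bar>\<eta>\<bar> < R} g) \<and>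
     ((\<lambda>(\<epsilon>, R). LINT \<eta>:{\<eta>. \<epsilon> < \<bar>\<eta>\<bar> \<and> \<bar>\<eta>\<bar> < R}|lborel. g \<eta>) \<longlongrightarrow> c)
       (at_right 0 \<times>\<^sub>F at_top)"

definition Xi1 :: "real \<Rightarrow> (real \<Rightarrow> real) \<Rightarrow> real \<Rightarrow> real \<Rightarrow> real" where
  "Xi1 l g x \<eta> = sinh (pi / (2*l) * \<eta>) /
     (cosh (pi / (2*l) * \<eta>) - cos (pi / (2*l) * (g x - g (x - \<eta>))))"

definition Xi2 :: "real \<Rightarrow> (real \<Rightarrow> real) \<Rightarrow> real \<Rightarrow> real \<Rightarrow> real" where
  "Xi2 l g x \<eta> = sinh (pi / (2*l) * \<eta>) /
     (cosh (pi / (2*l) * \<eta>) + cos (pi / (2*l) * (g x + g (x - \<eta>))))"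

definition muskat_integrand :: "real \<Rightarrow> (real \<Rightarrow> real) \<Rightarrow> real \<Rightarrow> real \<Rightarrow> real" where
  "muskat_integrand l g x \<eta> =
     (deriv g x - deriv g (x - \<eta>)) * Xi1 l g x \<eta> +
     (deriv g x + deriv g (x - \<eta>)) * Xi2 l g x \<eta>"

text \<open>\<open>rho1\<close> is the density of the upper fluid and \<open>rho2\<close> that of the lower one.
  At the endpoints of \<open>[0,T]\<close> the time derivative is one-sided.\<close>

definition muskat_equation ::
  "real \<Rightarrow> real \<Rightarrow> real \<Rightarrow> real \<Rightarrow> (real \<Rightarrow> real \<Rightarrow> real) \<Rightarrow> bool" where
  "muskat_equation l rho1 rho2 T f \<longleftrightarrow>
     (\<forall>t\<in>{0..T}. \<forall>x. \<exists>c. has_PV_integral (muskat_integrand l (f t) x) c \<and>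
        ((\<lambda>s. f s x) has_real_derivative (rho2 - rho1) / (8*l) * c) (at t within {0..T}))"

definition classical_solution ::
  "real \<Rightarrow> real \<Rightarrow> real \<Rightarrow> real \<Rightarrow> (real \<Rightarrow> real) \<Rightarrow> (real \<Rightarrow> real \<Rightarrow> real) \<Rightarrow> bool" where
  "classical_solution l rho1 rho2 T f0 f \<longleftrightarrow>
     continuous_in_sobolev_strip 3 l {0..T} f \<and>
     C1_in_C {0..T} f \<and>
     continuous_in_Ck 2 {0..T} f \<and>
     muskat_equation l rho1 rho2 T f \<and>
     f 0 = f0"

end

theory Submission
  imports Defs "HOL-Real_Asymp.Real_Asymp" "HOL-Computational_Algebra.Polynomial"
begin

text \<open>Write \<open>k = pi / (2 * l)\<close> and scale the solution to \<open>g t X = k * f t (X / k)\<close>: this keeps slopes, turns the strip into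
one of half-width \<open>pi/2\<close> and turns every factor \<open>pi / (2 * l)\<close> into \<open>1\<close>. Both parts of the theorem
are instances of one maximum principle: if \<open>\<bar>g 0\<bar> \<le> A\<close>, \<open>\<bar>g' 0\<bar> \<le> M\<close> and \<open>tan A \<le> M \<le> 1\<close>, then \<open>\<bar>g' t\<bar> \<le> M\<close>
for all times. In (i) take \<open>M = d\<close>, in (ii) take \<open>M = y\<close>; since \<open>tanh < 1\<close>, the tangent condition gives \<open>tan A \<le> M\<close>.

The equation is governed by a harmonic function. For \<open>u = g x\<close>, \<open>v = g (x - \<eta>)\<close>, \<open>z = \<eta> + i (u - v)\<close> and
\<open>w = \<eta> + i (u + v)\<close> put \<open>\<Phi> = 2 arg (sinh (z/2)) + 2 arg (cosh (w/2))\<close>: a vortex at the other point and its image in the wall.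
The integrand of the equation differs by a total \<open>\<eta>\<close>-derivative of \<open>\<Phi>\<close> (\<open>stream\<close> below) from the derivative of \<open>\<Phi>\<close>, as
a function of the point \<open>(x, u)\<close>, in the direction \<open>(1, g' x)\<close>, and this \<open>velocity\<close> contains \<open>g\<close> but not \<open>g'\<close> at the other point.
Let \<open>(x, u)\<close> now move along a line of slope \<open>M\<close>. The velocity then changes at the rate
\<open>Im ((1 + i M)^2 (1 / cosh(w/2)^2 - 1 / sinh(z/2)^2)) / 2\<close>, and the key estimate \<open>kernel_bound\<close> says that this rate is at most
\<open>ref_slope M \<eta>\<close> as long as \<open>\<bar>u\<bar>, \<bar>v\<bar> \<le> A\<close>, \<open>tan A \<le> M \<le> 1\<close> and \<open>\<bar>u - v\<bar> \<le> M * \<bar>\<eta>\<bar>\<close>. The reference has total integral \<open>8 * M\<close>,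
which is what the boundary terms of \<open>\<Phi>\<close> and the limits of the integrand at infinity take away. So a slope that
has reached the bound \<open>M\<close> cannot grow further.

The time derivative exists for \<open>f\<close> only, not for its slope, so the argument runs on pairs of points with the barrier
\<open>g x - g y \<le> M * \<bar>x - y\<bar> + \<epsilon> * exp (\<Lambda> * t)\<close>. If a pair \<open>x1 > x2\<close> touches it for the first time, both slopes are \<open>M\<close> there, and up to
errors of size \<open>\<epsilon>\<close> the two velocities are compared by moving along a line of slope \<open>M\<close> (\<open>two_point_kernel\<close>). After integration
(\<open>rate_difference_at_touching\<close>) the difference of the rates is \<open>O(\<epsilon>)\<close>, less than the growth of the barrier if \<open>\<Lambda>\<close> is large:
a contradiction. Letting \<open>\<epsilon> \<rightarrow> 0\<close> gives the slope bound. The bound \<open>\<bar>g t\<bar> \<le> A\<close> comes in the same way from a barrier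
for single points. For a barrier to be touched at a finite place the solution has to vanish at infinity; this is so
because it is Lipschitz and square integrable.\<close>

section \<open>The kernel inequality in half-angle variables\<close>

text \<open>The bound \<open>image_polynomial_bound\<close> below, multiplied by \<open>a^2\<close>, is concave in \<open>T = a^2\<close> once \<open>s = a * r\<close> is held fixed. Since
\<open>r \<le> 1\<close>, the variable \<open>T\<close> ranges over \<open>s^2 \<le> T \<le> 1\<close>, so that only these two ends need to be checked. Here \<open>m\<close> is \<open>M^2\<close>.\<close>

lemma image_polynomial_left_end:
  fixes m s :: real
  assumes "0 \<le> m" "m \<le> 1" "0 \<le> s" "s \<le> 1"
  shows "(1 + m) * ((1 + s) * (1 - m * s)) \<le> (2 + m/2 - 3/2 * m * s^2) * (1 + m * s^2)^2"
proof -
  have s4: "s^4 \<le> s^2" using assms by (intro power_decreasing) auto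
  have msq: "m^2 \<le> m" using assms by (simp add: power2_eq_square mult_left_le)
  have ms: "m * s^2 \<le> 1" using assms by (simp add: mult_le_one power_le_one)
  have c: "0 \<le> 2 + m/2 - 3/2 * m * s^2" using ms assms by linarith
  have "(1 + m) * ((1 + s) * (1 - m * s)) = 1 + m + s * (1-m^2) - m * (1+m) * s^2"
    by (simp add: algebra_simps power2_eq_square)
  also have "\<dots> \<le> (2 + m/2 - 3/2 * m * s^2) * (1 + 2 * (m * s^2))"
  proof -
    have "(2 + m/2 - 3/2 * m * s^2) * (1 + 2 * (m * s^2)) - (1 + m + s * (1-m^2) - m * (1+m) * s^2)
      = 1 - m/2 - s * (1-m^2) + (7/2 * m+2 * m^2) * s^2 - 3 * m^2 * s^4"
      by (simp add: field_simps power2_eq_square power4_eq_xxxx)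
    moreover have "3 * m^2 * s^4 \<le> 3 * m^2 * s^2" using s4 by (intro mult_left_mono) auto
    moreover have "m^2 * s^2 \<le> m * s^2" using msq by (intro mult_right_mono) auto
    moreover have "0 \<le> 1 - m/2 - s * (1-m^2) + (5/2 * m) * s^2"
    proof (cases "s \<le> 1/5")
      case True
      have "s * (1-m^2) \<le> 1/5" using True assms mult_left_le[of "1 - m^2" s] by simp
      moreover have "0 \<le> (5/2 * m) * s^2" using assms by simp
      ultimately show ?thesis using assms by linarith
    next
      case False
      have "m * s * (1/5) \<le> m * s * s" using False assms by (intro mult_left_mono) auto
      then have "1/2 * m * s \<le> 5/2 * m * s^2" by (simp add: power2_eq_square)
      moreover have "0 \<le> (1-s) * (1-m/2)" using assms by simp
      moreover have "0 \<le> s * m^2" using assms by simp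
      moreover have "1 - m/2 - s * (1-m^2) + (5/2 * m) * s^2
          = (1-s) * (1-m/2) + s * m^2 + (5/2 * m * s^2 - 1/2 * m * s)"
        by (simp add: field_simps)
      ultimately show ?thesis by linarith
    qed
    ultimately show ?thesis by (simp add: algebra_simps)
  qed
  also have "\<dots> \<le> (2 + m/2 - 3/2 * m * s^2) * (1 + m * s^2)^2"
    using c by (intro mult_left_mono) (simp_all add: power2_sum)
  finally show ?thesis .
qed

lemma image_polynomial_right_end:
  fixes m s :: real
  assumes "0 \<le> m" "m \<le> 1" "0 \<le> s" "s \<le> 1"
  shows "(1 + m * s^2) * ((1 + s) * (1 - m * s)) \<le> (2 - m) * (1 + m * s^2)^2"
proof -
  have "0 \<le> (1-s) * (1-m) + m * s^2 * (3-m)" using assms by simp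
  then have "(1 + s) * (1 - m * s) \<le> (2 - m) * (1 + m * s^2)"
    by (simp add: algebra_simps power2_eq_square)
  then have "(1 + m * s^2) * ((1 + s) * (1 - m * s)) \<le> (1 + m * s^2) * ((2 - m) * (1 + m * s^2))"
    using assms by (intro mult_left_mono) auto
  then show ?thesis by (simp add: power2_eq_square mult_ac)
qed

text \<open>The image part of the kernel alone stays below the reference. This settles all points for which the vortex part is not positive.\<close>

lemma image_polynomial_bound:
  fixes m r a :: real
  assumes m: "0 \<le> m" "m \<le> 1" and r: "0 \<le> r" "r \<le> 1" and a: "0 < a" "a < 1"
  shows "(1 + m * r^2) * ((1 + a * r) * (1 - m * (a * r))) \<le> (2 + m/2 - 3/2 * m * a^2) * (1 + m * (a * r)^2)^2"
proof -
  define s where "s = a * r"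
  define T where "T = a^2"
  define G where "G = (1 + m * s^2)^2"
  define K where "K = (1 + s) * (1 - m * s)"
  define f where "f = (\<lambda>T. T * (2 + m/2 - 3/2 * m * T) * G - (T + m * s^2) * K)"
  have sa: "s \<le> a" unfolding s_def using r a by (simp add: mult_left_le)
  have s: "0 \<le> s" "s < 1" using sa a r by (simp add: s_def, linarith)
  have T: "s^2 \<le> T" "T < 1" "0 < T" unfolding T_def using sa s a by (auto intro!: power_mono simp: power_less_one_iff)
  have f1: "0 \<le> f 1" using image_polynomial_right_end[of m s] m s by (simp add: f_def K_def G_def field_simps)
  have "(1 + m) * K \<le> (2 + m/2 - 3/2 * m * s^2) * G"
    using image_polynomial_left_end[of m s] m s by (simp add: K_def G_def)
  then have "s^2 * ((1 + m) * K) \<le> s^2 * ((2 + m/2 - 3/2 * m * s^2) * G)" by (intro mult_left_mono) auto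
  then have f2: "0 \<le> f (s^2)" by (simp add: f_def algebra_simps)
  have s1: "0 < 1 - s^2" using s by (simp add: power_less_one_iff)
  have "(1 - s^2) * f T = (1-T) * f (s^2) + (T - s^2) * f 1 + 3/2 * m * G * (T-s^2) * (1-T) * (1-s^2)"
    unfolding f_def by (simp add: field_simps power2_eq_square power3_eq_cube)
  moreover have "0 \<le> (1-T) * f (s^2) + (T - s^2) * f 1 + 3/2 * m * G * (T-s^2) * (1-T) * (1-s^2)"
    using T f1 f2 m s1 by (intro add_nonneg_nonneg mult_nonneg_nonneg) (auto simp: G_def)
  ultimately have "0 \<le> f T" using s1 by (metis zero_le_mult_iff not_less)
  moreover have "f T = T * ((2 + m/2 - 3/2 * m * a^2) * G - (1 + m * r^2) * K)"
    by (simp add: f_def T_def s_def algebra_simps power_mult_distrib)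
  ultimately have "0 \<le> (2 + m/2 - 3/2 * m * a^2) * G - (1 + m * r^2) * K"
    using T by (simp add: zero_le_mult_iff)
  then show ?thesis by (simp add: G_def K_def s_def)
qed

text \<open>After \<open>m^2 \<le> m\<close> the claim is linear in \<open>m\<close>. At \<open>m = 0\<close> it reads \<open>1 - a \<le> a^3\<close>, true from \<open>a = 0.683\<close> on; this fixes how low the
threshold \<open>69/100\<close> can be.\<close>

lemma far_coefficient_bound:
  fixes m a :: real
  assumes m: "0 \<le> m" "m \<le> 1" and a: "69/100 \<le> a" "a < 1"
  shows "(1 + m * a^2) * (1 - a) \<le> a^3 * (1 + m) * (1 + m/2 - 3/2 * m * a^2)"
proof -
  have T: "(69/100)^2 \<le> a^2" "(69/100)^3 \<le> a^3" using a by (intro power_mono; simp)+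
  have neg: "1 - 3 * a^2 \<le> 0" using T by (simp add: power2_eq_square)
  have e0: "1 - a \<le> a^3" using T a by (simp add: power3_eq_cube)
  have e1: "(1 + a^2) * (1-a) \<le> a^3 * (3 - 3 * a^2)"
  proof -
    have "1 + a^2 \<le> 3 * a^3 * (1+a)"
    proof -
      have "(69/100)^2 * (3 * (69/100) * (1+69/100) - 1) \<le> a^2 * (3 * a * (1+a) - 1)"
      proof (intro mult_mono)
        show "3 * (69/100) * (1+69/100) - 1 \<le> 3 * a * (1+a) - 1"
          using mult_mono[of "69/100" a "1+69/100" "1+a"] a by simp
      qed (use T a in auto)
      then have "1 \<le> a^2 * (3 * a * (1+a) - 1)" by (simp add: power2_eq_square)
      then show ?thesis by (simp add: algebra_simps power2_eq_square power3_eq_cube)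
    qed
    then have "(1 + a^2) * (1-a) \<le> 3 * a^3 * (1+a) * (1-a)" using a by (intro mult_right_mono) auto
    then show ?thesis by (simp add: algebra_simps power2_eq_square)
  qed
  have "(1 + m * a^2) * (1 - a) = (1-m) * (1-a) + m * ((1+a^2) * (1-a))" by (simp add: algebra_simps)
  also have "\<dots> \<le> (1-m) * a^3 + m * (a^3 * (3 - 3 * a^2))"
    using e0 e1 m by (intro add_mono mult_left_mono) auto
  also have "\<dots> = a^3 * (1 + m + m * (1 - 3 * a^2))" by (simp add: algebra_simps)
  also have "\<dots> \<le> a^3 * (1 + m + m/2 * (1+m) * (1 - 3 * a^2))"
  proof (intro mult_left_mono add_left_mono)
    have "m/2 * (1+m) \<le> m" using m by (simp add: mult_left_le field_simps)
    then show "m * (1 - 3 * a^2) \<le> m/2 * (1+m) * (1 - 3 * a^2)" using neg by (rule mult_right_mono_neg)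
  qed (use a in auto)
  also have "\<dots> = a^3 * (1 + m) * (1 + m/2 - 3/2 * m * a^2)" by (simp add: field_simps)
  finally show ?thesis .
qed

text \<open>The two ends of the interval in \<open>T\<close> on which \<open>vortex_polynomial_bound\<close> is linear; \<open>N = 1 + m\<close> and \<open>E = 1 - N * x\<close>. Both sides are
quadratic in \<open>N\<close> with a concave difference, which leaves polynomials in \<open>x\<close> for \<open>N = 1\<close> and \<open>N = 2\<close>.\<close>

lemma vortex_polynomial_left_end:
  fixes x N :: real
  assumes x: "0 \<le> x" "x \<le> 239/1000" and N: "1 \<le> N" "N \<le> 2"
  shows "(1 - 2 * x + N^2 * x^2) * (1 - x) \<le> (1 + 22/10 * x) * (1 - 2 * x + N * x^2)^2"
proof -
  define f where "f = (\<lambda>N. (1 + 22/10 * x) * (1 - 2 * x + N * x^2)^2 - (1 - 2 * x + N^2 * x^2) * (1 - x))"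
  have x2: "x^2 \<le> (239/1000)^2" using x by (intro power_mono) auto
  have f1: "0 \<le> f 1"
  proof -
    have "f 1 = (1-x)^3 * (x * (12/10 - 22/10 * x))"
      unfolding f_def by (simp add: field_simps power2_eq_square power3_eq_cube)
    then show ?thesis using x by simp
  qed
  have f2: "0 \<le> f 2"
  proof -
    define y where "y = x^2 * (1 - x)"
    define z where "z = x^4"
    have "f 2 = x * (12/10 - 68/10 * x + 136/10 * y + 88/10 * z)"
      unfolding f_def y_def z_def by (simp add: field_simps power2_eq_square power4_eq_xxxx)
    moreover have "x^2 * (761/1000) \<le> y" unfolding y_def using x by (intro mult_left_mono) auto
    moreover have "0 \<le> (x - 1/3)^2" by simp
    then have "0 \<le> 12/10 - 68/10 * x + 136/10 * (x^2 * (761/1000))"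
      using x by (simp add: power2_eq_square algebra_simps)
    moreover have "0 \<le> z" unfolding z_def by simp
    ultimately show ?thesis using x by simp
  qed
  define c where "c = 1 + 22/10 * x"
  have "f N = (2-N) * f 1 + (N-1) * f 2 + x^2 * (1 - x - c * x^2) * ((N-1) * (2-N))"
    unfolding f_def c_def[symmetric] by (simp add: algebra_simps power2_eq_square)
  moreover have "(1 + 22/10 * x) * x^2 \<le> (1 + 22/10 * (239/1000)) * (239/1000)^2"
    using x x2 by (intro mult_mono) auto
  then have "0 \<le> 1 - x - c * x^2" using x unfolding c_def by (simp add: power2_eq_square)
  ultimately have "0 \<le> f N" using f1 f2 N by simp
  then show ?thesis by (simp add: f_def)
qed

lemma vortex_polynomial_right_end:
  fixes x N :: real
  assumes x: "0 \<le> x" "x \<le> 239/1000" and N: "1 \<le> N" "N \<le> 2"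
  shows "((1 - N * x)^2 + (N-1) * (4761/10000)) * (1 - x) \<le> (1 + 11/10 * (4761/10000)) * (1 - 2 * x + N * x^2)^2"
proof -
  define c :: real where "c = 1 + 11/10 * (4761/10000)"
  define f where "f = (\<lambda>N. c * (1 - 2 * x + N * x^2)^2 - ((1 - N * x)^2 + (N-1) * (4761/10000)) * (1 - x))"
  have x2: "x^2 \<le> (239/1000)^2" using x by (intro power_mono) auto
  have f1: "0 \<le> f 1"
  proof -
    have "f 1 = (1-x)^3 * (c * (1 - x) - 1)"
      unfolding f_def by (simp add: field_simps power2_eq_square power3_eq_cube)
    moreover have "0 \<le> c * (1 - x) - 1" using x by (simp add: c_def)
    ultimately show ?thesis using x by simp
  qed
  have f2: "0 \<le> f 2"
  proof -
    have "f 2 = (c - 14761/10000) - (4 * c - 54761/10000) * x + x^2 * ((8 * c - 8) - (8 * c - 4) * x + 4 * c * x^2)"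
      unfolding f_def by (simp add: field_simps power2_eq_square power3_eq_cube)
    moreover have "25/10 * x^2 \<le> x^2 * ((8 * c - 8) - (8 * c - 4) * x + 4 * c * x^2)"
    proof -
      have "0 \<le> (x - 239/1000)^2" by simp
      then have "2 * (239/1000) * x - (239/1000)^2 \<le> x^2" by (simp add: power2_eq_square algebra_simps)
      then have "25/10 \<le> (8 * c - 8) - (8 * c - 4) * x + 4 * c * x^2" using x by (simp add: c_def power2_eq_square)
      then have "x^2 * (25/10) \<le> x^2 * ((8 * c - 8) - (8 * c - 4) * x + 4 * c * x^2)"
        by (intro mult_left_mono) auto
      then show ?thesis by (simp add: mult.commute)
    qed
    moreover have "0 \<le> (c - 14761/10000) - (4 * c - 54761/10000) * x + 25/10 * x^2"
    proof -
      have "0 \<le> (x - 30937/250000)^2" by simp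
      then show ?thesis by (simp add: c_def power2_eq_square algebra_simps)
    qed
    ultimately show ?thesis by linarith
  qed
  have "f N = (2-N) * f 1 + (N-1) * f 2 + x^2 * (1 - x - c * x^2) * ((N-1) * (2-N))"
    unfolding f_def by (simp add: field_simps power2_eq_square power3_eq_cube)
  moreover have "0 \<le> 1 - x - c * x^2" using x x2 by (simp add: c_def power2_eq_square)
  ultimately have "0 \<le> f N" using f1 f2 N by simp
  then show ?thesis by (simp add: f_def c_def)
qed

text \<open>Half of the left side over \<open>(E^2 + m)^2\<close> bounds the vortex part in the regime \<open>a \<le> 69/100\<close>, where \<open>T = a^2 \<le> (69/100)^2 = 4761/10000\<close>.
The hypothesis on \<open>E\<close> is the cone condition.\<close>

lemma vortex_polynomial_bound:
  fixes m E T :: real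
  assumes m: "0 \<le> m" "m \<le> 1" and E: "1 - (1+m) * T/2 \<le> E" "E \<le> 1" and T: "0 \<le> T" "T \<le> 4761/10000"
  shows "(1+m) * (E^2+m * T) * (E+m) \<le> (1 + 11/10 * T) * (E^2+m)^2"
proof -
  define N where "N = 1 + m"
  define x where "x = (1 - E) / N"
  have N: "1 \<le> N" "N \<le> 2" using m by (auto simp: N_def)
  have mE: "m = N - 1" "E = 1 - N * x" using N by (auto simp: N_def x_def)
  have x0: "0 \<le> x" using E N by (simp add: x_def)
  have xT: "2 * x \<le> T" using E N by (simp add: x_def N_def field_simps)
  have x1: "x \<le> 239/1000" using xT T by simp
  define f where "f = (\<lambda>T. (1 + 11/10 * T) * (1 - 2 * x + N * x^2)^2 - ((1 - N * x)^2 + (N-1) * T) * (1 - x))"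
  have Em: "E^2 + m = N * (1 - 2 * x + N * x^2)" "E + m = N * (1 - x)"
    by (simp_all add: mE power2_eq_square algebra_simps)
  have "f (2 * x) = (1 + 22/10 * x) * (1 - 2 * x + N * x^2)^2 - (1 - 2 * x + N^2 * x^2) * (1 - x)"
    unfolding f_def by (simp add: field_simps power2_eq_square power3_eq_cube)
  then have a: "0 \<le> f (2 * x)" using vortex_polynomial_left_end[OF x0 x1 N] by simp
  have b: "0 \<le> f (4761/10000)" using vortex_polynomial_right_end[OF x0 x1 N] unfolding f_def by simp
  have "(4761/10000 - 2 * x) * f T = (4761/10000 - T) * f (2 * x) + (T - 2 * x) * f (4761/10000)"
    unfolding f_def by (simp add: field_simps power2_eq_square power3_eq_cube)
  then have *: "0 \<le> (4761/10000 - 2 * x) * f T" using a b xT T by simp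
  have fT: "0 \<le> f T"
  proof (cases "2 * x = 4761/10000")
    case True
    then have "T = 4761/10000" using xT T by linarith
    then show ?thesis using b by metis
  next
    case False
    then have "0 < 4761/10000 - 2 * x" using xT T by linarith
    then show ?thesis using * by (simp add: zero_le_mult_iff)
  qed
  have "(1+m) * (E^2+m * T) * (E+m) = N^2 * (((1 - N * x)^2 + (N-1) * T) * (1 - x))"
    unfolding Em by (simp add: mE power2_eq_square algebra_simps)
  also have "\<dots> \<le> N^2 * ((1 + 11/10 * T) * (1 - 2 * x + N * x^2)^2)"
    using fT unfolding f_def by (intro mult_left_mono) auto
  also have "\<dots> = (1 + 11/10 * T) * (E^2+m)^2" unfolding Em by (simp add: power_mult_distrib)
  finally show ?thesis .
qed

text \<open>The denominator is expanded to first order, which is good enough because \<open>m * (a * r)^2 \<le> 1/16\<close>. The bound is linear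
in \<open>m\<close>.\<close>

lemma image_factor_le:
  fixes m r a :: real
  assumes m: "0 \<le> m" "m \<le> 1" and a: "0 < a" "a < 1" and r: "0 \<le> r" "r \<le> 1 - a"
  shows "(1 + m * r^2) * ((1 + a * r) * (1 - m * (a * r))) / (1 + m * (a * r)^2)^2
    \<le> 1 + a * r * (1 - m) * (1 + r^2) + m * r^2 - 8/3 * m * a^2 * r^2"
proof -
  define s where "s = a * r"
  define b where "b = s * (1 - m)"
  define x where "x = m * s^2"
  have s0: "0 \<le> s" using a r by (simp add: s_def)
  have "s \<le> a * (1 - a)" unfolding s_def using a r by (intro mult_left_mono) auto
  also have "\<dots> \<le> 1/4" using zero_le_power2[of "a - 1/2"] by (simp add: power2_eq_square algebra_simps)
  finally have s4: "s \<le> 1/4" .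
  have "s^2 \<le> (1/4)^2" using s0 s4 by (intro power_mono) auto
  then have "m * s^2 \<le> 1 * (1/4)^2" using m by (intro mult_mono) auto
  then have x: "0 \<le> x" "x \<le> 1/16" using m by (auto simp: x_def power2_eq_square)
  have b: "0 \<le> b" using m s0 by (simp add: b_def)
  have c: "0 \<le> 1 + b - 8/3 * x" using x b by simp
  have pos: "0 < (1 + x)^2" using x by simp
  have "1 + b - x \<le> (1 + b - 8/3 * x) * (1 + 2 * x)"
  proof -
    have "0 \<le> x * (1/3 + 2 * b - 16/3 * x)" using x b by simp
    then show ?thesis by (simp add: field_simps)
  qed
  also have "\<dots> \<le> (1 + b - 8/3 * x) * (1 + x)^2" using c by (intro mult_left_mono) (auto simp: power2_sum)
  finally have "(1 + b - x) / (1 + x)^2 \<le> 1 + b - 8/3 * x" using pos by (simp add: pos_divide_le_eq)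
  then have "(1 + m * r^2) * ((1 + b - x) / (1 + x)^2) \<le> (1 + m * r^2) * (1 + b - 8/3 * x)"
    using m by (intro mult_left_mono) auto
  also have "\<dots> \<le> 1 + b * (1 + r^2) + m * r^2 - 8/3 * x"
  proof -
    have "m * (r^2 * b) \<le> r^2 * b" using m b by (simp add: mult_left_le_one_le)
    moreover have "0 \<le> m * r^2 * x" using m x by simp
    ultimately show ?thesis by (simp add: field_simps)
  qed
  finally show ?thesis
    by (simp add: b_def x_def s_def power_mult_distrib algebra_simps power2_eq_square)
qed

lemma image_factor_le_linear:
  fixes m r a :: real
  assumes m: "0 \<le> m" "m \<le> 1" and a: "0 < a" "a < 1" and r: "0 \<le> r" "r \<le> 1 - a"
  shows "(1 + m * r^2) * ((1 + a * r) * (1 - m * (a * r))) / (1 + m * (a * r)^2)^2 \<le> 1 + r"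
proof -
  have "r^2 \<le> (1 - a)^2" using r by (intro power_mono) auto
  moreover have "(1 - a)^2 \<le> 1 - a" using a by (simp add: power2_eq_square mult_left_le)
  moreover have "a * (1 - a) \<le> 1 - a" using a by (simp add: mult_left_le_one_le)
  moreover have "a * r^2 \<le> a * (1 - a)" using calculation a by (intro mult_left_mono) auto
  ultimately have "a * (1 + r^2) \<le> 1" by (simp add: algebra_simps)
  then have "(a * (1 + r^2)) * (r * (1 - m)) \<le> 1 * (r * (1 - m))" using r m by (intro mult_right_mono) auto
  moreover have "r * (r * m) \<le> 1 * (r * m)" using r a m by (intro mult_right_mono) auto
  moreover have "0 \<le> m * a^2 * r^2" using m by simp
  ultimately have "1 + a * r * (1 - m) * (1 + r^2) + m * r^2 - 8/3 * m * a^2 * r^2 \<le> 1 + r"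
    by (simp add: algebra_simps power2_eq_square)
  then show ?thesis using image_factor_le[OF assms] by linarith
qed

text \<open>Here \<open>q = t / M\<close> and \<open>r = \<bar>p\<bar> / M\<close> for the half-angle tangents \<open>t\<close> and \<open>p\<close>, so \<open>q + r \<le> 1\<close> expresses that both points lie in the strip. For
\<open>\<eta>\<close> away from \<open>0\<close> this alone suffices: the vortex part is at most \<open>L * (q - a)\<close> with \<open>L \<ge> 1\<close>, the image part at most
\<open>1 + r\<close>, and so the worst case is \<open>q = 1\<close>, \<open>r = 0\<close>.\<close>

lemma kernel_far:
  fixes m a q r :: real
  assumes m: "0 \<le> m" "m \<le> 1" and a: "69/100 \<le> a" "a < 1"
    and q: "a < q" and r: "0 \<le> r" "q + r \<le> 1"
  shows "(1 + m * q^2) * (a + m * q) * (q - a) / (a^2 + m * q^2)^2 + 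
     (1 + m * r^2) * ((1 + a * r) * (1 - m * (a * r))) / (1 + m * (a * r)^2)^2 \<le> 2 + m/2 - 3/2 * m * a^2"
proof -
  define L where "L = (1 + m * a^2) / (a^3 * (1 + m))"
  have aa: "0 < a" "a^3 \<le> 1" "a^3 \<le> a^2" using a by (auto intro: power_le_one power_decreasing)
  have D: "0 < a^3 * (1 + m)" using aa m by simp
  have L1: "1 \<le> L"
  proof -
    have "m * a^3 \<le> m * a^2" using aa m by (intro mult_left_mono) auto
    then have "a^3 * (1 + m) \<le> 1 + m * a^2" using aa by (simp add: algebra_simps)
    then show ?thesis using D by (simp add: L_def)
  qed
  have q2: "a^2 \<le> q^2" using q aa by (intro power_mono) auto
  have S: "0 < a^2 + m * q^2" using aa m by (simp add: add_pos_nonneg)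
  have v1: "(1 + m * q^2) / (a^2 + m * q^2) \<le> (1 + m * a^2) / (a^2 * (1 + m))"
  proof -
    have "0 \<le> m * (q^2 - a^2) * (1 - a^2)" using m q2 a by (simp add: power_le_one)
    then have "(1 + m * q^2) * (a^2 * (1 + m)) \<le> (1 + m * a^2) * (a^2 + m * q^2)"
      by (simp add: algebra_simps)
    then show ?thesis using S aa m by (simp add: divide_simps)
  qed
  have v2: "(a + m * q) / (a^2 + m * q^2) \<le> 1 / a"
  proof -
    have "m * q * a \<le> m * q * q" using m q aa by (intro mult_left_mono) auto
    then show ?thesis using S aa by (simp add: divide_simps) (simp add: algebra_simps power2_eq_square)
  qed
  have "(1 + m * q^2) * (a + m * q) * (q - a) / (a^2 + m * q^2)^2
     = ((1 + m * q^2) / (a^2 + m * q^2)) * ((a + m * q) / (a^2 + m * q^2)) * (q - a)"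
    by (simp add: power2_eq_square)
  also have "\<dots> \<le> ((1 + m * a^2) / (a^2 * (1 + m))) * (1 / a) * (q - a)"
    using v1 v2 q aa m S by (intro mult_right_mono mult_mono) auto
  also have "\<dots> = L * (q - a)" by (simp add: L_def power2_eq_square power3_eq_cube)
  also have "\<dots> \<le> L * (1 - r - a)" using L1 r by (intro mult_left_mono) auto
  finally have V: "(1 + m * q^2) * (a + m * q) * (q - a) / (a^2 + m * q^2)^2 \<le> L * (1 - a) - L * r"
    by (simp add: algebra_simps)
  have "r \<le> L * r" using L1 r by (simp add: mult_le_cancel_right1)
  moreover have "L * (1 - a) \<le> 1 + m/2 - 3/2 * m * a^2"
    using far_coefficient_bound[OF m a] D by (simp add: L_def pos_divide_le_eq mult_ac)
  moreover have "(1 + m * r^2) * ((1 + a * r) * (1 - m * (a * r))) / (1 + m * (a * r)^2)^2 \<le> 1 + r"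
    using m a q r by (intro image_factor_le_linear) auto
  ultimately show ?thesis using V by linarith
qed

text \<open>For small \<open>\<eta>\<close> the vortex part is singular and the cone condition has to enter; it bounds \<open>q\<close> by
\<open>a / (1 - (1 + m) * a^2 / 2)\<close>, so \<open>q - a\<close> is of third order in \<open>a\<close>, which cancels the singularity.\<close>

lemma kernel_near:
  fixes m a q r :: real
  assumes m: "0 \<le> m" "m \<le> 1" and a: "0 < a" "a \<le> 69/100"
    and q: "a < q" "q * (1 - (1 + m) * a^2/2) \<le> a" and r: "0 \<le> r" "q + r \<le> 1"
  shows "(1 + m * q^2) * (a + m * q) * (q - a) / (a^2 + m * q^2)^2 + 
     (1 + m * r^2) * ((1 + a * r) * (1 - m * (a * r))) / (1 + m * (a * r)^2)^2 \<le> 2 + m/2 - 3/2 * m * a^2"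
proof -
  define T where "T = a^2"
\<comment> \<open>the ratio of \<open>\<eta>/2\<close> and the angle, both measured by their tangents; the cone keeps it close to \<open>1\<close>\<close>
  define E where "E = a / q"
  have T: "0 < T" "T \<le> 4761/10000" 
  proof -
    have "a^2 \<le> (69/100)^2" using a by (intro power_mono) auto
    then show "T \<le> 4761/10000" by (simp add: T_def power2_eq_square)
  qed (use a in \<open>simp add: T_def\<close>)
  have E: "0 < E" "E \<le> 1" "1 - (1+m) * T/2 \<le> E"
    using a q by (auto simp: E_def T_def field_simps)
  have qE: "q = a / E" using a q by (simp add: E_def)
  have S: "0 < E^2 + m" using E m by (simp add: add_pos_nonneg)
  define Y where "Y = (1+m) * (E^2+m * T) * (E+m) / (E^2+m)^2"
  have Y: "Y \<le> 1 + 11/10 * T"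
    using vortex_polynomial_bound[OF m E(3,2) _ T(2)] T S by (simp add: Y_def pos_divide_le_eq)
  have "(1 + m * q^2) * (a + m * q) * (q - a) / (a^2 + m * q^2)^2
      = (1 - E) / T * ((E^2+m * T) * (E+m) / (E^2+m)^2)"
  proof -
    have e1: "1 + m * q^2 = (E^2 + m * T) / E^2" using E by (simp add: qE T_def field_simps power_divide)
    have e2: "a + m * q = a * (E + m) / E" using E by (simp add: qE field_simps)
    have e3: "q - a = a * (1 - E) / E" using E by (simp add: qE field_simps)
    have e4: "a^2 + m * q^2 = T * (E^2 + m) / E^2" using E by (simp add: qE T_def field_simps power_divide)
    have "(1 + m * q^2) * (a + m * q) * (q - a) = (E^2 + m * T) * (E + m) * (1 - E) * T / E^4"
      unfolding e1 e2 e3 by (simp add: T_def power2_eq_square power4_eq_xxxx)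
    moreover have "(a^2 + m * q^2)^2 = T^2 * (E^2+m)^2 / E^4"
      unfolding e4 by (simp add: power_mult_distrib power_divide)
    ultimately show ?thesis using E T S by (simp add: power2_eq_square)
  qed
  also have "\<dots> \<le> (1+m)/2 * ((E^2+m * T) * (E+m) / (E^2+m)^2)"
    using E T m by (intro mult_right_mono) (auto simp: field_simps)
  also have "\<dots> = Y / 2" by (simp add: Y_def)
  finally have V: "(1 + m * q^2) * (a + m * q) * (q - a) / (a^2 + m * q^2)^2 \<le> 1/2 + 11/20 * T"
    using Y by linarith
  have ra: "r \<le> 1 - a" using q r by linarith
  have W: "(1 + m * r^2) * ((1 + a * r) * (1 - m * (a * r))) / (1 + m * (a * r)^2)^2
    \<le> 1 + a * r * (1 - m) * (1 + r^2) + m * r^2 - 8/3 * m * a^2 * r^2"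
    using m a ra r by (intro image_factor_le) auto
  have r2: "r^2 \<le> (1 - a)^2" using r ra by (intro power_mono) auto
  have m0: "11/20 * T + a * r * (1 + r^2) \<le> 1/2"
  proof -
    define b where "b = 69/100 - a"
    have b: "0 \<le> b" "a = 69/100 - b" using a by (auto simp: b_def)
    have "a * r * (1 + r^2) \<le> a * (1 - a) * (1 + (1-a)^2)"
      using a r ra r2 by (intro mult_mono) auto
    moreover have "1/2 - (11/20 * a^2 + a * (1 - a) * (1 + (1-a)^2))
       = 1/2 - (11/20 * (69/100)^2 + (69/100) * (31/100) * (1 + (31/100)^2))
         + b * (209864/1000000) + b^2 * (966/10000) + 24/100 * b^3 + b^4"
      unfolding b(2) by (simp add: field_simps power2_eq_square power3_eq_cube power4_eq_xxxx)
    moreover have "0 \<le> 1/2 - (11/20 * (69/100)^2 + (69/100) * (31/100) * (1 + (31/100)^2) :: real)"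
      by (simp add: power2_eq_square)
    moreover have "0 \<le> b * (209864/1000000)" "0 \<le> b^2 * (966/10000)" "0 \<le> 24/100 * b^3" "0 \<le> b^4"
      using b by auto
    ultimately show ?thesis unfolding T_def by linarith
  qed
  have m1: "11/20 * T + r^2 * (1 - 8/3 * T) \<le> 1 - 3/2 * T"
  proof (cases "T \<le> 3/8")
    case True
    have "a^2 \<le> (62/100)^2" using True by (simp add: T_def power2_eq_square)
    then have a6: "a \<le> 62/100" using a by (simp add: power_mono_iff)
    have "r^2 * (1 - 8/3 * T) \<le> (1-a)^2 * (1 - 8/3 * T)" using r2 True by (intro mult_right_mono) auto
    also have "\<dots> \<le> (1 - a)^2 * 1" using T by (intro mult_left_mono) auto
    finally have "r^2 * (1 - 8/3 * T) \<le> 1 - 2 * a + T" by (simp add: T_def power2_eq_square algebra_simps)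
    moreover have "T \<le> 62/100 * a" using a6 a by (simp add: T_def power2_eq_square)
    ultimately show ?thesis using a by simp
  next
    case False
    then have "r^2 * (1 - 8/3 * T) \<le> 0" by (simp add: mult_nonneg_nonpos)
    then show ?thesis using T by simp
  qed
  have "(1-m) * (11/20 * T + a * r * (1 + r^2)) + m * (11/20 * T + r^2 * (1 - 8/3 * T))
     \<le> (1-m) * (1/2) + m * (1 - 3/2 * T)"
    using m0 m1 m by (intro add_mono mult_left_mono) auto
  then have "11/20 * T + (a * r * (1 - m) * (1 + r^2) + m * r^2 - 8/3 * m * a^2 * r^2) \<le> 1/2 + m/2 - 3/2 * m * a^2"
    by (simp add: T_def field_simps)
  then show ?thesis using V W by (simp add: T_def)
qed

text \<open>The two parts of the kernel divided by \<open>1 - a^2\<close>, where \<open>a = tanh (\<eta>/2)\<close>, in terms of the tangents \<open>t\<close> and \<open>p\<close> of half of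
\<open>u - v\<close> and of \<open>u + v\<close>; see \<open>vortex_slope_half\<close> and \<open>image_slope_half\<close>.\<close>

definition vortex_factor :: "real \<Rightarrow> real \<Rightarrow> real \<Rightarrow> real" where
  "vortex_factor M a t = (1 + t^2) * (a + M * t) * (t - M * a) / (a^2 + t^2)^2"

definition image_factor :: "real \<Rightarrow> real \<Rightarrow> real \<Rightarrow> real" where
  "image_factor M a p = (1 + p^2) * (1 + M * a * p) * (M - a * p) / (1 + a^2 * p^2)^2"

text \<open>The worst signs are \<open>t \<ge> 0\<close> and \<open>p \<le> 0\<close>, because reversing a sign changes the numerator by a multiple of \<open>1 - M^2\<close>.\<close>

lemma vortex_factor_le_abs:
  assumes "0 \<le> M" "M \<le> 1" "0 < a"
  shows "vortex_factor M a t \<le> vortex_factor M a \<bar>t\<bar>"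
proof (cases "0 \<le> t")
  case False
  have "M^2 \<le> 1" using assms by (simp add: power_le_one)
  then have "0 \<le> a * (- t) * (1 - M^2)" using False assms by (intro mult_nonneg_nonneg) auto
  then have "(a + M * t) * (t - M * a) \<le> (a + M * (-t)) * ((-t) - M * a)"
    by (simp add: algebra_simps power2_eq_square)
  then have "(1 + t^2) * ((a + M * t) * (t - M * a)) \<le> (1 + t^2) * ((a + M * (-t)) * ((-t) - M * a))"
    by (intro mult_left_mono) auto
  then show ?thesis using False
    by (simp add: vortex_factor_def divide_right_mono mult.assoc)
qed (simp add: vortex_factor_def)

lemma image_factor_le_abs:
  assumes "0 \<le> M" "M \<le> 1" "0 < a"
  shows "image_factor M a p \<le> image_factor M a (- \<bar>p\<bar>)"
proof (cases "0 \<le> p")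
  case True
  have "M^2 \<le> 1" using assms by (simp add: power_le_one)
  then have "0 \<le> a * p * (1 - M^2)" using True assms by (intro mult_nonneg_nonneg) auto
  then have "(1 + M * a * p) * (M - a * p) \<le> (1 + M * a * (-p)) * (M - a * (-p))"
    by (simp add: algebra_simps power2_eq_square)
  then have "(1 + p^2) * ((1 + M * a * p) * (M - a * p)) \<le> (1 + p^2) * ((1 + M * a * (-p)) * (M - a * (-p)))"
    by (intro mult_left_mono) auto
  then show ?thesis using True
    by (simp add: image_factor_def divide_right_mono mult.assoc)
qed (simp add: image_factor_def)

lemma kernel_half_angle_bound:
  assumes M: "0 < M" "M \<le> 1" and a: "0 < a" "a < 1"
    and tp: "\<bar>t\<bar> + \<bar>p\<bar> \<le> M"
    and cone: "a \<le> 69/100 \<Longrightarrow> \<bar>t\<bar> * (1 - (1 + M^2) * a^2/2) \<le> M * a"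
  shows "vortex_factor M a t + image_factor M a p \<le> M * (2 + M^2/2 - 3/2 * M^2 * a^2)"
proof -
  define m where "m = M^2"
  define q where "q = \<bar>t\<bar> / M"
  define r where "r = \<bar>p\<bar> / M"
  define W where "W = (1 + m * r^2) * ((1 + a * r) * (1 - m * (a * r))) / (1 + m * (a * r)^2)^2"
  define V where "V = (1 + m * q^2) * (a + m * q) * (q - a) / (a^2 + m * q^2)^2"
  have m: "0 \<le> m" "m \<le> 1" using M by (auto simp: m_def power_le_one)
  have q0: "0 \<le> q" and r0: "0 \<le> r" and tq: "\<bar>t\<bar> = M * q" and pr: "\<bar>p\<bar> = M * r"
    using M by (auto simp: q_def r_def)
  have qr: "q + r \<le> 1" using tp M unfolding tq pr by (simp flip: distrib_left)
  have t2: "t^2 = m * q^2" by (metis tq m_def power_mult_distrib power2_abs)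
  have "vortex_factor M a \<bar>t\<bar> = M * V"
    unfolding vortex_factor_def power2_abs t2 unfolding tq V_def m_def
    by (simp add: algebra_simps power2_eq_square)
  moreover have "image_factor M a (-\<bar>p\<bar>) = M * W"
    unfolding image_factor_def power2_minus pr W_def m_def
    by (simp add: algebra_simps power2_eq_square)
  moreover have "V + W \<le> 2 + m/2 - 3/2 * m * a^2"
  proof (cases "q \<le> a")
    case True
    then have "V \<le> 0" unfolding V_def using m a q0
      by (intro divide_nonpos_nonneg mult_nonneg_nonpos) auto
    moreover have "W \<le> 2 + m/2 - 3/2 * m * a^2"
    proof -
      have "0 < 1 + m * (a * r)^2" using m by (simp add: add_pos_nonneg)
      then have "0 < (1 + m * (a * r)^2)^2" by simp
      then show ?thesis unfolding W_def using image_polynomial_bound[OF m r0 _ a] qr q0 by (simp add: pos_divide_le_eq)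
    qed
    ultimately show ?thesis by simp
  next
    case False
    show ?thesis
    proof (cases "a \<le> 69/100")
      case True
      have "M * (q * (1 - (1 + m) * a^2/2)) \<le> M * a" using cone[OF True] unfolding tq m_def by (simp add: mult.assoc)
      then have "q * (1 - (1 + m) * a^2/2) \<le> a" using M by simp
      then show ?thesis unfolding V_def W_def using False True m a r0 qr by (intro kernel_near) auto
    next
      case F2: False
      then show ?thesis unfolding V_def W_def using False m a r0 qr by (intro kernel_far) auto
    qed
  qed
  then have "M * V + M * W \<le> M * (2 + M^2/2 - 3/2 * M^2 * a^2)"
    using M unfolding m_def by (simp flip: distrib_left)
  ultimately show ?thesis
    using vortex_factor_le_abs[of M a t] image_factor_le_abs[of M a p] M a by linarith
qed

text \<open>An algebraic form of \<open>y \<le> M * x\<close>. The function \<open>arctan (M * Q (tanh x)) - M * x\<close>, with \<open>Q a = a / (1 - (1 + M^2) * a^2 / 2)\<close>, vanishes at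
\<open>0\<close> and increases as long as \<open>tanh x ^ 2 \<le> 1/2\<close>; hence \<open>tan y \<le> M * Q (tanh x)\<close>.\<close>

lemma tan_cone:
  assumes M: "0 < M" "M \<le> 1" and x: "0 \<le> x" "tanh x ^ 2 \<le> 1/2" and y: "0 \<le> y" "y \<le> M * x" "y < pi/2"
  shows "tan y * (1 - (1 + M^2) * tanh x ^ 2/2) \<le> M * tanh x"
proof -
  define k where "k = (1 + M^2)/2"
  have M2: "0 \<le> M^2" "M^2 \<le> 1" using M by (auto simp: power_le_one)
  have k: "0 < k" "k \<le> 1" using M2 by (simp_all add: k_def add_pos_nonneg)
  define D where "D = (\<lambda>z. 1 - k * tanh z ^ 2 :: real)"
  define h where "h = (\<lambda>z. arctan (M * (tanh z / D z)) - M * z)"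
  have Dpos: "0 < D z" if "0 \<le> z" "z \<le> x" for z
  proof -
    have "tanh z ^ 2 \<le> tanh x ^ 2" using that by (intro power_mono) auto
    then have "k * tanh z ^ 2 \<le> 1 * (1/2)" using x k by (intro mult_mono) auto
    then show ?thesis by (simp add: D_def)
  qed
  have "h 0 \<le> h x"
  proof (rule DERIV_nonneg_imp_nondecreasing[OF x(1)])
    fix z assume z: "0 \<le> z" "z \<le> x"
    have Dz: "0 < D z" using Dpos z by simp
    define a where "a = tanh z"
    have a2: "a^2 \<le> 1/2" unfolding a_def using power_mono[of "tanh z" "tanh x" 2] z x(2)
      by (metis order_trans tanh_real_le_iff tanh_real_nonneg_iff)
    have c: "cosh z \<noteq> 0" by simp
    let ?h = "M * ((1 - a^2) * (1 + k * a^2) / (D z)^2) / (1 + (M * (a / D z))^2) - M"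
    have "(D has_real_derivative (- (k * (2 * a * (1 - a^2))))) (at z)"
      unfolding D_def a_def using c by (auto intro!: derivative_eq_intros)
    moreover have "(tanh has_real_derivative (1 - a^2)) (at z)"
      unfolding a_def using c by (auto intro!: derivative_eq_intros)
    ultimately have "((\<lambda>z. tanh z / D z) has_real_derivative (((1 - a^2) * D z - a * (- (k * (2 * a * (1 - a^2))))) / (D z * D z))) (at z)"
      using Dz unfolding a_def by (intro DERIV_divide) auto
    moreover have "(1 - a^2) * D z - a * (- (k * (2 * a * (1 - a^2)))) = (1 - a^2) * (1 + k * a^2)"
      by (simp add: D_def a_def algebra_simps power2_eq_square)
    ultimately have q: "((\<lambda>z. tanh z / D z) has_real_derivative ((1 - a^2) * (1 + k * a^2) / (D z)^2)) (at z)"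
      by (simp add: power2_eq_square)
    have "(h has_real_derivative ?h) (at z)"
      unfolding h_def
      by (rule derivative_eq_intros q refl | simp add: a_def divide_simps)+
    moreover have "0 \<le> ?h"
    proof -
      have "a^2 * (k + k^2) \<le> 1/2 * (k + k^2)" using a2 k by (intro mult_right_mono) auto
      also have "\<dots> \<le> k" using k by (simp add: power2_eq_square mult_left_le)
      finally have "a^2 * (k + k^2) \<le> 3 * k - 2 * k" by simp
      then have "a^2 * (a^2 * (k + k^2)) \<le> a^2 * k" by (intro mult_left_mono) auto
      moreover have "(1 - a^2) * (1 + k * a^2) - ((D z)^2 + M^2 * a^2) = a^2 * k - a^2 * (a^2 * (k + k^2))"
      proof -
        have M2k: "M^2 = 2 * k - 1" by (simp add: k_def field_simps)
        show ?thesis unfolding M2k D_def a_def[symmetric] by (simp add: algebra_simps power2_eq_square)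
      qed
      ultimately have le: "(D z)^2 + M^2 * a^2 \<le> (1 - a^2) * (1 + k * a^2)" by linarith
      have "(1 - a^2) * (1 + k * a^2) / (D z)^2 / (1 + (M * (a / D z))^2)
         = (1 - a^2) * (1 + k * a^2) / ((D z)^2 + M^2 * a^2)"
      proof -
        have "1 + (M * (a / D z))^2 = ((D z)^2 + M^2 * a^2) / (D z)^2"
          using Dz by (simp add: field_simps power_divide power_mult_distrib)
        then show ?thesis using Dz by simp
      qed
      also have "\<dots> \<ge> 1" using le Dz by (simp add: add_pos_nonneg)
      finally have "1 \<le> (1 - a^2) * (1 + k * a^2) / (D z)^2 / (1 + (M * (a / D z))^2)" .
      then have "M * 1 \<le> M * ((1 - a^2) * (1 + k * a^2) / (D z)^2 / (1 + (M * (a / D z))^2))"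
        using M by (intro mult_left_mono) auto
      then show ?thesis by simp
    qed
    ultimately show "\<exists>y. (h has_real_derivative y) (at z) \<and> 0 \<le> y" by blast
  qed
  then have "y \<le> arctan (M * (tanh x / D x))" using y by (simp add: h_def)
  then have "tan y \<le> tan (arctan (M * (tanh x / D x)))"
    using y arctan_ubound by (intro tan_mono_le) (auto intro: less_le_trans[of _ 0])
  then have "tan y \<le> M * tanh x / D x" by (simp add: tan_arctan)
  then have "tan y * D x \<le> M * tanh x" using Dpos[of x] x by (simp add: pos_le_divide_eq)
  then show ?thesis by (simp add: D_def k_def mult.assoc)
qed

lemma tan_add_le:
  assumes "0 \<le> x" "0 \<le> y" "x + y < pi/2"
  shows "tan x + tan y \<le> tan (x + y)"
proof -
  have c: "0 < cos x" "0 < cos y" "0 < cos (x + y)" using assms by (auto intro!: cos_gt_zero_pi)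
  have s: "0 \<le> sin x" "0 \<le> sin y" "0 \<le> sin (x+y)" using assms pi_gt_zero by (auto intro!: sin_ge_zero)
  have "cos (x + y) \<le> cos x * cos y" using s by (simp add: cos_add)
  then have "sin (x+y) / (cos x * cos y) \<le> sin (x+y) / cos (x+y)" using s c by (intro divide_left_mono) auto
  then show ?thesis using c by (simp add: add_tan_eq) (simp add: tan_def)
qed

section \<open>The kernel inequality\<close>

text \<open>With \<open>z = \<eta> + i \<theta>\<close> and \<open>w = \<eta> + i \<phi>\<close> these are \<open>- Im ((1 + i M)^2 / sinh(z/2)^2) / 2\<close> and \<open>Im ((1 + i M)^2 / cosh(w/2)^2) / 2\<close>.\<close>

definition vortex_slope :: "real \<Rightarrow> real \<Rightarrow> real \<Rightarrow> real" where
  "vortex_slope M \<eta> \<theta> = (2 * M * (1 - cosh \<eta> * cos \<theta>) + (1 - M^2) * (sinh \<eta> * sin \<theta>)) / (cosh \<eta> - cos \<theta>)^2"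

definition image_slope :: "real \<Rightarrow> real \<Rightarrow> real \<Rightarrow> real" where
  "image_slope M \<eta> \<phi> = (2 * M * (1 + cosh \<eta> * cos \<phi>) - (1 - M^2) * (sinh \<eta> * sin \<phi>)) / (cosh \<eta> + cos \<phi>)^2"

text \<open>In the variable \<open>a = tanh (\<eta>/2)\<close> the measure \<open>(1 - a^2) d\<eta>\<close> is \<open>2 da\<close> and \<open>1 - 3 * a^2\<close> has mean \<open>0\<close> on \<open>[0, 1]\<close>, so the integral
over the line is \<open>8 * M\<close> for every multiple of \<open>1 - 3 * a^2\<close> in place of \<open>M^2/2 * (1 - 3 * a^2)\<close>. This multiple lifts the reference near
\<open>\<eta> = 0\<close>: there the kernel comes close to \<open>7/3 * M\<close> when \<open>M = 1\<close>, more than the constant \<open>2 * M\<close> would allow.\<close>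

definition ref_slope :: "real \<Rightarrow> real \<Rightarrow> real" where
  "ref_slope M \<eta> = (1 - tanh (\<eta>/2)^2) * (M * (2 + M^2/2 - 3/2 * M^2 * tanh (\<eta>/2)^2))"

lemma hyperbolic_half:
  fixes \<eta> :: real
  defines "a \<equiv> tanh (\<eta>/2)"
  shows "sinh \<eta> = 2 * a / (1 - a^2)" "cosh \<eta> = (1 + a^2) / (1 - a^2)" "a^2 < 1"
proof -
  let ?c = "cosh (\<eta>/2)" and ?s = "sinh (\<eta>/2)"
  have c: "0 < ?c" and id: "?c^2 - ?s^2 = 1" by (simp_all add: cosh_square_eq)
  have a: "a = ?s / ?c" by (simp add: a_def tanh_def)
  have e: "1 - a^2 = 1 / ?c^2" using c id unfolding a by (simp add: power_divide divide_simps)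
  then show "a^2 < 1" using c by (smt (verit) divide_pos_pos zero_less_power)
  show "sinh \<eta> = 2 * a / (1 - a^2)" unfolding e using c sinh_double[of "\<eta>/2"] by (simp add: a power2_eq_square)
  show "cosh \<eta> = (1 + a^2) / (1 - a^2)" unfolding e using c cosh_double[of "\<eta>/2"]
    by (simp add: a power_divide divide_simps)
qed

lemma trigonometric_half:
  fixes \<theta> :: real
  defines "t \<equiv> tan (\<theta>/2)"
  assumes c0: "cos (\<theta>/2) \<noteq> 0"
  shows "sin \<theta> = 2 * t / (1 + t^2)" "cos \<theta> = (1 - t^2) / (1 + t^2)"
proof -
  let ?c = "cos (\<theta>/2)" and ?s = "sin (\<theta>/2)"
  have id: "?c^2 + ?s^2 = 1" by simp
  have t: "t = ?s / ?c" by (simp add: t_def tan_def)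
  have e: "1 + t^2 = 1 / ?c^2" using c0 id unfolding t by (simp add: power_divide divide_simps)
  show "sin \<theta> = 2 * t / (1 + t^2)" unfolding e using c0 sin_double[of "\<theta>/2"] by (simp add: t power2_eq_square)
  show "cos \<theta> = (1 - t^2) / (1 + t^2)" unfolding e using c0 cos_double[of "\<theta>/2"]
    by (simp add: t power_divide divide_simps)
qed

lemma quotient_of_scaled:
  fixes X n s :: real
  assumes "X \<noteq> 0"
  shows "4 * n / X / (2 * s / X)^2 = X * n / s^2"
  using assms by (cases "s = 0") (auto simp: power2_eq_square field_simps)

lemma vortex_slope_half:
  assumes "cos (\<theta>/2) \<noteq> 0" "\<eta> \<noteq> 0"
  shows "vortex_slope M \<eta> \<theta> = (1 - tanh (\<eta>/2)^2) * vortex_factor M (tanh (\<eta>/2)) (tan (\<theta>/2))"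
proof -
  define a where "a = tanh (\<eta>/2)"
  define t where "t = tan (\<theta>/2)"
  define X where "X = (1 - a^2) * (1 + t^2)"
  have a: "a^2 < 1" "a \<noteq> 0" using hyperbolic_half(3)[of \<eta>] assms by (auto simp: a_def)
  have p: "1 - a^2 \<noteq> 0" "1 + t^2 \<noteq> 0" "X \<noteq> 0" using a by (auto simp: X_def add_nonneg_eq_0_iff)
  note h = hyperbolic_half[of \<eta>, folded a_def] trigonometric_half[OF assms(1), folded t_def]
  have e1: "cosh \<eta> - cos \<theta> = 2 * (a^2 + t^2) / X"
    unfolding h X_def using p by (simp add: divide_simps) (simp add: algebra_simps)
  have e2: "2 * M * (1 - cosh \<eta> * cos \<theta>) + (1 - M^2) * (sinh \<eta> * sin \<theta>) = 4 * ((a + M * t) * (t - M * a)) / X"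
    unfolding h X_def using p by (simp add: divide_simps) (simp add: algebra_simps power2_eq_square)
  have "vortex_slope M \<eta> \<theta> = X * ((a + M * t) * (t - M * a)) / (a^2 + t^2)^2"
    unfolding vortex_slope_def e1 e2 by (rule quotient_of_scaled[OF p(3)])
  then show ?thesis unfolding vortex_factor_def a_def[symmetric] t_def[symmetric] X_def by simp
qed

lemma image_slope_half:
  assumes "cos (\<phi>/2) \<noteq> 0"
  shows "image_slope M \<eta> \<phi> = (1 - tanh (\<eta>/2)^2) * image_factor M (tanh (\<eta>/2)) (tan (\<phi>/2))"
proof -
  define a where "a = tanh (\<eta>/2)"
  define t where "t = tan (\<phi>/2)"
  define X where "X = (1 - a^2) * (1 + t^2)"
  have a: "a^2 < 1" using hyperbolic_half(3)[of \<eta>] by (auto simp: a_def)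
  have p: "1 - a^2 \<noteq> 0" "1 + t^2 \<noteq> 0" "X \<noteq> 0" using a by (auto simp: X_def add_nonneg_eq_0_iff)
  note h = hyperbolic_half[of \<eta>, folded a_def] trigonometric_half[OF assms(1), folded t_def]
  have e1: "cosh \<eta> + cos \<phi> = 2 * (1 + a^2 * t^2) / X"
    unfolding h X_def using p by (simp add: divide_simps) (simp add: algebra_simps)
  have e2: "2 * M * (1 + cosh \<eta> * cos \<phi>) - (1 - M^2) * (sinh \<eta> * sin \<phi>) = 4 * ((1 + M * a * t) * (M - a * t)) / X"
    unfolding h X_def using p by (simp add: divide_simps) (simp add: algebra_simps power2_eq_square)
  have "image_slope M \<eta> \<phi> = X * ((1 + M * a * t) * (M - a * t)) / (1 + a^2 * t^2)^2"
    unfolding image_slope_def e1 e2 by (rule quotient_of_scaled[OF p(3)])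
  then show ?thesis unfolding image_factor_def a_def[symmetric] t_def[symmetric] X_def by simp
qed

lemma abs_tan_eq:
  assumes "\<bar>z\<bar> < pi/2" shows "\<bar>tan z\<bar> = tan \<bar>z\<bar>"
proof (cases "0 \<le> z")
  case True
  then show ?thesis using tan_pos_pi2_le[of z] assms by simp
next
  case False
  then have "0 \<le> tan (-z)" using tan_pos_pi2_le[of "-z"] assms by simp
  then show ?thesis using False by simp
qed

lemma kernel_bound_pos:
  assumes M: "0 < M" "M \<le> 1" and A: "A < pi/2" "tan A \<le> M" and uv: "\<bar>u\<bar> \<le> A" "\<bar>v\<bar> \<le> A"
    and \<eta>: "0 < \<eta>" "\<bar>u - v\<bar> \<le> M * \<eta>"
  shows "vortex_slope M \<eta> (u - v) + image_slope M \<eta> (u + v) \<le> ref_slope M \<eta>"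
proof -
  define a where "a = tanh (\<eta>/2)"
  define x where "x = \<bar>u - v\<bar>/2"
  define y where "y = \<bar>u + v\<bar>/2"
  have "\<bar>u - v\<bar> + \<bar>u + v\<bar> \<le> 2 * A" using uv by arith
  then have xy: "0 \<le> x" "0 \<le> y" "x + y \<le> A" by (simp_all add: x_def y_def)
  have a: "0 < a" "a < 1" using \<eta> tanh_real_lt_1 by (auto simp: a_def)
  have "x < pi/2" "y < pi/2" using xy A by linarith+
  then have tx: "\<bar>tan ((u - v)/2)\<bar> = tan x" "\<bar>tan ((u + v)/2)\<bar> = tan y"
    using abs_tan_eq[of "(u - v)/2"] abs_tan_eq[of "(u + v)/2"] by (simp_all add: x_def y_def)
  have "cos x > 0" "cos y > 0" using xy A by (auto intro!: cos_gt_zero_pi)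
  then have c: "cos ((u - v)/2) \<noteq> 0" "cos ((u + v)/2) \<noteq> 0"
    unfolding x_def y_def by (metis abs_divide abs_numeral cos_abs_real less_irrefl)+
  have "tan x + tan y \<le> tan (x + y)" using xy A by (intro tan_add_le) auto
  also have "\<dots> \<le> tan A" using xy A by (intro tan_mono_le) auto
  finally have J: "\<bar>tan ((u - v)/2)\<bar> + \<bar>tan ((u + v)/2)\<bar> \<le> M" using A tx by simp
  have "vortex_factor M a (tan ((u - v)/2)) + image_factor M a (tan ((u + v)/2)) \<le> M * (2 + M^2/2 - 3/2 * M^2 * a^2)"
  proof (rule kernel_half_angle_bound[OF M a J])
    assume "a \<le> 69/100"
    then have "a^2 \<le> (69/100)^2" using a by (intro power_mono) auto
    then have "tanh (\<eta>/2)^2 \<le> 1/2" by (simp add: a_def power2_eq_square)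
    then have "tan x * (1 - (1 + M^2) * tanh (\<eta>/2) ^ 2/2) \<le> M * tanh (\<eta>/2)"
      using M \<eta> xy A by (intro tan_cone) (auto simp: x_def)
    then show "\<bar>tan ((u - v)/2)\<bar> * (1 - (1 + M^2) * a^2/2) \<le> M * a" unfolding tx a_def .
  qed
  then have "(1 - a^2) * (vortex_factor M a (tan ((u - v)/2)) + image_factor M a (tan ((u + v)/2)))
     \<le> (1 - a^2) * (M * (2 + M^2/2 - 3/2 * M^2 * a^2))"
    using a by (intro mult_left_mono) (auto simp: power_le_one)
  then show ?thesis
    using vortex_slope_half[OF c(1), of \<eta> M] image_slope_half[OF c(2), of M \<eta>] \<eta>
    by (simp add: ref_slope_def a_def algebra_simps)
qed

text \<open>The heart of the proof. The kernel is even under \<open>(\<eta>, u, v) \<mapsto> (- \<eta>, - u, - v)\<close>.\<close>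

lemma kernel_bound:
  assumes M: "0 < M" "M \<le> 1" and A: "A < pi/2" "tan A \<le> M" and uv: "\<bar>u\<bar> \<le> A" "\<bar>v\<bar> \<le> A"
    and \<eta>: "\<eta> \<noteq> 0" "\<bar>u - v\<bar> \<le> M * \<bar>\<eta>\<bar>"
  shows "vortex_slope M \<eta> (u - v) + image_slope M \<eta> (u + v) \<le> ref_slope M \<eta>"
proof (cases "0 < \<eta>")
  case False
  have "vortex_slope M (-\<eta>) (-u - (-v)) + image_slope M (-\<eta>) (-u + (-v)) \<le> ref_slope M (-\<eta>)"
    using assms False by (intro kernel_bound_pos[where A=A]) auto
  moreover have "vortex_slope M (-\<eta>) (-u - (-v)) = vortex_slope M \<eta> (u - v)"
    using sin_minus[of "u - v"] cos_minus[of "u - v"] by (simp add: vortex_slope_def)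
  moreover have "image_slope M (-\<eta>) (-u + (-v)) = image_slope M \<eta> (u + v)"
    using sin_minus[of "u + v"] cos_minus[of "u + v"] by (simp add: image_slope_def)
  moreover have "ref_slope M (-\<eta>) = ref_slope M \<eta>" by (simp add: ref_slope_def)
  ultimately show ?thesis by simp
qed (use kernel_bound_pos[OF M A uv] \<eta> in auto)

section \<open>The velocity of one point in the field of another\<close>

text \<open>These are \<open>Im ((1 + i M) coth (z/2))\<close> and \<open>Im ((1 + i M) tanh (w/2))\<close>, the derivatives in the direction \<open>(1, M)\<close> of
\<open>2 arg (sinh (z/2))\<close> and \<open>2 arg (cosh (w/2))\<close>.\<close>

definition vortex_velocity :: "real \<Rightarrow> real \<Rightarrow> real \<Rightarrow> real" where
  "vortex_velocity M \<eta> \<theta> = (M * sinh \<eta> - sin \<theta>) / (cosh \<eta> - cos \<theta>)"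

definition image_velocity :: "real \<Rightarrow> real \<Rightarrow> real \<Rightarrow> real" where
  "image_velocity M \<eta> \<phi> = (M * sinh \<eta> + sin \<phi>) / (cosh \<eta> + cos \<phi>)"

definition velocity :: "real \<Rightarrow> real \<Rightarrow> real \<Rightarrow> real \<Rightarrow> real" where
  "velocity M \<eta> u v = vortex_velocity M \<eta> (u - v) + image_velocity M \<eta> (u + v)"

text \<open>The odd primitive of \<open>ref_slope\<close>; its limits at infinity are \<open>4 * M\<close> and \<open>- 4 * M\<close>.\<close>

definition ref_velocity :: "real \<Rightarrow> real \<Rightarrow> real" where
  "ref_velocity M \<eta> = M * (4 * tanh (\<eta>/2) + M^2 * (tanh (\<eta>/2) - tanh (\<eta>/2)^3))"

lemma cos_ge_parabola: "1 - x^2/2 \<le> cos (x::real)"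
proof -
  have "\<bar>sin (x/2)\<bar> \<le> \<bar>x/2\<bar>" by (rule abs_sin_x_le_abs_x)
  then have "\<bar>sin (x/2)\<bar>^2 \<le> \<bar>x/2\<bar>^2" by (intro power_mono) auto
  then have "sin (x/2)^2 \<le> (x/2)^2" by (simp only: power2_abs)
  moreover have "cos x = 1 - 2 * sin (x/2)^2" using cos_double_sin[of "x/2"] by simp
  ultimately show ?thesis by (simp add: power_divide)
qed

lemma sinh_ge_self: "0 \<le> x \<Longrightarrow> x \<le> sinh (x::real)"
proof -
  assume x: "0 \<le> x"
  have "sinh 0 - 0 \<le> sinh x - x"
    by (rule DERIV_nonneg_imp_nondecreasing[OF x])
       (auto intro!: derivative_eq_intros exI simp: cosh_real_ge_1)
  then show ?thesis by simp
qed

lemma cosh_ge_parabola: "1 + x^2/2 \<le> cosh (x::real)"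
proof -
  have "\<bar>x\<bar>/2 \<le> sinh (\<bar>x\<bar>/2)" by (rule sinh_ge_self) simp
  then have "(\<bar>x\<bar>/2)^2 \<le> sinh (\<bar>x\<bar>/2)^2" by (intro power_mono) auto
  moreover have "cosh \<bar>x\<bar> = 1 + 2 * sinh (\<bar>x\<bar>/2)^2"
    using cosh_double[of "\<bar>x\<bar>/2"] by (simp add: cosh_square_eq)
  ultimately show ?thesis by (simp add: power_divide)
qed

lemma cosh_gt_1: "x \<noteq> 0 \<Longrightarrow> 1 < cosh (x::real)"
  using cosh_ge_parabola[of x] by (smt (verit) half_gt_zero zero_less_power2)

lemma cosh_gt_cos: "\<eta> \<noteq> 0 \<Longrightarrow> cos \<theta> < cosh (\<eta>::real)"
  using cosh_gt_1[of \<eta>] cos_le_one[of \<theta>] by linarith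

lemma velocity_minus: "velocity M (-\<eta>) (-u) (-v) = - velocity M \<eta> u v"
proof -
  have "vortex_velocity M (-\<eta>) (-(u-v)) = - vortex_velocity M \<eta> (u-v)"
    "image_velocity M (-\<eta>) (-(u+v)) = - image_velocity M \<eta> (u+v)"
    unfolding vortex_velocity_def image_velocity_def sin_minus cos_minus cosh_minus sinh_minus
    by (simp_all add: minus_divide_left)
  moreover have "- (u - v) = - u - (- v)" "- (u + v) = - u + (- v)" by simp_all
  ultimately show ?thesis unfolding velocity_def by (metis minus_add_distrib)
qed

lemma ref_velocity_minus: "ref_velocity M (-\<eta>) = - ref_velocity M \<eta>"
  by (simp add: ref_velocity_def algebra_simps)

lemma line_derivative_algebra:
  fixes M C S c s :: real
  shows "(M * C - M * c) * (C - c) - (M * S - s) * (S + M * s)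
     = M * ((C^2 - S^2) + (s^2 + c^2)) - 2 * M * (C * c) + (1 - M^2) * (S * s)"
    and "(M * C + M * c) * (C + c) - (M * S + s) * (S - M * s)
     = M * ((C^2 - S^2) + (s^2 + c^2)) + 2 * M * (C * c) - (1 - M^2) * (S * s)"
  by (simp_all add: algebra_simps power2_eq_square)

lemma vortex_velocity_along_line:
  assumes "s \<noteq> 0"
  shows "((\<lambda>s. vortex_velocity M s (c + M * s)) has_real_derivative vortex_slope M s (c + M * s)) (at s)"
proof -
  define x where "x = c + M * s"
  have nz: "cosh s - cos x \<noteq> 0" using cosh_gt_cos[OF assms, of x] by simp
  have id: "cosh s ^ 2 - sinh s ^ 2 = 1" "sin x ^ 2 + cos x ^ 2 = 1" by (simp_all add: cosh_square_eq)
  have "((\<lambda>s. vortex_velocity M s (c + M * s)) has_real_derivative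
    ((M * cosh s - M * cos x) * (cosh s - cos x) - (M * sinh s - sin x) * (sinh s + M * sin x)) / ((cosh s - cos x) * (cosh s - cos x))) (at s)"
    unfolding vortex_velocity_def using nz unfolding x_def
    by (auto intro!: derivative_eq_intros simp: algebra_simps)
  moreover have "(M * cosh s - M * cos x) * (cosh s - cos x) - (M * sinh s - sin x) * (sinh s + M * sin x)
     = M * ((cosh s ^ 2 - sinh s ^ 2) + (sin x ^ 2 + cos x ^ 2)) - 2 * M * (cosh s * cos x) + (1 - M^2) * (sinh s * sin x)"
    by (rule line_derivative_algebra)
  moreover have "(M * (1 + 1) - 2 * M * (cosh s * cos x) + (1 - M^2) * (sinh s * sin x)) / ((cosh s - cos x) * (cosh s - cos x)) = vortex_slope M s x"
    by (simp add: vortex_slope_def algebra_simps power2_eq_square)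
  ultimately show ?thesis unfolding id x_def[symmetric] by metis
qed

lemma image_velocity_along_line:
  assumes "cosh s + cos (c + M * s) \<noteq> 0"
  shows "((\<lambda>s. image_velocity M s (c + M * s)) has_real_derivative image_slope M s (c + M * s)) (at s)"
proof -
  define x where "x = c + M * s"
  have nz: "cosh s + cos x \<noteq> 0" using assms by (simp add: x_def)
  have id: "cosh s ^ 2 - sinh s ^ 2 = 1" "sin x ^ 2 + cos x ^ 2 = 1" by (simp_all add: cosh_square_eq)
  have "((\<lambda>s. image_velocity M s (c + M * s)) has_real_derivative
    ((M * cosh s + M * cos x) * (cosh s + cos x) - (M * sinh s + sin x) * (sinh s - M * sin x)) / ((cosh s + cos x) * (cosh s + cos x))) (at s)"
    unfolding image_velocity_def using nz unfolding x_def
    by (auto intro!: derivative_eq_intros simp: algebra_simps)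
  moreover have "(M * cosh s + M * cos x) * (cosh s + cos x) - (M * sinh s + sin x) * (sinh s - M * sin x)
     = M * ((cosh s ^ 2 - sinh s ^ 2) + (sin x ^ 2 + cos x ^ 2)) + 2 * M * (cosh s * cos x) - (1 - M^2) * (sinh s * sin x)"
    by (rule line_derivative_algebra)
  moreover have "(M * (1 + 1) + 2 * M * (cosh s * cos x) - (1 - M^2) * (sinh s * sin x)) / ((cosh s + cos x) * (cosh s + cos x)) = image_slope M s x"
    by (simp add: image_slope_def algebra_simps power2_eq_square)
  ultimately show ?thesis unfolding id x_def[symmetric] by metis
qed

lemma ref_velocity_deriv: "(ref_velocity M has_real_derivative ref_slope M \<eta>) (at \<eta>)"
proof -
  have "cosh (\<eta>/2) \<noteq> 0" by simp
  then show ?thesis unfolding ref_velocity_def[abs_def] ref_slope_def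
    by (auto intro!: derivative_eq_intros simp: field_simps power2_eq_square)
qed

lemma cos_add_nonneg:
  assumes "\<bar>u\<bar> \<le> A" "\<bar>v\<bar> \<le> A" "A \<le> pi/4"
  shows "0 \<le> cos (u + v)"
  using assms by (intro cos_ge_zero) auto

lemma angle_le_quarter:
  assumes "0 \<le> A" "A < pi/2" "tan A \<le> 1" shows "A \<le> pi/4"
proof (rule ccontr)
  assume "\<not> A \<le> pi/4"
  then have "tan (pi/4) < tan A" using assms by (intro tan_monotone) auto
  then show False using assms by (simp add: tan_45)
qed

lemma velocity_minus_ref_decreasing:
  assumes M: "0 < M" "M \<le> 1" and A: "0 \<le> A" "A < pi/2" "tan A \<le> M"
    and s: "s2 \<le> s1" and v: "\<bar>v\<bar> \<le> A"
    and cone: "\<And>s. s2 \<le> s \<Longrightarrow> s \<le> s1 \<Longrightarrow> s \<noteq> 0 \<and> \<bar>c + M * s\<bar> \<le> A \<and> \<bar>c + M * s - v\<bar> \<le> M * \<bar>s\<bar>"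
  shows "velocity M s1 (c + M * s1) v - ref_velocity M s1 \<le> velocity M s2 (c + M * s2) v - ref_velocity M s2"
proof (rule DERIV_nonpos_imp_nonincreasing[OF s])
  fix s assume s: "s2 \<le> s" "s \<le> s1"
  have A4: "A \<le> pi/4" using angle_le_quarter A M by simp
  have e: "c + M * s - v = (c - v) + M * s" "c + M * s + v = (c + v) + M * s" for s by simp_all
  have "0 \<le> cos (c + M * s + v)" using cone[OF s] v A4 by (intro cos_add_nonneg[where A=A]) auto
  then have nz: "cosh s + cos ((c + v) + M * s) \<noteq> 0" unfolding e
    using cosh_real_pos[of s] by linarith
  have "((\<lambda>s. velocity M s (c + M * s) v - ref_velocity M s) has_real_derivative
     vortex_slope M s ((c - v) + M * s) + image_slope M s ((c + v) + M * s) - ref_slope M s) (at s)"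
    unfolding velocity_def e using cone[OF s] nz
    by (intro DERIV_diff DERIV_add vortex_velocity_along_line image_velocity_along_line ref_velocity_deriv) auto
  moreover have "vortex_slope M s (c + M * s - v) + image_slope M s (c + M * s + v) \<le> ref_slope M s"
    using cone[OF s] v by (intro kernel_bound[OF M A(2,3)]) auto
  ultimately show "\<exists>y. ((\<lambda>s. velocity M s (c + M * s) v - ref_velocity M s) has_real_derivative y) (at s) \<and> y \<le> 0"
    unfolding e by (intro exI conjI) auto
qed

lemma vortex_velocity_on_diagonal:
  assumes "0 < M"
  shows "((\<lambda>s. vortex_velocity M s (M * s)) \<longlongrightarrow> 0) (at 0)"
proof (rule Lim_null_comparison)
  let ?g = "\<lambda>x::real. (x - sin x) / x^2"
  have g: "(?g \<longlongrightarrow> 0) (at 0)" by real_asymp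
  have "filterlim (\<lambda>s. M * s) (at 0) (at 0)"
    using assms by (auto simp: filterlim_at intro!: tendsto_eq_intros eventually_at_topological[THEN iffD2] exI[of _ UNIV])
  then have g2: "((\<lambda>s. ?g (M * s)) \<longlongrightarrow> 0) (at 0)" using g by (rule filterlim_compose[rotated])
  have h: "((\<lambda>s. (sinh s - s) / s^2) \<longlongrightarrow> (0::real)) (at 0)" by real_asymp
  show "((\<lambda>s. 2 * (M * \<bar>(sinh s - s) / s^2\<bar> + M^2 * \<bar>?g (M * s)\<bar>)) \<longlongrightarrow> 0) (at 0)"
  proof -
    have "((\<lambda>s. 2 * (M * \<bar>(sinh s - s) / s^2\<bar> + M^2 * \<bar>?g (M * s)\<bar>)) \<longlongrightarrow> 2 * (M * \<bar>0\<bar> + M^2 * \<bar>0\<bar>)) (at 0)"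
      by (intro tendsto_intros g2 h)
    then show ?thesis by simp
  qed
  have "norm (vortex_velocity M s (M * s)) \<le> 2 * (M * \<bar>(sinh s - s) / s^2\<bar> + M^2 * \<bar>?g (M * s)\<bar>)" if s: "s \<noteq> 0" for s
  proof -
    define N where "N = M * (sinh s - s) + (M * s - sin (M * s))"
    have "s^2/2 \<le> cosh s - cos (M * s)" using cosh_ge_parabola[of s] cos_le_one[of "M * s"] by linarith
    then have "\<bar>N\<bar> / (cosh s - cos (M * s)) \<le> \<bar>N\<bar> / (s^2/2)" using s cosh_gt_cos[OF s, of "M * s"] by (intro divide_left_mono mult_pos_pos) auto
    moreover have "\<bar>vortex_velocity M s (M * s)\<bar> = \<bar>N\<bar> / (cosh s - cos (M * s))"
      using cosh_gt_cos[OF s, of "M * s"] by (simp add: vortex_velocity_def N_def algebra_simps)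
    moreover have "\<bar>N\<bar> / (s^2/2) \<le> 2 * (\<bar>M * (sinh s - s)\<bar> + \<bar>M * s - sin (M * s)\<bar>) / s^2"
    proof -
      have "\<bar>N\<bar> \<le> \<bar>M * (sinh s - s)\<bar> + \<bar>M * s - sin (M * s)\<bar>" unfolding N_def by (rule abs_triangle_ineq)
      then have "\<bar>N\<bar> / s^2 \<le> (\<bar>M * (sinh s - s)\<bar> + \<bar>M * s - sin (M * s)\<bar>) / s^2" by (intro divide_right_mono) auto
      moreover have "\<bar>N\<bar> / (s^2/2) = 2 * (\<bar>N\<bar> / s^2)" by simp
      ultimately show ?thesis by (metis mult_left_mono times_divide_eq_right zero_le_numeral)
    qed
    moreover have "2 * (\<bar>M * (sinh s - s)\<bar> + \<bar>M * s - sin (M * s)\<bar>) / s^2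
      = 2 * (M * \<bar>(sinh s - s) / s^2\<bar> + M^2 * \<bar>?g (M * s)\<bar>)"
      using s assms by (simp add: abs_mult power_mult_distrib add_divide_distrib)
    ultimately show ?thesis by simp
  qed
  then show "\<forall>\<^sub>F s in at 0. norm (vortex_velocity M s (M * s)) \<le> 2 * (M * \<bar>(sinh s - s) / s^2\<bar> + M^2 * \<bar>?g (M * s)\<bar>)"
    by (auto simp: eventually_at_filter)
qed

text \<open>The line of slope \<open>M\<close> through the singular point itself. On it \<open>z\<close> is a real multiple of \<open>1 + i M\<close>, so the singular
part of \<open>(1 + i M) coth (z/2)\<close> is real and the velocity extends continuously.\<close>

lemma velocity_minus_ref_through_point:
  assumes M: "0 < M" "M \<le> 1" and A: "0 \<le> A" "A < pi/2" "tan A \<le> M"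
    and s: "s2 < 0" "0 < s1" and u: "\<bar>v + M * s1\<bar> \<le> A" "\<bar>v + M * s2\<bar> \<le> A"
  shows "velocity M s1 (v + M * s1) v - ref_velocity M s1 \<le> velocity M s2 (v + M * s2) v - ref_velocity M s2"
proof -
  have A4: "A \<le> pi/4" using angle_le_quarter A M by simp
  have line: "\<bar>v + M * s\<bar> \<le> A" if "s2 \<le> s" "s \<le> s1" for s
  proof -
    have "M * s2 \<le> M * s" "M * s \<le> M * s1" using that M by auto
    then show ?thesis using u by linarith
  qed
  have v: "\<bar>v\<bar> \<le> A" using line[of 0] s by simp
  define h where "h = (\<lambda>s. velocity M s (v + M * s) v - ref_velocity M s)"
  define L where "L = image_velocity M 0 (v + v)"
  have lim: "(h \<longlongrightarrow> L) (at 0)"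
  proof -
    have "0 \<le> cos (v + v)" using v A4 by (intro cos_add_nonneg[where A=A]) auto
    then have nz: "cosh 0 + cos ((v + v) + M * 0) \<noteq> 0" by simp
    have "isCont (\<lambda>s. image_velocity M s ((v + v) + M * s)) 0"
      using image_velocity_along_line[OF nz] by (rule DERIV_isCont)
    then have i: "((\<lambda>s. image_velocity M s ((v + v) + M * s)) \<longlongrightarrow> L) (at 0)"
      by (simp add: isCont_def L_def)
    have "isCont (ref_velocity M) 0" using ref_velocity_deriv by (rule DERIV_isCont)
    then have r: "(ref_velocity M \<longlongrightarrow> 0) (at 0)" by (simp add: isCont_def ref_velocity_def)
    have "((\<lambda>s. vortex_velocity M s (M * s) + image_velocity M s ((v + v) + M * s) - ref_velocity M s) \<longlongrightarrow> 0 + L - 0) (at 0)"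
      by (intro tendsto_intros vortex_velocity_on_diagonal M i r)
    then show ?thesis by (simp add: h_def velocity_def algebra_simps)
  qed
  have right: "h s1 \<le> h s" if "0 < s" "s \<le> s1" for s
    unfolding h_def using that s line v M
    by (intro velocity_minus_ref_decreasing[OF M A]) (auto simp: abs_mult)
  have left: "h s \<le> h s2" if "s < 0" "s2 \<le> s" for s
    unfolding h_def using that s line v M
    by (intro velocity_minus_ref_decreasing[OF M A]) (auto simp: abs_mult)
  have "h s1 \<le> L"
  proof (rule tendsto_lowerbound)
    show "(h \<longlongrightarrow> L) (at_right 0)" using lim by (rule filterlim_mono) (auto simp: at_within_le_at)
    show "\<forall>\<^sub>F s in at_right 0. h s1 \<le> h s"
      using eventually_at_right_real[OF s(2)] by eventually_elim (use right in auto)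
  qed auto
  moreover have "L \<le> h s2"
  proof (rule tendsto_upperbound)
    show "(h \<longlongrightarrow> L) (at_left 0)" using lim by (rule filterlim_mono) (auto simp: at_within_le_at)
    show "\<forall>\<^sub>F s in at_left 0. h s \<le> h s2"
      using eventually_at_left_real[OF s(1)] by eventually_elim (use left in auto)
  qed auto
  ultimately show ?thesis by (simp add: h_def)
qed

lemma sin_ge_three_quarters:
  assumes "0 \<le> x" "x \<le> 3/8" shows "3/4 * x \<le> sin (x::real)"
proof -
  have "sin 0 - 3/4 * 0 \<le> sin x - 3/4 * x"
  proof (rule DERIV_nonneg_imp_nondecreasing[OF assms(1)])
    fix z assume z: "0 \<le> z" "z \<le> x"
    have "z^2 \<le> (3/8)^2" using z assms by (intro power_mono) auto
    then have "3/4 \<le> cos z" using cos_ge_parabola[of z] by (simp add: power2_eq_square)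
    then show "\<exists>y. ((\<lambda>x. sin x - 3/4 * x) has_real_derivative y) (at z) \<and> 0 \<le> y"
      by (intro exI[of _ "cos z - 3/4"]) (auto intro!: derivative_eq_intros)
  qed
  then show ?thesis by simp
qed

text \<open>Near a graph that is tangent to the line of slope \<open>M\<close>, moving a point upwards lowers the vortex velocity.\<close>

lemma vortex_numerator_near:
  fixes M \<eta> \<theta> :: real
  assumes M: "0 < M" "M \<le> 1" and \<eta>: "\<bar>\<eta>\<bar> \<le> 1/4" and near: "\<bar>\<theta> - M * \<eta>\<bar> \<le> M/2 * \<bar>\<eta>\<bar>"
  shows "1 \<le> cosh \<eta> * cos \<theta> + M * (sinh \<eta> * sin \<theta>)"
proof -
  have pos: "1 \<le> cosh e * cos x + M * (sinh e * sin x)"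
    if e: "0 \<le> e" "e \<le> 1/4" and x: "M/2 * e \<le> x" "x \<le> 3/2 * M * e" for e x :: real
  proof -
    have Me: "M * e \<le> 1 * (1/4)" using M e by (intro mult_mono) auto
    have x0: "0 \<le> x" using x M e by (meson order_trans mult_nonneg_nonneg less_imp_le half_gt_zero)
    have x8: "x \<le> 3/8" using x Me by simp
    have xe: "x \<le> 3/2 * e" using x mult_right_mono[of M 1 e] M e by linarith
    have "x^2 \<le> (3/8)^2" "x^2 \<le> (3/2 * e)^2" using x0 x8 xe by (intro power_mono; simp)+
    then have x2: "x^2 \<le> 9/64" "x^2 \<le> 9/4 * e^2" by (simp_all add: power2_eq_square)
    have "(1 + e^2/2) * (1 - x^2/2) \<le> cosh e * cos x"
      using cosh_ge_parabola[of e] cos_ge_parabola[of x] x2 by (intro mult_mono) auto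
    then have f1: "1 + e^2/2 - x^2/2 - e^2 * x^2/4 \<le> cosh e * cos x" by (simp add: algebra_simps)
    have "e * (3/4 * x) \<le> sinh e * sin x"
      using sinh_ge_self[of e] sin_ge_three_quarters[of x] e x0 x8 by (intro mult_mono) auto
    then have "M * (e * (3/4 * x)) \<le> M * (sinh e * sin x)" using M by (intro mult_left_mono) auto
    moreover have "x * x \<le> 3/2 * M * e * x" using x x0 by (intro mult_right_mono) auto
    ultimately have f2: "x^2/2 \<le> M * (sinh e * sin x)" by (simp add: algebra_simps power2_eq_square)
    have f3: "e^2 * x^2 \<le> e^2 * (9/64)" using x2 by (intro mult_left_mono) auto
    have f4: "0 \<le> e^2" by simp
    show ?thesis using f1 f2 f3 f4 by linarith
  qed
  show ?thesis
  proof (cases "0 \<le> \<eta>")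
    case True
    then have "\<bar>\<theta> - M * \<eta>\<bar> \<le> M/2 * \<eta>" using near by simp
    then have "M/2 * \<eta> \<le> \<theta>" "\<theta> \<le> 3/2 * M * \<eta>" unfolding abs_le_iff by linarith+
    then show ?thesis using True \<eta> by (intro pos) auto
  next
    case False
    have "1 \<le> cosh (-\<eta>) * cos (-\<theta>) + M * (sinh (-\<eta>) * sin (-\<theta>))"
    proof -
      have "\<bar>\<theta> - M * \<eta>\<bar> \<le> M/2 * (- \<eta>)" using near False by simp
      then have "M/2 * (- \<eta>) \<le> - \<theta>" "- \<theta> \<le> 3/2 * M * (- \<eta>)" unfolding abs_le_iff by linarith+
      then show ?thesis using False \<eta> by (intro pos) auto
    qed
    then show ?thesis by simp
  qed
qed

text \<open>A bound for the vertical derivative of the velocity times \<open>cosh \<eta>\<close>: the image contributes at most \<open>3\<close>, the vortex at distance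
at least \<open>\<eta>0\<close> at most the quotient.\<close>

definition vertical_const :: "real \<Rightarrow> real" where
  "vertical_const \<eta>0 = 3 + 3 / (1 - 1 / cosh \<eta>0)^2"

text \<open>Moving the point upwards by a small amount costs at most a constant times that amount, uniformly up to the singularity,
because close to it the vortex part has the favourable sign.\<close>

lemma vertical_move:
  assumes M: "0 < M" "M \<le> 1" and \<eta>0: "0 < \<eta>0" "\<eta>0 \<le> 1/4" and B: "B * \<eta>0 \<le> M/2" "0 \<le> B"
    and \<eta>: "\<eta> \<noteq> 0" and u: "ua \<le> ub"
    and adm: "\<And>u. ua \<le> u \<Longrightarrow> u \<le> ub \<Longrightarrow> 0 \<le> cos (u + v) \<and> (\<eta>0 \<le> \<bar>\<eta>\<bar> \<or> \<bar>u - v - M * \<eta>\<bar> \<le> B * \<eta>^2)"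
  shows "velocity M \<eta> ub v - velocity M \<eta> ua v \<le> vertical_const \<eta>0 * (ub - ua) / cosh \<eta>"
proof -
  define K where "K = vertical_const \<eta>0"
  define f where "f = (\<lambda>u. velocity M \<eta> u v - K / cosh \<eta> * u)"
  have "f ub \<le> f ua"
  proof (rule DERIV_nonpos_imp_nonincreasing[OF u])
    fix u assume "ua \<le> u" "u \<le> ub"
    note a = adm[OF this]
    define x where "x = u - v"
    define p where "p = u + v"
    define C where "C = cosh \<eta>"
    define S where "S = sinh \<eta>"
    have C: "1 < C" "\<bar>S\<bar> \<le> C" using \<eta> sinh_less_cosh_real[of "\<bar>\<eta>\<bar>"] by (auto simp: C_def S_def cosh_gt_1)
    have nz: "C - cos x \<noteq> 0" "C + cos p \<noteq> 0"
      using cosh_gt_cos[OF \<eta>, of x] a C by (auto simp: C_def p_def)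
    have id: "sin y * sin y = 1 - cos y * cos y" for y :: real
      using sin_squared_eq[of y] by (simp add: power2_eq_square)
    have "((\<lambda>u. velocity M \<eta> u v) has_real_derivative
        (- cos x * (C - cos x) - (M * S - sin x) * sin x) / ((C - cos x) * (C - cos x))
       + (cos p * (C + cos p) - (M * S + sin p) * (- sin p)) / ((C + cos p) * (C + cos p))) (at u)"
      unfolding velocity_def vortex_velocity_def image_velocity_def using nz unfolding x_def p_def C_def S_def
      by (auto intro!: derivative_eq_intros)
    moreover have "- cos x * (C - cos x) - (M * S - sin x) * sin x = 1 - (C * cos x + M * (S * sin x))"
      by (simp add: algebra_simps id)
    moreover have "cos p * (C + cos p) - (M * S + sin p) * (- sin p) = 1 + (C * cos p + M * (S * sin p))"
      by (simp add: algebra_simps id)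
    ultimately have d: "((\<lambda>u. velocity M \<eta> u v) has_real_derivative
        (1 - (C * cos x + M * (S * sin x))) / (C - cos x)^2 + (1 + (C * cos p + M * (S * sin p))) / (C + cos p)^2) (at u)"
      by (simp add: power2_eq_square)
    have size: "\<bar>C * cos y + M * (S * sin y)\<bar> \<le> 2 * C" for y
    proof -
      have "\<bar>C * cos y\<bar> \<le> C * 1" using C unfolding abs_mult by (intro mult_mono) auto
      moreover have "\<bar>M * (S * sin y)\<bar> \<le> 1 * (C * 1)" using M C unfolding abs_mult by (intro mult_mono) auto
      ultimately show ?thesis by linarith
    qed
    have "(1 + (C * cos p + M * (S * sin p))) / (C + cos p)^2 \<le> (3 * C) / C^2"
    proof (intro frac_le)
      show "1 + (C * cos p + M * (S * sin p)) \<le> 3 * C" using size[of p] C by linarith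
      show "C^2 \<le> (C + cos p)^2" using C a by (intro power_mono) (auto simp: p_def)
    qed (use C in auto)
    then have img: "(1 + (C * cos p + M * (S * sin p))) / (C + cos p)^2 \<le> 3 / C"
      using C by (simp add: power2_eq_square)
    have vor: "(1 - (C * cos x + M * (S * sin x))) / (C - cos x)^2 \<le> (K - 3) / C"
    proof (cases "\<eta>0 \<le> \<bar>\<eta>\<bar>")
      case True
      define q where "q = 1 - 1 / cosh \<eta>0"
      have q: "0 < q" using \<eta>0 by (simp add: q_def cosh_gt_1)
      have "cosh \<eta>0 \<le> cosh \<bar>\<eta>\<bar>" using True \<eta>0 by (subst cosh_real_nonneg_le_iff) auto
      then have "cosh \<eta>0 \<le> C" by (simp add: C_def)
      then have "1 \<le> C / cosh \<eta>0" by simp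
      then have "cos x \<le> C / cosh \<eta>0" using cos_le_one[of x] by linarith
      then have qC: "q * C \<le> C - cos x" unfolding q_def by (simp add: algebra_simps)
      have "(1 - (C * cos x + M * (S * sin x))) / (C - cos x)^2 \<le> (3 * C) / (q * C)^2"
      proof (intro frac_le)
        show "1 - (C * cos x + M * (S * sin x)) \<le> 3 * C" using size[of x] C by linarith
        show "(q * C)^2 \<le> (C - cos x)^2" using C q qC by (intro power_mono) auto
      qed (use C q in auto)
      also have "\<dots> = (K - 3) / C" using C q by (simp add: K_def vertical_const_def q_def[symmetric] power2_eq_square)
      finally show ?thesis .
    next
      case False
      then have "\<bar>x - M * \<eta>\<bar> \<le> B * \<bar>\<eta>\<bar> * \<bar>\<eta>\<bar>" using a by (simp add: x_def power2_eq_square mult.assoc)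
      also have "\<dots> \<le> B * \<eta>0 * \<bar>\<eta>\<bar>" using False B by (intro mult_right_mono mult_left_mono) auto
      also have "\<dots> \<le> M/2 * \<bar>\<eta>\<bar>" using B by (intro mult_right_mono) auto
      finally have "1 \<le> C * cos x + M * (S * sin x)" unfolding C_def S_def
        using False \<eta>0 by (intro vortex_numerator_near[OF M]) auto
      then have "(1 - (C * cos x + M * (S * sin x))) / (C - cos x)^2 \<le> 0" by (intro divide_nonpos_nonneg) auto
      also have "0 \<le> (K - 3) / C" using C by (simp add: K_def vertical_const_def)
      finally show ?thesis .
    qed
    have "(f has_real_derivative ((1 - (C * cos x + M * (S * sin x))) / (C - cos x)^2 + (1 + (C * cos p + M * (S * sin p))) / (C + cos p)^2) - K / C * 1) (at u)"
      unfolding f_def C_def[symmetric] by (intro DERIV_diff d DERIV_cmult DERIV_ident)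
    moreover have "((1 - (C * cos x + M * (S * sin x))) / (C - cos x)^2 + (1 + (C * cos p + M * (S * sin p))) / (C + cos p)^2) - K / C * 1 \<le> 0"
      using img vor by (simp add: diff_divide_distrib)
    ultimately show "\<exists>y. (f has_real_derivative y) (at u) \<and> y \<le> 0" by blast
  qed
  then show ?thesis by (simp add: f_def K_def algebra_simps diff_divide_distrib)
qed

section \<open>Comparing the velocities at two touching points\<close>

text \<open>Touching leaves a gap of \<open>\<epsilon>\<close> between the parallel lines of slope \<open>M\<close> through \<open>(x1, g x1)\<close> and \<open>(x2, g x2)\<close>. One of them is
chosen so that the third point \<open>(y, g y)\<close> lies in the cone of \<open>kernel_bound\<close> seen from all its points; the gap is bridged by a
vertical move at one of the ends. The lower line serves whenever \<open>(x2, g x2)\<close> sees \<open>(y, g y)\<close> inside the cone. Otherwise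
\<open>y\<close> is at a definite distance from \<open>x2\<close>, where vertical moves are harmless, and the upper line serves.\<close>

lemma two_point_kernel_left:
  assumes M: "0 < M" "M \<le> 1" and A: "0 \<le> A" "A < pi/2" "tan A \<le> M"
    and gA: "\<And>x. \<bar>g x\<bar> \<le> A"
    and lip: "\<And>x y. \<bar>g x - g y\<bar> \<le> M * \<bar>x - y\<bar> + \<epsilon>" and \<epsilon>: "0 < \<epsilon>" "\<epsilon> \<le> M * \<eta>0"
    and x: "x2 < x1" and touch: "g x1 - g x2 = M * (x1 - x2) + \<epsilon>"
    and B: "0 \<le> B" and taylor: "\<And>y. \<bar>g x1 - g y - M * (x1 - y)\<bar> \<le> B * (x1 - y)^2"
      "\<And>y. \<bar>g x2 - g y - M * (x2 - y)\<bar> \<le> B * (x2 - y)^2"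
    and \<eta>0: "0 < \<eta>0" "\<eta>0 \<le> 1/4" "4 * B * \<eta>0 \<le> M"
    and y: "y < x2"
  shows "velocity M (x1 - y) (g x1) (g y) - velocity M (x2 - y) (g x2) (g y)
    \<le> ref_velocity M (x1 - y) - ref_velocity M (x2 - y)
      + vertical_const \<eta>0 * \<epsilon> * (1 / cosh (x1 - y) + 1 / cosh (x2 - y))"
proof -
  define v where "v = g y"
  define u1 where "u1 = g x1"
  define u2 where "u2 = g x2"
  define e1 where "e1 = x1 - y"
  define e2 where "e2 = x2 - y"
  define K where "K = vertical_const \<eta>0"
  have K: "0 \<le> K" by (simp add: K_def vertical_const_def)
  have e: "0 < e2" "e2 < e1" "x1 - x2 = e1 - e2" using x y by (auto simp: e1_def e2_def)
  have u: "u1 = u2 + M * (e1 - e2) + \<epsilon>" using touch e(3) by (simp add: u1_def u2_def)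
  have Me: "0 \<le> M * (e1 - e2)" using M e by simp
  have A4: "A \<le> pi/4" using angle_le_quarter A M by simp
  have bnd: "\<bar>u1\<bar> \<le> A" "\<bar>u2\<bar> \<le> A" "\<bar>v\<bar> \<le> A" using gA by (auto simp: u1_def u2_def v_def)
  have between: "\<bar>z\<bar> \<le> A" if "u2 \<le> z" "z \<le> u1" for z using bnd that by linarith
  have pos: "0 \<le> K * \<epsilon> / cosh e1" "0 \<le> K * \<epsilon> / cosh e2" using K \<epsilon> by auto
  have B2: "(2 * B) * \<eta>0 \<le> M/2" "0 \<le> 2 * B" using \<eta>0 B by auto
  have up: "u2 - v \<le> M * e2"
    using lip[of x1 y] e u by (simp add: u1_def[symmetric] v_def[symmetric] e1_def[symmetric] algebra_simps)
  have line: "velocity M e1 (c + M * e1) v - ref_velocity M e1 \<le> velocity M e2 (c + M * e2) v - ref_velocity M e2"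
    if c: "u2 \<le> c + M * e2" "c + M * e1 \<le> u1" "c \<le> v" "- (M * e2) \<le> c + M * e2 - v" for c
  proof (rule velocity_minus_ref_decreasing[OF M A less_imp_le[OF e(2)] bnd(3)])
    fix s assume s: "e2 \<le> s" "s \<le> e1"
    then have "M * e2 \<le> M * s" "M * s \<le> M * e1" using M by auto
    then show "s \<noteq> 0 \<and> \<bar>c + M * s\<bar> \<le> A \<and> \<bar>c + M * s - v\<bar> \<le> M * \<bar>s\<bar>"
      using c s e by (intro conjI between) (auto simp: abs_le_iff)
  qed
  have "velocity M e1 u1 v - velocity M e2 u2 v \<le> ref_velocity M e1 - ref_velocity M e2 + (K * \<epsilon> / cosh e1 + K * \<epsilon> / cosh e2)"
  proof (cases "- (M * e2) \<le> u2 - v")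
    case True
    have "velocity M e1 ((u2 - M * e2) + M * e1) v - ref_velocity M e1
        \<le> velocity M e2 ((u2 - M * e2) + M * e2) v - ref_velocity M e2"
      using True up u \<epsilon> by (intro line) (auto simp: algebra_simps)
    moreover have "(u2 - M * e2) + M * e1 = u1 - \<epsilon>" "(u2 - M * e2) + M * e2 = u2" using u by (simp_all add: algebra_simps)
    ultimately have 1: "velocity M e1 (u1 - \<epsilon>) v - ref_velocity M e1 \<le> velocity M e2 u2 v - ref_velocity M e2"
      by simp
    have "\<epsilon> \<le> B * (e1 - e2)^2" using taylor(1)[of x2] touch \<epsilon> e(3) by simp
    also have "\<dots> \<le> B * e1^2" using B e by (intro mult_left_mono power_mono) auto
    finally have \<epsilon>B: "\<epsilon> \<le> B * e1^2" .
    have "velocity M e1 u1 v - velocity M e1 (u1 - \<epsilon>) v \<le> K * (u1 - (u1 - \<epsilon>)) / cosh e1"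
      unfolding K_def
    proof (rule vertical_move[OF M \<eta>0(1,2) B2])
      fix z assume z: "u1 - \<epsilon> \<le> z" "z \<le> u1"
      have "\<bar>u1 - v - M * e1\<bar> \<le> B * e1^2" using taylor(1)[of y] by (simp add: u1_def v_def e1_def)
      then have "\<bar>z - v - M * e1\<bar> \<le> 2 * B * e1^2" using z \<epsilon>B by linarith
      moreover have "0 \<le> cos (z + v)" using z u Me bnd A4 by (intro cos_add_nonneg[OF between]) auto
      ultimately show "0 \<le> cos (z + v) \<and> (\<eta>0 \<le> \<bar>e1\<bar> \<or> \<bar>z - v - M * e1\<bar> \<le> 2 * B * e1\<^sup>2)" by blast
    qed (use e \<epsilon> in auto)
    then have "velocity M e1 u1 v - velocity M e1 (u1 - \<epsilon>) v \<le> K * \<epsilon> / cosh e1" by simp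
    then show ?thesis using 1 pos by linarith
  next
    case False
\<comment> \<open>closer to \<open>x2\<close> the tangent of slope \<open>M\<close> would keep the third point inside the cone\<close>
    have far: "\<eta>0 \<le> e2"
    proof (rule ccontr)
      assume "\<not> \<eta>0 \<le> e2"
      then have "B * e2 \<le> B * \<eta>0" using B by (intro mult_left_mono) auto
      then have "B * e2 \<le> M" using \<eta>0 M by linarith
      then have "B * e2 * e2 \<le> M * e2" using e by (intro mult_right_mono) auto
      moreover have "\<bar>u2 - v - M * e2\<bar> \<le> B * e2 * e2" using taylor(2)[of y] by (simp add: u2_def v_def e2_def power2_eq_square)
      ultimately have "0 \<le> u2 - v" by linarith
      moreover have "0 \<le> M * e2" using M e by simp
      ultimately show False using False by linarith
    qed
    have "M * \<eta>0 \<le> M * e2" using far M by (intro mult_left_mono) auto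
    then have \<epsilon>e: "\<epsilon> \<le> M * e2" using \<epsilon> by linarith
    have "\<bar>v - u2\<bar> \<le> M * e2 + \<epsilon>"
      using lip[of y x2] e by (simp add: u2_def[symmetric] v_def[symmetric] e2_def abs_minus_commute)
    then have low: "- (M * e2) \<le> u2 + \<epsilon> - v" by linarith
    have "velocity M e1 ((u2 + \<epsilon> - M * e2) + M * e1) v - ref_velocity M e1
        \<le> velocity M e2 ((u2 + \<epsilon> - M * e2) + M * e2) v - ref_velocity M e2"
      using False low u \<epsilon> \<epsilon>e by (intro line) (auto simp: algebra_simps)
    moreover have "(u2 + \<epsilon> - M * e2) + M * e1 = u1" "(u2 + \<epsilon> - M * e2) + M * e2 = u2 + \<epsilon>" using u by (simp_all add: algebra_simps)
    ultimately have 1: "velocity M e1 u1 v - ref_velocity M e1 \<le> velocity M e2 (u2 + \<epsilon>) v - ref_velocity M e2"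
      by simp
    have "velocity M e2 (u2 + \<epsilon>) v - velocity M e2 u2 v \<le> K * (u2 + \<epsilon> - u2) / cosh e2"
      unfolding K_def
    proof (rule vertical_move[OF M \<eta>0(1,2) B2])
      fix z assume z: "u2 \<le> z" "z \<le> u2 + \<epsilon>"
      have "0 \<le> cos (z + v)" using z u Me bnd A4 by (intro cos_add_nonneg[OF between]) auto
      then show "0 \<le> cos (z + v) \<and> (\<eta>0 \<le> \<bar>e2\<bar> \<or> \<bar>z - v - M * e2\<bar> \<le> 2 * B * e2\<^sup>2)" using far by auto
    qed (use e \<epsilon> in auto)
    then have "velocity M e2 (u2 + \<epsilon>) v - velocity M e2 u2 v \<le> K * \<epsilon> / cosh e2" by simp
    then show ?thesis using 1 pos by linarith
  qed
  then show ?thesis by (simp add: u1_def u2_def v_def e1_def e2_def K_def distrib_left)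
qed

text \<open>Between the touching points the graph is squeezed between the two parallel lines. The line of slope \<open>M\<close> through
\<open>(y, g y)\<close> passes below \<open>(x1, g x1)\<close> and above \<open>(x2, g x2)\<close>, and both vertical moves go upwards.\<close>

lemma two_point_kernel_middle:
  assumes M: "0 < M" "M \<le> 1" and A: "0 \<le> A" "A < pi/2" "tan A \<le> M"
    and gA: "\<And>x. \<bar>g x\<bar> \<le> A"
    and lip: "\<And>x y. \<bar>g x - g y\<bar> \<le> M * \<bar>x - y\<bar> + \<epsilon>" and \<epsilon>: "0 < \<epsilon>"
    and x: "x2 < x1" and touch: "g x1 - g x2 = M * (x1 - x2) + \<epsilon>"
    and B: "0 \<le> B" and taylor: "\<And>y. \<bar>g x1 - g y - M * (x1 - y)\<bar> \<le> B * (x1 - y)^2"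
      "\<And>y. \<bar>g x2 - g y - M * (x2 - y)\<bar> \<le> B * (x2 - y)^2"
    and \<eta>0: "0 < \<eta>0" "\<eta>0 \<le> 1/4" "4 * B * \<eta>0 \<le> M"
    and y: "x2 < y" "y < x1"
  shows "velocity M (x1 - y) (g x1) (g y) - velocity M (x2 - y) (g x2) (g y)
    \<le> ref_velocity M (x1 - y) - ref_velocity M (x2 - y)
      + vertical_const \<eta>0 * \<epsilon> * (1 / cosh (x1 - y) + 1 / cosh (x2 - y))"
proof -
  define v where "v = g y"
  define u1 where "u1 = g x1"
  define u2 where "u2 = g x2"
  define e1 where "e1 = x1 - y"
  define e2 where "e2 = x2 - y"
  define K where "K = vertical_const \<eta>0"
  have K: "0 \<le> K" by (simp add: K_def vertical_const_def)
  have e: "e2 < 0" "0 < e1" "x1 - x2 = e1 - e2" using y by (auto simp: e1_def e2_def)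
  have u: "u1 = u2 + M * e1 - M * e2 + \<epsilon>" using touch e(3) by (simp add: u1_def u2_def algebra_simps)
  have Me: "0 \<le> M * e1" "M * e2 \<le> 0" using M e by (auto simp: mult_nonneg_nonpos)
  have A4: "A \<le> pi/4" using angle_le_quarter A M by simp
  have bnd: "\<bar>u1\<bar> \<le> A" "\<bar>u2\<bar> \<le> A" "\<bar>v\<bar> \<le> A" using gA by (auto simp: u1_def u2_def v_def)
  have between: "\<bar>z\<bar> \<le> A" if "u2 \<le> z" "z \<le> u1" for z using bnd that by linarith
  have B2: "(2 * B) * \<eta>0 \<le> M/2" "0 \<le> 2 * B" using \<eta>0 B by auto
  define d where "d = u1 - v - M * e1"
  have "\<bar>u1 - v\<bar> \<le> M * e1 + \<epsilon>" using lip[of x1 y] e by (simp add: u1_def[symmetric] v_def[symmetric] e1_def)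
  then have d1: "d \<le> \<epsilon>" by (simp add: d_def abs_le_iff)
  have "\<bar>v - u2\<bar> \<le> M * (- e2) + \<epsilon>" using lip[of y x2] e y by (simp add: u2_def[symmetric] v_def[symmetric] e2_def)
  then have d0: "0 \<le> d" using u by (simp add: d_def abs_le_iff)
  have p1: "v + M * e1 = u1 - d" by (simp add: d_def)
  have p2: "v + M * e2 = u2 + (\<epsilon> - d)" using u by (simp add: d_def)
  have "velocity M e1 (v + M * e1) v - ref_velocity M e1 \<le> velocity M e2 (v + M * e2) v - ref_velocity M e2"
    using d0 d1 u Me by (intro velocity_minus_ref_through_point[OF M A] e between; (unfold p1 p2)?; linarith)
  then have 1: "velocity M e1 (u1 - d) v - ref_velocity M e1 \<le> velocity M e2 (u2 + (\<epsilon> - d)) v - ref_velocity M e2"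
    unfolding p1 p2 .
  have "velocity M e1 u1 v - velocity M e1 (u1 - d) v \<le> K * (u1 - (u1 - d)) / cosh e1"
    unfolding K_def
  proof (rule vertical_move[OF M \<eta>0(1,2) B2])
    fix z assume z: "u1 - d \<le> z" "z \<le> u1"
    have "\<bar>u1 - v - M * e1\<bar> \<le> B * e1^2" using taylor(1)[of y] by (simp add: u1_def v_def e1_def)
    moreover have "0 \<le> B * e1^2" using B by simp
    ultimately have "\<bar>z - v - M * e1\<bar> \<le> 2 * B * e1^2" using z unfolding d_def by linarith
    moreover have "0 \<le> cos (z + v)" using z u Me d1 bnd A4 by (intro cos_add_nonneg[OF between]) auto
    ultimately show "0 \<le> cos (z + v) \<and> (\<eta>0 \<le> \<bar>e1\<bar> \<or> \<bar>z - v - M * e1\<bar> \<le> 2 * B * e1\<^sup>2)" by blast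
  qed (use e d0 in auto)
  also have "\<dots> \<le> K * \<epsilon> / cosh e1" using K d1 by (intro divide_right_mono mult_left_mono) auto
  finally have 2: "velocity M e1 u1 v - velocity M e1 (u1 - d) v \<le> K * \<epsilon> / cosh e1" .
  have "velocity M e2 (u2 + (\<epsilon> - d)) v - velocity M e2 u2 v \<le> K * ((u2 + (\<epsilon> - d)) - u2) / cosh e2"
    unfolding K_def
  proof (rule vertical_move[OF M \<eta>0(1,2) B2])
    fix z assume z: "u2 \<le> z" "z \<le> u2 + (\<epsilon> - d)"
    have "\<bar>u2 - v - M * e2\<bar> \<le> B * e2^2" using taylor(2)[of y] by (simp add: u2_def v_def e2_def)
    moreover have "0 \<le> B * e2^2" using B by simp
    ultimately have "\<bar>z - v - M * e2\<bar> \<le> 2 * B * e2^2" using z unfolding p2[symmetric] by linarith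
    moreover have "0 \<le> cos (z + v)" using z u Me d0 bnd A4 by (intro cos_add_nonneg[OF between]) auto
    ultimately show "0 \<le> cos (z + v) \<and> (\<eta>0 \<le> \<bar>e2\<bar> \<or> \<bar>z - v - M * e2\<bar> \<le> 2 * B * e2\<^sup>2)" by blast
  qed (use e d1 in auto)
  also have "\<dots> \<le> K * \<epsilon> / cosh e2" using K d0 by (intro divide_right_mono mult_left_mono) auto
  finally have 3: "velocity M e2 (u2 + (\<epsilon> - d)) v - velocity M e2 u2 v \<le> K * \<epsilon> / cosh e2" .
  have "velocity M e1 u1 v - velocity M e2 u2 v \<le> ref_velocity M e1 - ref_velocity M e2 + (K * \<epsilon> / cosh e1 + K * \<epsilon> / cosh e2)"
    using 1 2 3 by linarith
  then show ?thesis by (simp add: u1_def u2_def v_def e1_def e2_def K_def distrib_left)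
qed

text \<open>Points to the right of \<open>x1\<close> reduce to points to the left of \<open>x2\<close> by reflecting the graph in the origin.\<close>

lemma two_point_kernel:
  assumes M: "0 < M" "M \<le> 1" and A: "0 \<le> A" "A < pi/2" "tan A \<le> M"
    and gA: "\<And>x. \<bar>g x\<bar> \<le> A"
    and lip: "\<And>x y. \<bar>g x - g y\<bar> \<le> M * \<bar>x - y\<bar> + \<epsilon>" and \<epsilon>: "0 < \<epsilon>" "\<epsilon> \<le> M * \<eta>0"
    and x: "x2 < x1" and touch: "g x1 - g x2 = M * (x1 - x2) + \<epsilon>"
    and B: "0 \<le> B" and taylor: "\<And>y. \<bar>g x1 - g y - M * (x1 - y)\<bar> \<le> B * (x1 - y)^2"
      "\<And>y. \<bar>g x2 - g y - M * (x2 - y)\<bar> \<le> B * (x2 - y)^2"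
    and \<eta>0: "0 < \<eta>0" "\<eta>0 \<le> 1/4" "4 * B * \<eta>0 \<le> M"
    and y: "y \<noteq> x1" "y \<noteq> x2"
  shows "velocity M (x1 - y) (g x1) (g y) - velocity M (x2 - y) (g x2) (g y)
    \<le> ref_velocity M (x1 - y) - ref_velocity M (x2 - y)
      + vertical_const \<eta>0 * \<epsilon> * (1 / cosh (x1 - y) + 1 / cosh (x2 - y))"
proof -
  consider "y < x2" | "x2 < y" "y < x1" | "x1 < y" using y x by linarith
  then show ?thesis
  proof cases
    case 1
    then show ?thesis by (intro two_point_kernel_left[OF M A gA lip \<epsilon> x touch B taylor \<eta>0])
  next
    case 2
    then show ?thesis by (intro two_point_kernel_middle[OF M A gA lip \<epsilon>(1) x touch B taylor \<eta>0])
  next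
    case 3
    define h where "h = (\<lambda>z. - g (- z))"
    have "velocity M (- x2 - (- y)) (h (- x2)) (h (- y)) - velocity M (- x1 - (- y)) (h (- x1)) (h (- y))
      \<le> ref_velocity M (- x2 - (- y)) - ref_velocity M (- x1 - (- y))
      + vertical_const \<eta>0 * \<epsilon> * (1 / cosh (- x2 - (- y)) + 1 / cosh (- x1 - (- y)))"
    proof (rule two_point_kernel_left[OF M A _ _ \<epsilon> _ _ B _ _ \<eta>0])
      show "\<bar>h x\<bar> \<le> A" for x using gA by (simp add: h_def)
      show "\<bar>h x - h y\<bar> \<le> M * \<bar>x - y\<bar> + \<epsilon>" for x y
        using lip[of "-y" "-x"] by (simp add: h_def abs_minus_commute)
      show "- x1 < - x2" using x by simp
      show "h (- x2) - h (- x1) = M * (- x2 - - x1) + \<epsilon>" using touch by (simp add: h_def algebra_simps)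
      show "\<bar>h (- x2) - h y - M * (- x2 - y)\<bar> \<le> B * (- x2 - y)\<^sup>2" for y
        using taylor(2)[of "-y"] by (simp add: h_def power2_eq_square algebra_simps abs_minus_commute)
      show "\<bar>h (- x1) - h y - M * (- x1 - y)\<bar> \<le> B * (- x1 - y)\<^sup>2" for y
        using taylor(1)[of "-y"] by (simp add: h_def power2_eq_square algebra_simps abs_minus_commute)
      show "- y < - x1" using 3 by simp
    qed
    moreover have "velocity M (- x2 - (- y)) (h (- x2)) (h (- y)) = - velocity M (x2 - y) (g x2) (g y)"
      using velocity_minus[of M "x2 - y" "g x2" "g y"] by (simp add: h_def)
    moreover have "velocity M (- x1 - (- y)) (h (- x1)) (h (- y)) = - velocity M (x1 - y) (g x1) (g y)"
      using velocity_minus[of M "x1 - y" "g x1" "g y"] by (simp add: h_def)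
    moreover have "ref_velocity M (- x2 - (- y)) = - ref_velocity M (x2 - y)" "ref_velocity M (- x1 - (- y)) = - ref_velocity M (x1 - y)"
      using ref_velocity_minus[of M "x2 - y"] ref_velocity_minus[of M "x1 - y"] by simp_all
    moreover have "cosh (- x2 - (- y)) = cosh (x2 - y)" "cosh (- x1 - (- y)) = cosh (x1 - y)"
      by (metis cosh_minus minus_diff_eq diff_minus_eq_add add.commute uminus_add_conv_diff)+
    ultimately show ?thesis by (simp only: add.commute)
  qed
qed

section \<open>Principal values and monotone primitives\<close>

text \<open>Cutting off along two sequences and undoing the scaling turns the principal value into a limit of ordinary integrals.\<close>

lemma PV_integral_as_interval_limit:
  fixes J :: "real \<Rightarrow> real" and e R :: "nat \<Rightarrow> real"
  assumes k: "0 < k" and PV: "has_PV_integral (\<lambda>\<eta>. J (k * \<eta>)) c"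
    and e: "e \<longlonglongrightarrow> 0" "\<And>n. 0 < e n" and R: "filterlim R at_top sequentially"
  shows "(\<lambda>n. integral {- R n..- e n} J + integral {e n..R n} J) \<longlonglongrightarrow> k * c"
proof -
  define S where "S = (\<lambda>n. {\<eta>::real. e n / k < \<bar>\<eta>\<bar> \<and> \<bar>\<eta>\<bar> < R n / k})"
  define P where "P = (\<lambda>(\<epsilon>, R). LINT \<eta>:{\<eta>. \<epsilon> < \<bar>\<eta>\<bar> \<and> \<bar>\<eta>\<bar> < R}|lborel. J (k * \<eta>))"
  have int: "set_integrable lborel (S n) (\<lambda>\<eta>. J (k * \<eta>))" for n
    using PV e(2)[of n] k unfolding has_PV_integral_def S_def by auto
  have "(\<lambda>n. e n / k) \<longlonglongrightarrow> 0" using tendsto_divide[OF e(1) tendsto_const[of k]] k by simp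
  then have "filterlim (\<lambda>n. e n / k) (at_right 0) sequentially"
    using e(2) k less_imp_neq[OF e(2)] by (auto simp: filterlim_at intro!: always_eventually)
  moreover have "filterlim (\<lambda>n. R n / k) at_top sequentially"
    using filterlim_tendsto_pos_mult_at_top[OF tendsto_const[of "1/k"] _ R] k by simp
  ultimately have "filterlim (\<lambda>n. (e n / k, R n / k)) (at_right 0 \<times>\<^sub>F at_top) sequentially"
    by (rule filterlim_Pair)
  moreover have "(P \<longlongrightarrow> c) (at_right 0 \<times>\<^sub>F at_top)"
    using PV unfolding has_PV_integral_def P_def by simp
  ultimately have "(\<lambda>n. P (e n / k, R n / k)) \<longlonglongrightarrow> c" by (rule filterlim_compose[rotated])
  then have lim: "(\<lambda>n. k * (LINT \<eta>:S n|lborel. J (k * \<eta>))) \<longlonglongrightarrow> k * c"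
    unfolding P_def S_def by (intro tendsto_mult tendsto_const) simp
  have piece: "k * (LINT \<eta>:{a/k<..<b/k}|lborel. J (k * \<eta>)) = integral {a..b} J"
    if "set_integrable lborel {a/k<..<b/k} (\<lambda>\<eta>. J (k * \<eta>))" for a b
  proof -
    have "(LINT \<eta>:{a/k<..<b/k}|lborel. J (k * \<eta>)) = integral {a/k<..<b/k} (\<lambda>\<eta>. J (k * \<eta>))"
      using set_borel_integral_eq_integral(2)[OF that] .
    also have "\<dots> = integral {a/k..b/k} (\<lambda>\<eta>. J (k * \<eta>))"
      using integral_open_interval[of "a/k" "b/k" "\<lambda>\<eta>. J (k * \<eta>)"] by simp
    also have "{a/k..b/k} = (\<lambda>x. x / k) ` {a..b}"
      using k by (auto simp: image_iff divide_right_mono intro!: bexI[of _ "k * _"] simp: field_simps)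
    also have "integral \<dots> (\<lambda>\<eta>. J (k * \<eta>)) = (1 / k) * integral {a..b} J"
      using integral_stretch_real[of k a b J] k by simp
    finally show ?thesis using k by simp
  qed
  have "k * (LINT \<eta>:S n|lborel. J (k * \<eta>)) = integral {- R n..- e n} J + integral {e n..R n} J" for n
  proof -
    have S: "S n = {- R n / k<..<- e n / k} \<union> {e n / k<..<R n / k}"
    proof -
      have "0 < e n / k" using e(2)[of n] k by simp
      then show ?thesis unfolding S_def minus_divide_left[symmetric] by (auto simp: abs_if split: if_splits)
    qed
    have i: "set_integrable lborel {- R n / k<..<- e n / k} (\<lambda>\<eta>. J (k * \<eta>))"
      "set_integrable lborel {e n / k<..<R n / k} (\<lambda>\<eta>. J (k * \<eta>))"
      by (rule set_integrable_subset[OF int[of n]]; simp add: S)+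
    have d: "0 < e n / k" using e(2)[of n] k by simp
    have "(LINT \<eta>:S n|lborel. J (k * \<eta>)) = (LINT \<eta>:{- R n / k<..<- e n / k}|lborel. J (k * \<eta>))
       + (LINT \<eta>:{e n / k<..<R n / k}|lborel. J (k * \<eta>))"
      unfolding S using d by (intro set_integral_Un i) auto
    then show ?thesis using piece[OF i(1)] piece[OF i(2)] by (simp add: distrib_left)
  qed
  then show ?thesis using lim by simp
qed

lemma continuous_on_interval_avoiding_0:
  fixes J :: "real \<Rightarrow> real"
  assumes "continuous_on (- {0}) J" "0 \<notin> {a..b}"
  shows "continuous_on {a..b} J"
  using assms by (intro continuous_on_subset[OF assms(1)]) auto

lemma small_interval_integral_tendsto_0:
  fixes J :: "real \<Rightarrow> real"
  assumes J: "continuous_on (- {0}) J" and d: "d \<noteq> 0" and e: "e \<longlonglongrightarrow> 0" "\<And>n. 0 < e n" "\<And>n. e n < \<bar>d\<bar>/2"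
  shows "(\<lambda>n. integral {d - e n..d + e n} J) \<longlonglongrightarrow> 0"
proof -
  have "continuous_on {d - \<bar>d\<bar>/2..d + \<bar>d\<bar>/2} J"
    using d by (intro continuous_on_interval_avoiding_0[OF J]) (auto simp: abs_if)
  then have "bounded (J ` {d - \<bar>d\<bar>/2..d + \<bar>d\<bar>/2})"
    by (intro compact_imp_bounded compact_continuous_image) auto
  then obtain B where B0: "\<forall>y\<in>J ` {d - \<bar>d\<bar>/2..d + \<bar>d\<bar>/2}. norm y \<le> B" unfolding bounded_iff by blast
  have B: "norm (J x) \<le> B" if "x \<in> {d - \<bar>d\<bar>/2..d + \<bar>d\<bar>/2}" for x by (rule bspec[OF B0 imageI[OF that]])
  have sub: "{d - e n..d + e n} \<subseteq> {d - \<bar>d\<bar>/2..d + \<bar>d\<bar>/2}" for n using e(3)[of n] by auto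
  have "norm (integral {d - e n..d + e n} J) \<le> B * (2 * e n)" for n
  proof -
    have "norm (integral {d - e n..d + e n} J) \<le> B * ((d + e n) - (d - e n))"
      using sub[of n] e(2)[of n] B
      by (intro integral_bound continuous_on_subset[OF \<open>continuous_on {d - \<bar>d\<bar>/2..d + \<bar>d\<bar>/2} J\<close>]) auto
    then show ?thesis by simp
  qed
  then have "\<forall>\<^sub>F n in sequentially. norm (integral {d - e n..d + e n} J) \<le> B * (2 * e n)" by simp
  moreover have "(\<lambda>n. B * (2 * e n)) \<longlonglongrightarrow> 0" using tendsto_mult_left[OF tendsto_mult_left[OF e(1)], of B 2] by simp
  ultimately show ?thesis by (rule Lim_null_comparison)
qed

lemma moving_interval_integral_tendsto:
  fixes J :: "real \<Rightarrow> real"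
  assumes J: "\<And>n. continuous_on {a n..a n + d} J" and d: "0 < d"
    and lim: "(J \<longlongrightarrow> L) F" and a: "\<And>P. eventually P F \<Longrightarrow> \<forall>\<^sub>F n in sequentially. \<forall>x\<in>{a n..a n + d}. P x"
  shows "(\<lambda>n. integral {a n..a n + d} J) \<longlonglongrightarrow> L * d"
proof (rule tendstoI)
  fix r :: real assume r: "0 < r"
  have "\<forall>\<^sub>F x in F. dist (J x) L < r / (2 * d)" using tendstoD[OF lim, of "r / (2 * d)"] r d by simp
  then have "\<forall>\<^sub>F n in sequentially. \<forall>x\<in>{a n..a n + d}. dist (J x) L < r / (2 * d)" by (rule a)
  then show "\<forall>\<^sub>F n in sequentially. dist (integral {a n..a n + d} J) (L * d) < r"
  proof eventually_elim
    case (elim n)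
    have int: "J integrable_on {a n..a n + d}" by (intro integrable_continuous_interval J)
    have "norm (integral {a n..a n + d} (\<lambda>x. J x - L)) \<le> r / (2 * d) * ((a n + d) - a n)"
      using elim d by (intro integral_bound continuous_intros J) (auto simp: dist_real_def intro: less_imp_le)
    also have "\<dots> < r" using r d by simp
    also have "integral {a n..a n + d} (\<lambda>x. J x - L) = integral {a n..a n + d} J - L * d"
      using d by (subst integral_diff[OF int]) auto
    finally show ?case by (simp add: dist_real_def)
  qed
qed

text \<open>A pointwise comparison \<open>J1 x - J2 (x - d) \<le> Z' x\<close> off the two singularities bounds the difference of the principal values by the
increment of \<open>Z\<close>, provided \<open>Z\<close> is continuous across them. The cut-off windows of the two integrals are shifted by \<open>d\<close> against
each other. The parts that do not match are short intervals at regular points, whose contribution vanishes, and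
one interval of length \<open>d\<close> at each end, whose contributions are governed by the limits \<open>L\<close> and \<open>- L\<close>.\<close>

lemma PV_compare:
  fixes J1 J2 Z :: "real \<Rightarrow> real"
  assumes k: "0 < k" and PV1: "has_PV_integral (\<lambda>\<eta>. J1 (k * \<eta>)) c1" and PV2: "has_PV_integral (\<lambda>\<eta>. J2 (k * \<eta>)) c2"
    and J1: "continuous_on (- {0}) J1" and J2: "continuous_on (- {0}) J2"
    and d: "0 < d" and L: "(J2 \<longlongrightarrow> L) at_top" "(J2 \<longlongrightarrow> - L) at_bot"
    and Z: "\<And>x. isCont Z x" "(Z \<longlongrightarrow> zp) at_top" "(Z \<longlongrightarrow> zm) at_bot"
    and Z': "\<And>x. x \<noteq> 0 \<Longrightarrow> x \<noteq> d \<Longrightarrow> \<exists>z. (Z has_real_derivative z) (at x) \<and> J1 x - J2 (x - d) \<le> z"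
  shows "k * (c1 - c2) + 2 * L * d \<le> zp - zm"
proof -
\<comment> \<open>the cut-off stays below \<open>d/2\<close>, so that the two singularities are separated\<close>
  define e where "e = (\<lambda>n. d / (real n + 3))"
  define R where "R = (\<lambda>n. real n + 2 * d + 1)"
  have e0: "0 < e n" "e n \<le> d/3" for n
    unfolding e_def using d by (simp, intro divide_left_mono) auto
  have elim: "e \<longlonglongrightarrow> 0" unfolding e_def by real_asymp
  have Rlim: "filterlim R at_top sequentially" unfolding R_def by real_asymp
  have R0: "2 * d + 1 \<le> R n" for n by (simp add: R_def)
  define I1 where "I1 = (\<lambda>a b. integral {a..b} J1)"
  define I2 where "I2 = (\<lambda>a b. integral {a..b} J2)"
  have c1: "continuous_on {a..b} J1" and c2: "continuous_on {a..b} J2" if "0 \<notin> {a..b}" for a b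
    using that J1 J2 by (auto intro: continuous_on_interval_avoiding_0)
  have comb1: "I1 a b = I1 a c + I1 c b" if "0 \<notin> {a..b}" "a \<le> c" "c \<le> b" for a b c
    unfolding I1_def using that by (intro Henstock_Kurzweil_Integration.integral_combine[symmetric] integrable_continuous_interval c1) auto
  have comb2: "I2 a b = I2 a c + I2 c b" if "0 \<notin> {a..b}" "a \<le> c" "c \<le> b" for a b c
    unfolding I2_def using that by (intro Henstock_Kurzweil_Integration.integral_combine[symmetric] integrable_continuous_interval c2) auto
  have step: "I1 a b - I2 (a - d) (b - d) \<le> Z b - Z a" if ab: "a \<le> b" "0 \<notin> {a..b}" "d \<notin> {a..b}" for a b
  proof -
    have 1: "(J1 has_integral I1 a b) {a..b}"
      unfolding I1_def using ab by (intro integrable_integral integrable_continuous_interval c1)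
    have "(J2 has_integral I2 (a - d) (b - d)) {a - d..b - d}"
      unfolding I2_def using ab by (intro integrable_integral integrable_continuous_interval c2) auto
    then have 2: "((\<lambda>x. J2 (x - d)) has_integral I2 (a - d) (b - d)) {a..b}"
      using has_integral_shift_real_ivl[of J2 _ "a - d" "b - d" "- d"] by simp
    define z where "z = deriv Z"
    have z: "(Z has_real_derivative z x) (at x) \<and> J1 x - J2 (x - d) \<le> z x" if "x \<in> {a..b}" for x
    proof -
      have "x \<noteq> 0" "x \<noteq> d" using that ab by auto
      from Z'[OF this] show ?thesis unfolding z_def by (auto dest: DERIV_imp_deriv)
    qed
    have "(z has_integral (Z b - Z a)) {a..b}"
      using z by (intro fundamental_theorem_of_calculus ab)
        (auto intro: has_field_derivative_at_within simp flip: has_real_derivative_iff_has_vector_derivative)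
    then show ?thesis
      using has_integral_le[OF has_integral_diff[OF 1 2]] z by blast
  qed
  define err where "err = (\<lambda>n. I1 (d - e n) (d + e n) - I2 (- d - e n) (- d + e n) + I2 (- R n - d) (- R n) - I2 (R n - d) (R n)
      + (Z (- e n) - Z (e n)) + (Z (d - e n) - Z (d + e n)))"
  have main: "(I1 (- R n) (- e n) + I1 (e n) (R n)) - (I2 (- R n) (- e n) + I2 (e n) (R n))
     \<le> Z (R n) - Z (- R n) + err n" for n
  proof -
    note b = e0[of n] R0[of n] d
    have "I1 (- R n) (- e n) - I2 (- R n - d) (- e n - d) \<le> Z (- e n) - Z (- R n)" using b by (intro step) auto
    moreover have "I1 (e n) (d - e n) - I2 (e n - d) (d - e n - d) \<le> Z (d - e n) - Z (e n)" using b by (intro step) auto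
    moreover have "I1 (d + e n) (R n) - I2 (d + e n - d) (R n - d) \<le> Z (R n) - Z (d + e n)" using b by (intro step) auto
    moreover have "I1 (e n) (R n) = I1 (e n) (d - e n) + I1 (d - e n) (R n)" using b by (intro comb1) auto
    moreover have "I1 (d - e n) (R n) = I1 (d - e n) (d + e n) + I1 (d + e n) (R n)" using b by (intro comb1) auto
    moreover have "I2 (- R n - d) (- e n) = I2 (- R n - d) (- R n) + I2 (- R n) (- e n)" using b by (intro comb2) auto
    moreover have "I2 (- R n - d) (- e n) = I2 (- R n - d) (- e n - d) + I2 (- e n - d) (- e n)" using b by (intro comb2) auto
    moreover have "I2 (- e n - d) (- e n) = I2 (- e n - d) (e n - d) + I2 (e n - d) (- e n)" using b by (intro comb2) auto
    moreover have "I2 (e n) (R n) = I2 (e n) (R n - d) + I2 (R n - d) (R n)" using b by (intro comb2) auto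
    moreover have s: "d - e n - d = - e n" "d + e n - d = e n" "- d - e n = - e n - d" "- d + e n = e n - d" by simp_all
    ultimately show ?thesis unfolding err_def s by linarith
  qed
  have e2: "e n < \<bar>d\<bar>/2" "e n < \<bar>- d\<bar>/2" for n using e0[of n] d by simp_all
  have "(\<lambda>n. I1 (d - e n) (d + e n)) \<longlonglongrightarrow> 0"
    unfolding I1_def using d by (intro small_interval_integral_tendsto_0[OF J1 _ elim e0(1) e2(1)]) simp
  moreover have "(\<lambda>n. I2 (- d - e n) (- d + e n)) \<longlonglongrightarrow> 0"
    unfolding I2_def using d by (intro small_interval_integral_tendsto_0[OF J2 _ elim e0(1) e2(2)]) simp
  moreover have "(\<lambda>n. I2 (- R n - d) (- R n)) \<longlonglongrightarrow> - L * d"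
  proof -
    have "(\<lambda>n. integral {(- R n - d)..(- R n - d) + d} J2) \<longlonglongrightarrow> - L * d"
    proof (rule moving_interval_integral_tendsto[OF _ d L(2)])
      show "continuous_on {- R n - d..- R n - d + d} J2" for n using R0[of n] d by (intro c2) auto
      fix P assume "eventually P (at_bot :: real filter)"
      then obtain N where N: "\<And>x. x \<le> N \<Longrightarrow> P x" by (auto simp: eventually_at_bot_linorder)
      have "\<forall>\<^sub>F n in sequentially. - N \<le> R n" using Rlim by (simp add: filterlim_at_top)
      then show "\<forall>\<^sub>F n in sequentially. \<forall>x\<in>{- R n - d..- R n - d + d}. P x"
        by eventually_elim (auto intro!: N)
    qed
    then show ?thesis by (simp add: I2_def)
  qed
  moreover have "(\<lambda>n. I2 (R n - d) (R n)) \<longlonglongrightarrow> L * d"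
  proof -
    have "(\<lambda>n. integral {(R n - d)..(R n - d) + d} J2) \<longlonglongrightarrow> L * d"
    proof (rule moving_interval_integral_tendsto[OF _ d L(1)])
      show "continuous_on {R n - d..R n - d + d} J2" for n using R0[of n] d by (intro c2) auto
      fix P assume "eventually P (at_top :: real filter)"
      then obtain N where N: "\<And>x. x \<ge> N \<Longrightarrow> P x" by (auto simp: eventually_at_top_linorder)
      have "\<forall>\<^sub>F n in sequentially. N + d \<le> R n" using Rlim by (simp add: filterlim_at_top)
      then show "\<forall>\<^sub>F n in sequentially. \<forall>x\<in>{R n - d..R n - d + d}. P x"
        by eventually_elim (auto intro!: N)
    qed
    then show ?thesis by (simp add: I2_def)
  qed
  moreover have Zc: "(\<lambda>n. Z (x + s * e n)) \<longlonglongrightarrow> Z x" for x s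
    using isCont_tendsto_compose[OF Z(1), of "\<lambda>n. x + s * e n" x] tendsto_add[OF tendsto_const[of x] tendsto_mult[OF tendsto_const[of s] elim]] by simp
  have "(\<lambda>n. Z (- e n) - Z (e n)) \<longlonglongrightarrow> 0" using tendsto_diff[OF Zc[of 0 "-1"] Zc[of 0 1]] by simp
  moreover have "(\<lambda>n. Z (d - e n) - Z (d + e n)) \<longlonglongrightarrow> 0" using tendsto_diff[OF Zc[of d "-1"] Zc[of d 1]] by simp
  ultimately have "err \<longlonglongrightarrow> 0 - 0 + (- L * d) - (L * d) + 0 + 0" unfolding err_def by (intro tendsto_add tendsto_diff)
  moreover have "(\<lambda>n. Z (R n)) \<longlonglongrightarrow> zp" "(\<lambda>n. Z (- R n)) \<longlonglongrightarrow> zm"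
    using filterlim_compose[OF Z(2) Rlim] filterlim_compose[OF Z(3) filterlim_compose[OF filterlim_uminus_at_bot_at_top Rlim]] by auto
  ultimately have rhs: "(\<lambda>n. Z (R n) - Z (- R n) + err n) \<longlonglongrightarrow> zp - zm + (0 - 0 + (- L * d) - (L * d) + 0 + 0)"
    by (intro tendsto_add tendsto_diff)
  have "(\<lambda>n. (I1 (- R n) (- e n) + I1 (e n) (R n)) - (I2 (- R n) (- e n) + I2 (e n) (R n))) \<longlonglongrightarrow> k * c1 - k * c2"
    unfolding I1_def I2_def
    by (intro tendsto_diff PV_integral_as_interval_limit[OF k PV1 elim e0(1) Rlim] PV_integral_as_interval_limit[OF k PV2 elim e0(1) Rlim])
  then have "k * c1 - k * c2 \<le> zp - zm + (0 - 0 + (- L * d) - (L * d) + 0 + 0)"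
    using main by (intro LIMSEQ_le[OF _ rhs]) auto
  then show ?thesis by (simp add: algebra_simps)
qed

lemma PV_upper_bound:
  fixes J Z :: "real \<Rightarrow> real"
  assumes k: "0 < k" and PV: "has_PV_integral (\<lambda>\<eta>. J (k * \<eta>)) c" and J: "continuous_on (- {0}) J"
    and Z: "\<And>x. isCont Z x" "(Z \<longlongrightarrow> zp) at_top" "(Z \<longlongrightarrow> zm) at_bot"
    and Z': "\<And>x. x \<noteq> 0 \<Longrightarrow> \<exists>z. (Z has_real_derivative z) (at x) \<and> J x \<le> z"
  shows "k * c \<le> zp - zm"
proof -
  have "has_PV_integral (\<lambda>\<eta>. (\<lambda>_. 0) (k * \<eta>)) 0"
    unfolding has_PV_integral_def by (simp add: set_integrable_def case_prod_unfold)
  then have "k * (c - 0) + 2 * 0 * 1 \<le> zp - zm"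
  proof (rule PV_compare[OF k PV _ J _ _ _ _ Z])
    fix x :: real assume "x \<noteq> 0"
    then show "\<exists>z. (Z has_real_derivative z) (at x) \<and> J x - 0 \<le> z" using Z'[of x] by simp
  qed simp_all
  then show ?thesis by simp
qed

section \<open>Removing the derivative from the integral\<close>

text \<open>The integrand of the Muskat equation for half-width \<open>pi/2\<close>; see \<open>muskat_integrand_scaled\<close>.\<close>

definition strip_integrand :: "(real \<Rightarrow> real) \<Rightarrow> (real \<Rightarrow> real) \<Rightarrow> real \<Rightarrow> real \<Rightarrow> real" where
  "strip_integrand g g' x \<eta> =
     (g' x - g' (x - \<eta>)) * (sinh \<eta> / (cosh \<eta> - cos (g x - g (x - \<eta>)))) +
     (g' x + g' (x - \<eta>)) * (sinh \<eta> / (cosh \<eta> + cos (g x + g (x - \<eta>))))"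

text \<open>The harmonic function \<open>\<Phi>\<close> along the graph. The value at \<open>\<eta> = 0\<close> is the limit.\<close>

definition stream :: "(real \<Rightarrow> real) \<Rightarrow> (real \<Rightarrow> real) \<Rightarrow> real \<Rightarrow> real \<Rightarrow> real" where
  "stream g g' x \<eta> =
     2 * arctan (if \<eta> = 0 then g' x else tan ((g x - g (x - \<eta>))/2) / tanh (\<eta>/2)) +
     2 * arctan (tan ((g x + g (x - \<eta>))/2) * tanh (\<eta>/2))"

lemma quotient_of_halves:
  fixes D U n s :: real
  assumes "D \<noteq> 0"
  shows "2 * n / D / (2 * s / (D * U)) = n * U / s" and "2 * n / D / (2 * s / (U * D)) = n * U / s"
  using assms by (cases "U = 0"; cases "s = 0"; simp)+

locale strip_profile =
  fixes g g' :: "real \<Rightarrow> real" and G :: real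
  assumes in_strip: "\<bar>g x\<bar> < pi/2"
    and deriv_g: "(g has_real_derivative g' x) (at x)"
    and cont_g': "continuous_on UNIV g'"
    and bound_g': "\<bar>g' x\<bar> \<le> G"
    and decay_top: "(g \<longlongrightarrow> 0) at_top"
    and decay_bot: "(g \<longlongrightarrow> 0) at_bot"
begin

lemma cos_half_pos: "0 < cos ((g x - g y)/2)" "0 < cos ((g x + g y)/2)"
  using in_strip[of x] in_strip[of y] by (auto intro!: cos_gt_zero_pi)

lemma cosh_plus_cos_pos: "0 < cosh \<eta> + cos (g x + g y)"
proof -
  have "- 1 < cos (g x + g y)"
  proof -
    have "cos (g x + g y) = 2 * cos ((g x + g y)/2)^2 - 1" using cos_double_cos[of "(g x + g y)/2"] by (simp only: mult_2 field_sum_of_halves)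
    then show ?thesis using cos_half_pos(2)[of x y] by simp
  qed
  then show ?thesis using cosh_real_ge_1[of \<eta>] by linarith
qed

lemma shifted_deriv: "((\<lambda>\<eta>. g (x - \<eta>)) has_real_derivative - g' (x - \<eta>)) (at \<eta>)"
proof -
  have "((\<lambda>\<eta>. x - \<eta>) has_real_derivative - 1) (at \<eta>)" by (auto intro!: derivative_eq_intros)
  from DERIV_chain2[OF deriv_g this] show ?thesis by simp
qed

text \<open>Integration by parts: up to a total derivative the integrand is the velocity, which depends on the other point only through the
value of \<open>g\<close> there.\<close>

lemma stream_deriv:
  assumes "\<eta> \<noteq> 0"
  shows "(stream g g' x has_real_derivative
      velocity (g' x) \<eta> (g x) (g (x - \<eta>)) - strip_integrand g g' x \<eta>) (at \<eta>)"
proof -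
  define p where "p = g' (x - \<eta>)"
  define v where "v = g (x - \<eta>)"
  define a where "a = tanh (\<eta>/2)"
  define t where "t = tan ((g x - v)/2)"
  define w where "w = tan ((g x + v)/2)"
  have a: "a \<noteq> 0" "a^2 < 1" using assms hyperbolic_half(3)[of \<eta>] by (auto simp: a_def)
  have c: "cos ((g x - v)/2) \<noteq> 0" "cos ((g x + v)/2) \<noteq> 0" using cos_half_pos[of x "x - \<eta>"] by (auto simp: v_def)
  have gd: "((\<lambda>\<eta>. g (x - \<eta>)) has_real_derivative - p) (at \<eta>)"
    unfolding p_def by (rule shifted_deriv)
  have sec: "1 / (cos y)^2 = 1 + tan y ^ 2" if "cos y \<noteq> 0" for y :: real
    using that by (simp add: tan_sec inverse_eq_divide power_divide)
  have T: "((\<lambda>\<eta>. tan ((g x - g (x - \<eta>))/2)) has_real_derivative (1 + t^2) * p / 2) (at \<eta>)"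
    using c(1) unfolding v_def
    by (auto intro!: derivative_eq_intros gd simp: t_def v_def sec[symmetric] inverse_eq_divide)
  have W: "((\<lambda>\<eta>. tan ((g x + g (x - \<eta>))/2)) has_real_derivative (1 + w^2) * (- p) / 2) (at \<eta>)"
    using c(2) unfolding v_def
    by (auto intro!: derivative_eq_intros gd simp: w_def v_def sec[symmetric] inverse_eq_divide)
  have H: "((\<lambda>\<eta>. tanh (\<eta>/2)) has_real_derivative (1 - a^2) / 2) (at \<eta>)"
  proof -
    have "cosh (\<eta>/2) \<noteq> 0" by simp
    then show ?thesis by (auto intro!: derivative_eq_intros simp: a_def)
  qed
  have "((\<lambda>\<eta>. 2 * arctan (tan ((g x - g (x - \<eta>))/2) / tanh (\<eta>/2)) +
     2 * arctan (tan ((g x + g (x - \<eta>))/2) * tanh (\<eta>/2))) has_real_derivative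
     (2 * (inverse (1 + (t/a)^2) * (((1 + t^2) * p / 2 * a - t * ((1 - a^2) / 2)) / (a * a)))
      + 2 * (inverse (1 + (w * a)^2) * ((1 + w^2) * (- p) / 2 * a + (1 - a^2) / 2 * w)))) (at \<eta>)"
    by (intro DERIV_add DERIV_cmult DERIV_chain2[OF DERIV_arctan, THEN DERIV_cong]
        DERIV_divide[OF T H, THEN DERIV_cong] DERIV_mult[OF W H, THEN DERIV_cong])
      (use a in \<open>auto simp: t_def w_def v_def a_def\<close>)
  moreover have "2 * (inverse (1 + (t/a)^2) * (((1 + t^2) * p / 2 * a - t * ((1 - a^2) / 2)) / (a * a)))
      = ((1 + t^2) * p * a - t * (1 - a^2)) / (a^2 + t^2)"
  proof -
    have "1 + (t/a)^2 = (a^2 + t^2) / a^2" using a by (simp add: power_divide field_simps)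
    then show ?thesis using a by (simp add: power2_eq_square) (simp add: field_simps)?
  qed
  moreover have "2 * (inverse (1 + (w * a)^2) * ((1 + w^2) * (- p) / 2 * a + (1 - a^2) / 2 * w))
      = (w * (1 - a^2) - (1 + w^2) * p * a) / (1 + a^2 * w^2)"
  proof -
    have "(1 + w^2) * (- p) / 2 * a + (1 - a^2) / 2 * w = (w * (1 - a^2) - (1 + w^2) * p * a) / 2"
      by (simp add: field_simps)
    moreover have "1 + (w * a)^2 = 1 + a^2 * w^2" by (simp add: power_mult_distrib)
    moreover have "2 * (inverse D * (N / 2)) = N / D" for D N :: real by (simp add: inverse_eq_divide)
    ultimately show ?thesis by (simp only:)
  qed
  moreover have "velocity (g' x) \<eta> (g x) v - strip_integrand g g' x \<eta>
      = ((1 + t^2) * p * a - t * (1 - a^2)) / (a^2 + t^2) + (w * (1 - a^2) - (1 + w^2) * p * a) / (1 + a^2 * w^2)"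
  proof -
    define X where "X = (1 - a^2) * (1 + t^2)"
    define Y where "Y = (1 - a^2) * (1 + w^2)"
    have nz: "1 - a^2 \<noteq> 0" "1 + t^2 \<noteq> 0" "1 + w^2 \<noteq> 0" using a by (auto simp: add_nonneg_eq_0_iff)
    note h = hyperbolic_half[of \<eta>, folded a_def] trigonometric_half[OF c(1), folded t_def]
    note h2 = hyperbolic_half[of \<eta>, folded a_def] trigonometric_half[OF c(2), folded w_def]
    have e1: "cosh \<eta> - cos (g x - v) = 2 * (a^2 + t^2) / X"
      unfolding h X_def using nz by (simp add: divide_simps) (simp add: algebra_simps)
    have e2: "cosh \<eta> + cos (g x + v) = 2 * (1 + a^2 * w^2) / Y"
      unfolding h2 Y_def using nz by (simp add: divide_simps) (simp add: algebra_simps)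
    have k1: "sinh \<eta> / (cosh \<eta> - cos (g x - v)) = a * (1 + t^2) / (a^2 + t^2)"
      unfolding e1 h(1) X_def by (rule quotient_of_halves(1)[OF nz(1)])
    have k2: "sinh \<eta> / (cosh \<eta> + cos (g x + v)) = a * (1 + w^2) / (1 + a^2 * w^2)"
      unfolding e2 h(1) Y_def by (rule quotient_of_halves(1)[OF nz(1)])
    have k3: "sin (g x - v) / (cosh \<eta> - cos (g x - v)) = t * (1 - a^2) / (a^2 + t^2)"
      unfolding e1 h(4) X_def by (rule quotient_of_halves(2)[OF nz(2)])
    have k4: "sin (g x + v) / (cosh \<eta> + cos (g x + v)) = w * (1 - a^2) / (1 + a^2 * w^2)"
      unfolding e2 h2(4) Y_def by (rule quotient_of_halves(2)[OF nz(3)])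
    have "velocity (g' x) \<eta> (g x) v - strip_integrand g g' x \<eta>
      = p * (sinh \<eta> / (cosh \<eta> - cos (g x - v))) - sin (g x - v) / (cosh \<eta> - cos (g x - v))
        - p * (sinh \<eta> / (cosh \<eta> + cos (g x + v))) + sin (g x + v) / (cosh \<eta> + cos (g x + v))"
      by (simp add: velocity_def vortex_velocity_def image_velocity_def strip_integrand_def v_def p_def
          add_divide_distrib diff_divide_distrib algebra_simps)
    moreover have "p * (a * c / S) - y / S - p * (a * d / Q) + z / Q = (c * p * a - y) / S + (z - d * p * a) / Q"
      for c d y z S Q :: real by (simp add: diff_divide_distrib mult_ac)
    ultimately show ?thesis unfolding k1 k2 k3 k4 by (simp only:)
  qed
  ultimately have "((\<lambda>\<eta>. 2 * arctan (tan ((g x - g (x - \<eta>))/2) / tanh (\<eta>/2)) +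
     2 * arctan (tan ((g x + g (x - \<eta>))/2) * tanh (\<eta>/2))) has_real_derivative
      velocity (g' x) \<eta> (g x) (g (x - \<eta>)) - strip_integrand g g' x \<eta>) (at \<eta>)" by (simp add: v_def)
  then show ?thesis
    by (rule has_field_derivative_transform_within_open[where S = "- {0}"]) (use assms in \<open>auto simp: stream_def\<close>)
qed

lemma stream_isCont: "isCont (stream g g' x) \<eta>"
proof (cases "\<eta> = 0")
  case False
  then show ?thesis using stream_deriv by (blast intro: DERIV_isCont)
next
  case True
  define N where "N = (\<lambda>\<eta>. tan ((g x - g (x - \<eta>))/2))"
  have gd: "((\<lambda>\<eta>. g (x - \<eta>)) has_real_derivative - g' x) (at 0)"
    using shifted_deriv[of x 0] by simp
  have "(N has_real_derivative g' x / 2) (at 0)"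
    unfolding N_def by (auto intro!: derivative_eq_intros gd)
  then have 1: "((\<lambda>h. N h / h) \<longlongrightarrow> g' x / 2) (at 0)" by (simp add: DERIV_def N_def)
  have "((\<lambda>\<eta>::real. tanh (\<eta>/2)) has_real_derivative 1/2) (at 0)"
    by (auto intro!: derivative_eq_intros)
  then have 2: "((\<lambda>h::real. tanh (h/2) / h) \<longlongrightarrow> 1/2) (at 0)" by (simp add: DERIV_def)
  have "((\<lambda>h. (N h / h) / (tanh (h/2) / h)) \<longlongrightarrow> (g' x / 2) / (1/2)) (at 0)"
    by (intro tendsto_divide 1 2) simp
  then have "((\<lambda>h. (N h / h) / (tanh (h/2) / h)) \<longlongrightarrow> g' x) (at 0)" by simp
  then have lim: "((\<lambda>h. if h = 0 then g' x else N h / tanh (h/2)) \<longlongrightarrow> g' x) (at 0)"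
    by (rule Lim_transform_eventually) (auto simp: eventually_at_filter)
  have "isCont (\<lambda>\<eta>. g (x - \<eta>)) 0" using gd by (rule DERIV_isCont)
  then have gl: "((\<lambda>\<eta>. g (x - \<eta>)) \<longlongrightarrow> g x) (at 0)" by (simp add: isCont_def)
  have L2: "((\<lambda>\<eta>. tan ((g x + g (x - \<eta>))/2) * tanh (\<eta>/2)) \<longlongrightarrow> tan ((g x + g x)/2) * tanh (0/2)) (at 0)"
    using cos_half_pos(2)[of x x] by (intro tendsto_intros gl) auto
  have "((\<lambda>\<eta>. 2 * arctan (if \<eta> = 0 then g' x else N \<eta> / tanh (\<eta>/2)) + 2 * arctan (tan ((g x + g (x - \<eta>))/2) * tanh (\<eta>/2)))
     \<longlongrightarrow> 2 * arctan (g' x) + 2 * arctan (tan ((g x + g x)/2) * tanh (0/2))) (at 0)"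
    by (intro tendsto_add tendsto_mult tendsto_const tendsto_arctan lim L2)
  then show ?thesis unfolding True isCont_def stream_def[abs_def] N_def by simp
qed

lemma shifted_decay:
  "((\<lambda>\<eta>. g (x - \<eta>)) \<longlongrightarrow> 0) at_top" "((\<lambda>\<eta>. g (x - \<eta>)) \<longlongrightarrow> 0) at_bot"
proof -
  have "filterlim (\<lambda>\<eta>::real. x - \<eta>) at_bot at_top" by real_asymp
  then show "((\<lambda>\<eta>. g (x - \<eta>)) \<longlongrightarrow> 0) at_top" by (rule filterlim_compose[OF decay_bot])
  have "filterlim (\<lambda>\<eta>::real. x - \<eta>) at_top at_bot" by real_asymp
  then show "((\<lambda>\<eta>. g (x - \<eta>)) \<longlongrightarrow> 0) at_bot" by (rule filterlim_compose[OF decay_top])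
qed

lemma stream_limits:
  "(stream g g' x \<longlongrightarrow> 2 * g x) at_top" "(stream g g' x \<longlongrightarrow> - 2 * g x) at_bot"
proof -
  have c: "cos ((g x - 0)/2) \<noteq> 0" "cos ((g x + 0)/2) \<noteq> 0"
  proof -
    have "- (pi/2) < g x/2" "g x/2 < pi/2" using in_strip[of x] pi_gt_zero by linarith+
    then have "0 < cos (g x/2)" by (rule cos_gt_zero_pi)
    then show "cos ((g x - 0)/2) \<noteq> 0" "cos ((g x + 0)/2) \<noteq> 0" by auto
  qed
  have at: "arctan (tan (g x / 2)) = g x / 2" using in_strip[of x] by (intro arctan_tan) auto
  have tp: "((\<lambda>\<eta>::real. tanh (\<eta>/2)) \<longlongrightarrow> 1) at_top" by real_asymp
  have tm: "((\<lambda>\<eta>::real. tanh (\<eta>/2)) \<longlongrightarrow> -1) at_bot" by real_asymp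
  have "((\<lambda>\<eta>. 2 * arctan (tan ((g x - g (x - \<eta>))/2) / tanh (\<eta>/2)) + 2 * arctan (tan ((g x + g (x - \<eta>))/2) * tanh (\<eta>/2)))
      \<longlongrightarrow> 2 * arctan (tan ((g x - 0)/2) / 1) + 2 * arctan (tan ((g x + 0)/2) * 1)) at_top"
    using c by (intro tendsto_intros shifted_decay tp) auto
  moreover have "\<forall>\<^sub>F \<eta> in at_top. 2 * arctan (tan ((g x - g (x - \<eta>))/2) / tanh (\<eta>/2)) + 2 * arctan (tan ((g x + g (x - \<eta>))/2) * tanh (\<eta>/2)) = stream g g' x \<eta>"
    using eventually_gt_at_top[of "0::real"] by eventually_elim (simp add: stream_def)
  ultimately show "(stream g g' x \<longlongrightarrow> 2 * g x) at_top" by (auto dest: Lim_transform_eventually simp: at)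
  have "((\<lambda>\<eta>. 2 * arctan (tan ((g x - g (x - \<eta>))/2) / tanh (\<eta>/2)) + 2 * arctan (tan ((g x + g (x - \<eta>))/2) * tanh (\<eta>/2)))
      \<longlongrightarrow> 2 * arctan (tan ((g x - 0)/2) / (-1)) + 2 * arctan (tan ((g x + 0)/2) * (-1))) at_bot"
    using c by (intro tendsto_intros shifted_decay tm) auto
  moreover have "\<forall>\<^sub>F \<eta> in at_bot. 2 * arctan (tan ((g x - g (x - \<eta>))/2) / tanh (\<eta>/2)) + 2 * arctan (tan ((g x + g (x - \<eta>))/2) * tanh (\<eta>/2)) = stream g g' x \<eta>"
    using eventually_at_bot_not_equal[of "0::real"] by eventually_elim (simp add: stream_def)
  ultimately show "(stream g g' x \<longlongrightarrow> - 2 * g x) at_bot" by (auto dest: Lim_transform_eventually simp: at arctan_minus)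
qed

lemma strip_integrand_continuous: "continuous_on (- {0}) (strip_integrand g g' x)"
proof -
  have g: "continuous_on UNIV g" using deriv_g by (auto intro: DERIV_isCont continuous_at_imp_continuous_on)
  have "continuous_on (- {0}) (\<lambda>\<eta>. g (x - \<eta>))" "continuous_on (- {0}) (\<lambda>\<eta>. g' (x - \<eta>))"
    by (intro continuous_on_compose2[OF g] continuous_on_compose2[OF cont_g'] continuous_intros; simp)+
  then show ?thesis unfolding strip_integrand_def[abs_def]
    using cosh_gt_cos cosh_plus_cos_pos
    by (intro continuous_intros) (auto simp: less_imp_neq[symmetric] less_imp_neq[THEN not_sym])
qed

lemma strip_integrand_limits:
  "(strip_integrand g g' x \<longlongrightarrow> 2 * g' x) at_top" "(strip_integrand g g' x \<longlongrightarrow> - (2 * g' x)) at_bot"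
proof -
  define A where "A = (\<lambda>\<eta>. sinh \<eta> / (cosh \<eta> - cos (g x - g (x - \<eta>))))"
  define B where "B = (\<lambda>\<eta>. sinh \<eta> / (cosh \<eta> + cos (g x + g (x - \<eta>))))"
  have J: "strip_integrand g g' x = (\<lambda>\<eta>. g' x * (A \<eta> + B \<eta>) - g' (x - \<eta>) * (A \<eta> - B \<eta>))"
    proof
    fix \<eta>
    have "(m - p) * a + (m + p) * b = m * (a + b) - p * (a - b)" for m p a b :: real by (simp add: algebra_simps)
    then show "strip_integrand g g' x \<eta> = g' x * (A \<eta> + B \<eta>) - g' (x - \<eta>) * (A \<eta> - B \<eta>)"
      unfolding strip_integrand_def A_def B_def .
  qed
  have squeeze: "((\<lambda>\<eta>. sinh \<eta> / (cosh \<eta> - c \<eta>)) \<longlongrightarrow> s) F"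
    if c: "\<And>\<eta>. \<bar>c \<eta>\<bar> \<le> 1" and F: "\<forall>\<^sub>F \<eta> in F. (\<eta>::real) \<noteq> 0"
      and l: "((\<lambda>\<eta>. sinh \<eta> / cosh \<eta>) \<longlongrightarrow> s) F" "((\<lambda>\<eta>. 1 / cosh \<eta>) \<longlongrightarrow> 0) F" for c s F
  proof -
    have "((\<lambda>\<eta>. c \<eta> * (1 / cosh \<eta>)) \<longlongrightarrow> 0) F"
    proof (rule Lim_null_comparison[OF _ l(2)])
      show "\<forall>\<^sub>F \<eta> in F. norm (c \<eta> * (1 / cosh \<eta>)) \<le> 1 / cosh \<eta>"
        using c by (intro always_eventually allI) (simp add: abs_mult divide_right_mono)
    qed
    then have "((\<lambda>\<eta>. (sinh \<eta> / cosh \<eta>) / (1 - c \<eta> * (1 / cosh \<eta>))) \<longlongrightarrow> s / (1 - 0)) F"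
      by (intro tendsto_intros l) auto
    moreover have "(sinh \<eta> / cosh \<eta>) / (1 - c \<eta> * (1 / cosh \<eta>)) = sinh \<eta> / (cosh \<eta> - c \<eta>)" for \<eta>
    proof -
      have "1 - c \<eta> * (1 / cosh \<eta>) = (cosh \<eta> - c \<eta>) / cosh \<eta>" by (simp add: diff_divide_distrib)
      then show ?thesis by simp
    qed
    ultimately show ?thesis by (simp only: diff_0_right div_by_1)
  qed
  have lims: "((\<lambda>\<eta>::real. sinh \<eta> / cosh \<eta>) \<longlongrightarrow> 1) at_top" "((\<lambda>\<eta>::real. 1 / cosh \<eta>) \<longlongrightarrow> 0) at_top"
    "((\<lambda>\<eta>::real. sinh \<eta> / cosh \<eta>) \<longlongrightarrow> -1) at_bot" "((\<lambda>\<eta>::real. 1 / cosh \<eta>) \<longlongrightarrow> 0) at_bot"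
    by real_asymp+
  have ne: "\<forall>\<^sub>F \<eta>::real in at_top. \<eta> \<noteq> 0" "\<forall>\<^sub>F \<eta>::real in at_bot. \<eta> \<noteq> 0"
    by simp_all
  have A: "(A \<longlongrightarrow> 1) at_top" "(A \<longlongrightarrow> -1) at_bot" unfolding A_def by (intro squeeze ne lims; simp)+
  have B': "((\<lambda>\<eta>. sinh \<eta> / (cosh \<eta> - (- cos (g x + g (x - \<eta>))))) \<longlongrightarrow> 1) at_top"
     "((\<lambda>\<eta>. sinh \<eta> / (cosh \<eta> - (- cos (g x + g (x - \<eta>))))) \<longlongrightarrow> -1) at_bot" by (intro squeeze ne lims; simp)+
  then have B: "(B \<longlongrightarrow> 1) at_top" "(B \<longlongrightarrow> -1) at_bot" by (simp_all add: B_def)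
  have G: "0 \<le> G" using bound_g'[of x] by linarith
  have small: "((\<lambda>\<eta>. g' (x - \<eta>) * (A \<eta> - B \<eta>)) \<longlongrightarrow> 0) F" if "((\<lambda>\<eta>. A \<eta> - B \<eta>) \<longlongrightarrow> 0) F" for F
  proof (rule Lim_null_comparison)
    show "((\<lambda>\<eta>. G * \<bar>A \<eta> - B \<eta>\<bar>) \<longlongrightarrow> 0) F" using tendsto_mult[OF tendsto_const[of G] tendsto_rabs[OF that]] by simp
    show "\<forall>\<^sub>F \<eta> in F. norm (g' (x - \<eta>) * (A \<eta> - B \<eta>)) \<le> G * \<bar>A \<eta> - B \<eta>\<bar>"
      using bound_g' by (intro always_eventually allI) (simp add: abs_mult mult_right_mono)
  qed
  have "(strip_integrand g g' x \<longlongrightarrow> g' x * (1 + 1) - 0) at_top"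
    unfolding J using small tendsto_diff[OF A(1) B(1)] by (intro tendsto_intros A B) auto
  then show "(strip_integrand g g' x \<longlongrightarrow> 2 * g' x) at_top" by (simp add: mult.commute)
  have "(strip_integrand g g' x \<longlongrightarrow> g' x * (-1 + -1) - 0) at_bot"
    unfolding J using small tendsto_diff[OF A(2) B(2)] by (intro tendsto_intros A B) auto
  then show "(strip_integrand g g' x \<longlongrightarrow> - (2 * g' x)) at_bot" by (simp add: mult.commute)
qed

end

section \<open>Rates at extremal points\<close>

lemma boundary_profile_deriv:
  assumes "\<bar>u\<bar> < pi/2"
  shows "((\<lambda>\<eta>. 2 * arctan (tan u * tanh (\<eta>/2))) has_real_derivative
      sin (2 * u) / (cosh \<eta> + cos (2 * u))) (at \<eta>)"
proof -
  define a where "a = tanh (\<eta>/2)"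
  define w where "w = tan u"
  have "0 < cos u" using assms by (intro cos_gt_zero_pi) linarith+
  then have c: "cos (2 * u / 2) \<noteq> 0" by simp
  have a: "1 - a^2 \<noteq> 0" using hyperbolic_half(3)[of \<eta>] by (simp add: a_def)
  have w: "1 + w^2 \<noteq> 0" by (simp add: add_nonneg_eq_0_iff)
  have H: "((\<lambda>\<eta>. tan u * tanh (\<eta>/2)) has_real_derivative w * ((1 - a^2) / 2)) (at \<eta>)"
  proof -
    have "cosh (\<eta>/2) \<noteq> 0" by simp
    then show ?thesis by (auto intro!: derivative_eq_intros simp: a_def w_def)
  qed
  have 1: "((\<lambda>\<eta>. 2 * arctan (tan u * tanh (\<eta>/2))) has_real_derivative
      2 * (inverse (1 + (w * a)^2) * (w * ((1 - a^2) / 2)))) (at \<eta>)"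
    using DERIV_cmult[OF DERIV_chain2[OF DERIV_arctan H], of 2] unfolding a_def w_def .
  note h = hyperbolic_half[of \<eta>, folded a_def] trigonometric_half[of "2 * u", OF c, simplified, folded w_def]
  have e: "cosh \<eta> + cos (2 * u) = 2 * (1 + (w * a)^2) / ((1 - a^2) * (1 + w^2))"
    unfolding h using a w by (simp add: divide_simps) (simp add: algebra_simps power_mult_distrib)
  have "sin (2 * u) / (cosh \<eta> + cos (2 * u)) = w * (1 - a^2) / (1 + (w * a)^2)"
    unfolding e h(4) by (rule quotient_of_halves(2)[OF w])
  moreover have "2 * (inverse D * (w * (N / 2))) = w * N / D" for D N :: real by (simp add: inverse_eq_divide)
  ultimately show ?thesis using 1 by (simp only:)
qed

text \<open>With \<open>C = cosh \<eta>\<close>, \<open>s = sin u\<close> and \<open>q = sin v\<close>, the difference of the two sides has the sign of \<open>(s - q) * (C^2 + C - s^2 - s * q)\<close>.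
The right side is the velocity for \<open>v = u\<close>: flat graphs are in equilibrium.\<close>

lemma velocity_at_maximum_le:
  assumes u: "\<bar>u\<bar> < pi/2" and v: "\<bar>v\<bar> < pi/2" "v \<le> u" and \<eta>: "\<eta> \<noteq> 0"
  shows "velocity 0 \<eta> u v \<le> sin (2 * u) / (cosh \<eta> + cos (2 * u))"
proof -
  define C where "C = cosh \<eta>"
  define s where "s = sin u"
  define q where "q = sin v"
  have C: "1 < C" using cosh_gt_1[OF \<eta>] by (simp add: C_def)
  have cu: "0 < cos u" using u by (intro cos_gt_zero_pi) linarith+
  have sq: "q \<le> s" unfolding q_def s_def using u v by (intro sin_monotone_2pi_le) auto
  have cc: "cos u^2 = 1 - s^2" "cos v^2 = 1 - q^2" by (simp_all add: s_def q_def cos_squared_eq)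
  have p1: "0 < C - cos (u - v)" using cosh_gt_cos[OF \<eta>, of "u - v"] by (simp add: C_def)
  have p2: "0 < C + cos (u + v)" "0 < C + cos (2 * u)"
    using cos_ge_minus_one[of "u + v"] cos_ge_minus_one[of "2 * u"] C by linarith+
  have den: "(C - cos (u - v)) * (C + cos (u + v)) = C^2 - 2 * C * s * q - 1 + s^2 + q^2"
  proof -
    have "(C - cos (u - v)) * (C + cos (u + v)) = C^2 - 2 * C * s * q - (cos u^2 * cos v^2 - s^2 * q^2)"
      by (simp add: cos_diff cos_add s_def q_def algebra_simps power2_eq_square)
    then show ?thesis unfolding cc by (simp add: algebra_simps)
  qed
  have num: "- sin (u - v) * (C + cos (u + v)) + sin (u + v) * (C - cos (u - v)) = 2 * cos u * (C * q - s)"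
  proof -
    have "- sin (u - v) * (C + cos (u + v)) + sin (u + v) * (C - cos (u - v))
       = C * (sin (u + v) - sin (u - v)) - sin ((u - v) + (u + v))"
      unfolding sin_add[of "u - v" "u + v"] by (simp add: algebra_simps)
    also have "(u - v) + (u + v) = 2 * u" by simp
    also have "sin (u + v) - sin (u - v) = 2 * cos u * q" by (simp add: sin_add sin_diff q_def)
    finally show ?thesis unfolding sin_double s_def by (simp add: algebra_simps)
  qed
  have "0 \<le> (s - q) * (C^2 + C - s^2 - s * q)"
  proof (intro mult_nonneg_nonneg)
    have "s^2 \<le> 1" by (simp add: s_def abs_square_le_1)
    moreover have "\<bar>s * q\<bar> \<le> 1 * 1" unfolding abs_mult by (intro mult_mono) (auto simp: s_def q_def)
    moreover have "1 * 1 \<le> C * C" using C by (intro mult_mono) auto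
    ultimately show "0 \<le> C^2 + C - s^2 - s * q" using C by (simp add: power2_eq_square abs_le_iff)
  qed (use sq in simp)
  then have "(C * q - s) * (C + cos (2 * u)) \<le> s * (C^2 - 2 * C * s * q - 1 + s^2 + q^2)"
    unfolding cos_double_sin s_def[symmetric] by (simp add: algebra_simps power2_eq_square)
  then have "2 * cos u * ((C * q - s) * (C + cos (2 * u))) \<le> 2 * cos u * (s * (C^2 - 2 * C * s * q - 1 + s^2 + q^2))"
    using cu by (intro mult_left_mono) auto
  then have "2 * cos u * (C * q - s) * (C + cos (2 * u)) \<le> sin (2 * u) * ((C - cos (u - v)) * (C + cos (u + v)))"
    unfolding den sin_double s_def[symmetric] by (simp only: mult_ac)
  then have "2 * cos u * (C * q - s) / ((C - cos (u - v)) * (C + cos (u + v))) \<le> sin (2 * u) / (C + cos (2 * u))"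
    using p1 p2 by (simp add: divide_le_eq le_divide_eq mult_ac)
  moreover have "velocity 0 \<eta> u v = 2 * cos u * (C * q - s) / ((C - cos (u - v)) * (C + cos (u + v)))"
    using p1 p2 unfolding num[symmetric] velocity_def vortex_velocity_def image_velocity_def C_def[symmetric]
    by (simp add: add_frac_eq diff_frac_eq mult.commute)
  ultimately show ?thesis by (simp add: C_def)
qed

definition ref_potential :: "real \<Rightarrow> real \<Rightarrow> real" where
  "ref_potential M \<eta> = M * (8 * ln (cosh (\<eta>/2)) + M^2 * tanh (\<eta>/2)^2)"

lemma ref_potential_deriv: "(ref_potential M has_real_derivative ref_velocity M \<eta>) (at \<eta>)"
proof -
  have c: "0 < cosh (\<eta>/2)" by simp
  have d1: "((\<lambda>\<eta>. ln (cosh (\<eta>/2))) has_real_derivative tanh (\<eta>/2) / 2) (at \<eta>)"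
    using c by (auto intro!: derivative_eq_intros simp: tanh_def)
  have d2: "((\<lambda>\<eta>. tanh (\<eta>/2)) has_real_derivative (1 - tanh (\<eta>/2)^2) / 2) (at \<eta>)"
    using c by (auto intro!: derivative_eq_intros)
  have d3: "((\<lambda>\<eta>. tanh (\<eta>/2)^2) has_real_derivative 2 * (tanh (\<eta>/2) * ((1 - tanh (\<eta>/2)^2) / 2))) (at \<eta>)"
    unfolding power2_eq_square[of "tanh (_/2)"]
    by (rule DERIV_cong[OF DERIV_mult[OF d2 d2]]) (simp add: power2_eq_square field_simps)
  have "((\<lambda>\<eta>. M * (8 * ln (cosh (\<eta>/2)) + M^2 * tanh (\<eta>/2)^2)) has_real_derivative
      M * (8 * (tanh (\<eta>/2) / 2) + M^2 * (2 * (tanh (\<eta>/2) * ((1 - tanh (\<eta>/2)^2) / 2))))) (at \<eta>)"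
    by (intro DERIV_cmult DERIV_add d1 d3)
  moreover have "M * (8 * (tanh (\<eta>/2) / 2) + M^2 * (2 * (tanh (\<eta>/2) * ((1 - tanh (\<eta>/2)^2) / 2)))) = ref_velocity M \<eta>"
    by (simp add: ref_velocity_def field_simps power2_eq_square power3_eq_cube)
  ultimately show ?thesis unfolding ref_potential_def[abs_def] by (simp only:)
qed

lemma ref_potential_increment_limits:
  "((\<lambda>\<eta>. ref_potential M \<eta> - ref_potential M (\<eta> - d)) \<longlongrightarrow> 4 * M * d) at_top"
  "((\<lambda>\<eta>. ref_potential M \<eta> - ref_potential M (\<eta> - d)) \<longlongrightarrow> - (4 * M * d)) at_bot"
proof -
  have l: "((\<lambda>\<eta>. ln (cosh (\<eta>/2)) - ln (cosh ((\<eta> - d)/2))) \<longlongrightarrow> d/2) at_top"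
    "((\<lambda>\<eta>. ln (cosh (\<eta>/2)) - ln (cosh ((\<eta> - d)/2))) \<longlongrightarrow> - (d/2)) at_bot"
    by (real_asymp; simp add: ln_div)+
  have t: "((\<lambda>\<eta>. tanh (\<eta>/2)^2 - tanh ((\<eta> - d)/2)^2) \<longlongrightarrow> 0) at_top"
    "((\<lambda>\<eta>. tanh (\<eta>/2)^2 - tanh ((\<eta> - d)/2)^2) \<longlongrightarrow> 0) at_bot"
    by real_asymp+
  have eq: "ref_potential M \<eta> - ref_potential M (\<eta> - d)
     = M * (8 * (ln (cosh (\<eta>/2)) - ln (cosh ((\<eta> - d)/2))) + M^2 * (tanh (\<eta>/2)^2 - tanh ((\<eta> - d)/2)^2))" for \<eta>
    by (simp add: ref_potential_def algebra_simps)
  show "((\<lambda>\<eta>. ref_potential M \<eta> - ref_potential M (\<eta> - d)) \<longlongrightarrow> 4 * M * d) at_top"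
    unfolding eq using tendsto_mult[OF tendsto_const tendsto_add[OF tendsto_mult[OF tendsto_const l(1)] tendsto_mult[OF tendsto_const t(1)]], of M 8 "M^2"]
    by (simp add: mult_ac)
  show "((\<lambda>\<eta>. ref_potential M \<eta> - ref_potential M (\<eta> - d)) \<longlongrightarrow> - (4 * M * d)) at_bot"
    unfolding eq using tendsto_mult[OF tendsto_const tendsto_add[OF tendsto_mult[OF tendsto_const l(2)] tendsto_mult[OF tendsto_const t(2)]], of M 8 "M^2"]
    by (simp add: mult_ac)
qed

lemma inverse_cosh_le: "1 / cosh \<eta> \<le> 1 - tanh (\<eta>/2)^2" for \<eta> :: real
proof -
  have a: "tanh (\<eta>/2)^2 < 1" by (rule hyperbolic_half(3))
  have "1 / cosh \<eta> = (1 - tanh (\<eta>/2)^2) / (1 + tanh (\<eta>/2)^2)" by (subst hyperbolic_half(2)) simp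
  also have "\<dots> \<le> (1 - tanh (\<eta>/2)^2) / 1" using a by (intro divide_left_mono) (auto intro!: add_pos_nonneg)
  finally show ?thesis by simp
qed

context strip_profile
begin

lemma rate_at_maximum:
  assumes k: "0 < k" and max: "\<And>y. g y \<le> g x" "g' x = 0"
    and PV: "has_PV_integral (\<lambda>\<eta>. strip_integrand g g' x (k * \<eta>)) c"
  shows "c \<le> 0"
proof -
  define Z where "Z = (\<lambda>\<eta>. 2 * arctan (tan (g x) * tanh (\<eta>/2)) - stream g g' x \<eta>)"
  have tp: "((\<lambda>\<eta>::real. tanh (\<eta>/2)) \<longlongrightarrow> 1) at_top" by real_asymp
  have tm: "((\<lambda>\<eta>::real. tanh (\<eta>/2)) \<longlongrightarrow> -1) at_bot" by real_asymp
  have at: "arctan (tan (g x)) = g x" using in_strip[of x] by (intro arctan_tan) auto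
  have "k * c \<le> 0 - 0"
  proof (rule PV_upper_bound[OF k PV strip_integrand_continuous, of Z])
    show "isCont Z \<eta>" for \<eta>
      unfolding Z_def using boundary_profile_deriv[OF in_strip, THEN DERIV_isCont]
      by (intro continuous_diff stream_isCont) auto
    have "(Z \<longlongrightarrow> 2 * arctan (tan (g x) * 1) - 2 * g x) at_top"
      unfolding Z_def by (intro tendsto_intros stream_limits tp)
    then show "(Z \<longlongrightarrow> 0) at_top" by (simp add: at)
    have "(Z \<longlongrightarrow> 2 * arctan (tan (g x) * (-1)) - (- 2 * g x)) at_bot"
      unfolding Z_def by (intro tendsto_intros stream_limits tm)
    then show "(Z \<longlongrightarrow> 0) at_bot" by (simp add: at arctan_minus)
    fix \<eta> :: real assume \<eta>: "\<eta> \<noteq> 0"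
    have "(Z has_real_derivative (sin (2 * g x) / (cosh \<eta> + cos (2 * g x))
        - (velocity (g' x) \<eta> (g x) (g (x - \<eta>)) - strip_integrand g g' x \<eta>))) (at \<eta>)"
      unfolding Z_def by (intro DERIV_diff boundary_profile_deriv in_strip stream_deriv \<eta>)
    moreover have "velocity 0 \<eta> (g x) (g (x - \<eta>)) \<le> sin (2 * g x) / (cosh \<eta> + cos (2 * g x))"
      by (intro velocity_at_maximum_le in_strip max \<eta>)
    ultimately show "\<exists>z. (Z has_real_derivative z) (at \<eta>) \<and> strip_integrand g g' x \<eta> \<le> z"
      using max(2) by (intro exI conjI) auto
  qed
  then show ?thesis using k by (simp add: mult_le_0_iff)
qed

text \<open>The primitive \<open>Z\<close> collects the boundary terms of \<open>stream\<close>, the reference and the error. Its total increment is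
\<open>- 4 * (g x1 - g x2) + 8 * M * (x1 - x2) + O(\<epsilon>)\<close>, and the shift of the windows accounts for \<open>4 * M * (x1 - x2)\<close>; since \<open>g x1 - g x2\<close> equals
\<open>M * (x1 - x2) + \<epsilon>\<close>, only terms of size \<open>\<epsilon>\<close> remain.\<close>

lemma rate_difference_at_touching:
  assumes k: "0 < k"
    and M: "0 < M" "M \<le> 1" and A: "0 \<le> A" "A < pi/2" "tan A \<le> M"
    and gA: "\<And>x. \<bar>g x\<bar> \<le> A"
    and lip: "\<And>x y. \<bar>g x - g y\<bar> \<le> M * \<bar>x - y\<bar> + \<epsilon>" and \<epsilon>: "0 < \<epsilon>" "\<epsilon> \<le> M * \<eta>0"
    and x: "x2 < x1" and touch: "g x1 - g x2 = M * (x1 - x2) + \<epsilon>"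
    and slopes: "g' x1 = M" "g' x2 = M"
    and B: "0 \<le> B" and taylor: "\<And>x y. \<bar>g x - g y - g' x * (x - y)\<bar> \<le> B * (x - y)^2"
    and \<eta>0: "0 < \<eta>0" "\<eta>0 \<le> 1/4" "4 * B * \<eta>0 \<le> M"
    and PV: "has_PV_integral (\<lambda>\<eta>. strip_integrand g g' x1 (k * \<eta>)) c1"
      "has_PV_integral (\<lambda>\<eta>. strip_integrand g g' x2 (k * \<eta>)) c2"
  shows "k * (c1 - c2) \<le> 8 * vertical_const \<eta>0 * \<epsilon>"
proof -
  define d where "d = x1 - x2"
  define K where "K = vertical_const \<eta>0 * \<epsilon>"
  have K: "0 \<le> K" using \<epsilon> by (simp add: K_def vertical_const_def)
  have d: "0 < d" using x by (simp add: d_def)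
  define Z where "Z = (\<lambda>\<eta>. - stream g g' x1 \<eta> + stream g g' x2 (\<eta> - d)
     + (ref_potential M \<eta> - ref_potential M (\<eta> - d)) + 2 * K * (tanh (\<eta>/2) + tanh ((\<eta> - d)/2)))"
  have shift: "((\<lambda>\<eta>. F (\<eta> - d)) has_real_derivative D) (at \<eta>)" if "(F has_real_derivative D) (at (\<eta> - d))" for F D \<eta>
  proof -
    have "((\<lambda>\<eta>. \<eta> - d) has_real_derivative 1) (at \<eta>)" by (auto intro!: derivative_eq_intros)
    from DERIV_chain2[OF that this] show ?thesis by simp
  qed
  have th: "((\<lambda>\<eta>. tanh (\<eta>/2)) has_real_derivative (1 - tanh (\<eta>/2)^2)/2) (at \<eta>)" for \<eta> :: real
  proof -
    have "cosh (\<eta>/2) \<noteq> 0" by simp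
    then show ?thesis by (auto intro!: derivative_eq_intros)
  qed
  have tp: "((\<lambda>\<eta>::real. tanh (\<eta>/2)) \<longlongrightarrow> 1) at_top" "((\<lambda>\<eta>::real. tanh ((\<eta>-d)/2)) \<longlongrightarrow> 1) at_top" by real_asymp+
  have tm: "((\<lambda>\<eta>::real. tanh (\<eta>/2)) \<longlongrightarrow> -1) at_bot" "((\<lambda>\<eta>::real. tanh ((\<eta>-d)/2)) \<longlongrightarrow> -1) at_bot" by real_asymp+
  have "filterlim (\<lambda>\<eta>::real. \<eta> - d) at_top at_top" by real_asymp
  note sp = filterlim_compose[OF stream_limits(1)[of x2] this]
  have "filterlim (\<lambda>\<eta>::real. \<eta> - d) at_bot at_bot" by real_asymp
  note sm = filterlim_compose[OF stream_limits(2)[of x2] this]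
  have "k * (c1 - c2) + 2 * (2 * g' x2) * d
     \<le> (- (2 * g x1) + 2 * g x2 + 4 * M * d + 2 * K * (1 + 1)) - (- (- 2 * g x1) + (- 2 * g x2) + (- (4 * M * d)) + 2 * K * (-1 + -1))"
  proof (rule PV_compare[OF k PV strip_integrand_continuous strip_integrand_continuous d strip_integrand_limits])
    show "isCont Z \<eta>" for \<eta>
    proof -
      have "isCont (\<lambda>\<eta>. stream g g' x2 (\<eta> - d)) \<eta>"
        using continuous_at_compose[of \<eta> "\<lambda>\<eta>. \<eta> - d" "stream g g' x2"] stream_isCont by (simp add: o_def)
      moreover have "isCont (\<lambda>\<eta>. ref_potential M \<eta> - ref_potential M (\<eta> - d)) \<eta>"
        using DERIV_isCont[OF DERIV_diff[OF ref_potential_deriv shift[OF ref_potential_deriv]]] .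
      moreover have "isCont (\<lambda>\<eta>. tanh (\<eta>/2)) \<eta>" "isCont (\<lambda>\<eta>. tanh ((\<eta> - d)/2)) \<eta>"
        using DERIV_isCont[OF th] DERIV_isCont[OF shift[OF th]] by auto
      ultimately show ?thesis unfolding Z_def
        by (intro continuous_add continuous_minus continuous_mult continuous_const stream_isCont)
    qed
    show "(Z \<longlongrightarrow> - (2 * g x1) + 2 * g x2 + 4 * M * d + 2 * K * (1 + 1)) at_top"
      unfolding Z_def by (intro tendsto_add tendsto_minus tendsto_mult tendsto_const stream_limits sp ref_potential_increment_limits tp)
    show "(Z \<longlongrightarrow> - (- 2 * g x1) + (- 2 * g x2) + (- (4 * M * d)) + 2 * K * (-1 + -1)) at_bot"
      unfolding Z_def by (intro tendsto_add tendsto_minus tendsto_mult tendsto_const stream_limits sm ref_potential_increment_limits tm)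
    fix \<eta> :: real assume \<eta>: "\<eta> \<noteq> 0" "\<eta> \<noteq> d"
    define y where "y = x1 - \<eta>"
    have y: "x2 - (\<eta> - d) = y" "x1 - \<eta> = y" "y \<noteq> x1" "y \<noteq> x2" "x1 - y = \<eta>" "x2 - y = \<eta> - d"
      using \<eta> by (auto simp: y_def d_def)
    have nz: "\<eta> - d \<noteq> 0" using \<eta> by simp
    let ?z = "- (velocity M \<eta> (g x1) (g y) - strip_integrand g g' x1 \<eta>)
      + (velocity M (\<eta> - d) (g x2) (g y) - strip_integrand g g' x2 (\<eta> - d))
      + (ref_velocity M \<eta> - ref_velocity M (\<eta> - d))
      + 2 * K * ((1 - tanh (\<eta>/2)^2)/2 + (1 - tanh ((\<eta> - d)/2)^2)/2)"
    have "(Z has_real_derivative ?z) (at \<eta>)"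
      unfolding Z_def
      using stream_deriv[OF \<eta>(1), of x1] shift[OF stream_deriv[OF nz, of x2]]
      unfolding y slopes
      by (intro DERIV_add DERIV_minus DERIV_diff DERIV_cmult ref_potential_deriv shift[OF ref_potential_deriv] th shift[OF th]) auto
    moreover have "velocity M (x1 - y) (g x1) (g y) - velocity M (x2 - y) (g x2) (g y)
      \<le> ref_velocity M (x1 - y) - ref_velocity M (x2 - y) + vertical_const \<eta>0 * \<epsilon> * (1 / cosh (x1 - y) + 1 / cosh (x2 - y))"
      using taylor[of x1] taylor[of x2] unfolding slopes
      by (intro two_point_kernel[OF M A gA lip \<epsilon> x touch B _ _ \<eta>0 y(3,4)]) auto
    then have "velocity M \<eta> (g x1) (g y) - velocity M (\<eta> - d) (g x2) (g y)
      \<le> ref_velocity M \<eta> - ref_velocity M (\<eta> - d) + K * (1 / cosh \<eta> + 1 / cosh (\<eta> - d))"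
      unfolding y(5,6) K_def .
    moreover have "K * (1 / cosh \<eta> + 1 / cosh (\<eta> - d)) \<le> K * ((1 - tanh (\<eta>/2)^2) + (1 - tanh ((\<eta> - d)/2)^2))"
      using K inverse_cosh_le[of \<eta>] inverse_cosh_le[of "\<eta> - d"] by (intro mult_left_mono add_mono) auto
    moreover have "K * ((1 - tanh (\<eta>/2)^2) + (1 - tanh ((\<eta> - d)/2)^2)) = 2 * K * ((1 - tanh (\<eta>/2)^2)/2 + (1 - tanh ((\<eta> - d)/2)^2)/2)"
      by (simp add: field_simps)
    ultimately show "\<exists>z. (Z has_real_derivative z) (at \<eta>) \<and> strip_integrand g g' x1 \<eta> - strip_integrand g g' x2 (\<eta> - d) \<le> z"
      by (intro exI[of _ ?z] conjI) linarith+
  qed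
  moreover have "g x1 = g x2 + M * d + \<epsilon>" using touch by (simp add: d_def)
  ultimately have "k * (c1 - c2) \<le> 8 * K - 4 * \<epsilon>" unfolding slopes by (simp add: algebra_simps)
  then show ?thesis using \<epsilon> by (simp add: K_def)
qed

end

section \<open>Maximum principles for amplitude and slope\<close>

text \<open>The barrier principle: \<open>h\<close> is the excess over the barrier, and the infimum of the times at which it is nonnegative is a
first touching time.\<close>

lemma no_first_touching:
  fixes h :: "real \<Rightarrow> 'p \<Rightarrow> real"
  assumes start: "\<And>p. h 0 p < 0"
    and unif: "\<And>t e. t \<in> {0..T} \<Longrightarrow> 0 < e \<Longrightarrow> \<exists>d>0. \<forall>s\<in>{0..T}. \<bar>s - t\<bar> < d \<longrightarrow> (\<forall>p. \<bar>h s p - h t p\<bar> < e)"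
    and attained: "\<And>t. t \<in> {0..T} \<Longrightarrow> (\<And>e. 0 < e \<Longrightarrow> \<exists>p. - e < h t p) \<Longrightarrow> \<exists>p. 0 \<le> h t p"
    and touch: "\<And>t p. 0 < t \<Longrightarrow> t \<le> T \<Longrightarrow> h t p = 0 \<Longrightarrow> (\<And>q. h t q \<le> 0) \<Longrightarrow>
      (\<And>s. 0 \<le> s \<Longrightarrow> s < t \<Longrightarrow> h s p < 0) \<Longrightarrow> False"
    and t: "t \<in> {0..T}"
  shows "h t p < 0"
proof (rule ccontr)
  assume "\<not> h t p < 0"
  define S where "S = {s \<in> {0..T}. \<exists>p. 0 \<le> h s p}"
  have tS: "t \<in> S" using t \<open>\<not> h t p < 0\<close> by (auto simp: S_def not_less)
  have bdd: "bdd_below S" by (auto simp: S_def intro!: bdd_belowI[of _ 0])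
  define a where "a = Inf S"
  have aT: "a \<in> {0..T}"
  proof -
    have "0 \<le> a" unfolding a_def using tS by (intro cInf_greatest) (auto simp: S_def)
    moreover have "a \<le> t" unfolding a_def by (rule cInf_lower[OF tS bdd])
    ultimately show ?thesis using t by auto
  qed
  have before: "h s p < 0" if "0 \<le> s" "s < a" for s p
  proof (rule ccontr)
    assume "\<not> h s p < 0"
    then have "s \<in> S" using that aT by (auto simp: S_def not_less)
    then have "a \<le> s" unfolding a_def by (rule cInf_lower[OF _ bdd])
    then show False using that by simp
  qed
  have "\<exists>p. - e < h a p" if e: "0 < e" for e
  proof -
    obtain d where d: "0 < d" "\<And>s p. s \<in> {0..T} \<Longrightarrow> \<bar>s - a\<bar> < d \<Longrightarrow> \<bar>h s p - h a p\<bar> < e"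
      using unif[OF aT e] by blast
    have "Inf S < a + d" using d by (simp add: a_def)
    then obtain s where s: "s \<in> S" "s < a + d" using cInf_lessD tS by blast
    moreover have "a \<le> s" unfolding a_def by (rule cInf_lower[OF s(1) bdd])
    moreover obtain p where "0 \<le> h s p" using s by (auto simp: S_def)
    ultimately have "\<bar>h s p - h a p\<bar> < e" by (intro d) (auto simp: S_def)
    then show ?thesis using \<open>0 \<le> h s p\<close> by (intro exI[of _ p]) linarith
  qed
  then obtain p where p: "0 \<le> h a p" using attained[OF aT] by blast
  then have a0: "0 < a" using start[of p] aT by (cases "a = 0") auto
  have le: "h a q \<le> 0" for q
  proof (rule field_le_epsilon)
    fix e :: real assume e: "0 < e"
    obtain d where d: "0 < d" "\<And>s p. s \<in> {0..T} \<Longrightarrow> \<bar>s - a\<bar> < d \<Longrightarrow> \<bar>h s p - h a p\<bar> < e"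
      using unif[OF aT e] by blast
    define s where "s = max 0 (a - d/2)"
    have s: "0 \<le> s" "s < a" "\<bar>s - a\<bar> < d" using a0 d by (auto simp: s_def)
    then have "\<bar>h s q - h a q\<bar> < e" using aT by (intro d) auto
    then show "h a q \<le> 0 + e" using before[OF s(1,2), of q] by linarith
  qed
  show False
  proof (rule touch[OF a0])
    show "a \<le> T" using aT by simp
    show "h a p = 0" using p le[of p] by simp
    show "h a q \<le> 0" for q by (rule le)
    show "h s p < 0" if "0 \<le> s" "s < a" for s using before that .
  qed
qed

lemma supremum_attained_near_compact:
  fixes H :: "'p::topological_space \<Rightarrow> real"
  assumes K: "compact K" and H: "continuous_on K H" and c: "0 < c" "\<And>p. p \<notin> K \<Longrightarrow> H p \<le> - c"
    and near: "\<And>e. 0 < e \<Longrightarrow> \<exists>p. - e < H p"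
  shows "\<exists>p. 0 \<le> H p"
proof -
  obtain p0 where "- c < H p0" using near[OF c(1)] by blast
  then have "K \<noteq> {}" using c(2)[of p0] by force
  then obtain x where x: "x \<in> K" "\<And>y. y \<in> K \<Longrightarrow> H y \<le> H x"
    using continuous_attains_sup[OF K _ H] by blast
  have "0 \<le> H x"
  proof (rule ccontr)
    assume "\<not> 0 \<le> H x"
    then obtain p where p: "- min c (- H x) < H p" using near[of "min c (- H x)"] c by auto
    then have "p \<in> K" using c(2)[of p] by (cases "p \<in> K") auto
    then show False using x(2)[of p] p by auto
  qed
  then show ?thesis by blast
qed

text \<open>At a first touching time only earlier times are under control, which is why the one-sided derivative is used.\<close>

lemma left_derivative_nonneg:
  fixes F :: "real \<Rightarrow> real"
  assumes d: "(F has_real_derivative D) (at t within {0..T})" and t: "0 < t" "t \<le> T"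
    and le: "\<And>s. 0 \<le> s \<Longrightarrow> s < t \<Longrightarrow> F s \<le> F t"
  shows "0 \<le> D"
proof -
  have "(F has_real_derivative D) (at t within {0..<t})"
    by (rule has_field_derivative_subset[OF d]) (use t in auto)
  then have lim: "((\<lambda>s. (F s - F t) / (s - t)) \<longlongrightarrow> D) (at t within {0..<t})"
    by (simp add: has_field_derivative_iff)
  have "at t within {0..<t} \<noteq> bot" using t by (simp add: at_within_eq_bot_iff)
  moreover have "\<forall>\<^sub>F s in at t within {0..<t}. 0 \<le> (F s - F t) / (s - t)"
    unfolding eventually_at_filter using le by (intro always_eventually) (auto intro!: divide_nonpos_nonpos)
  ultimately show ?thesis using tendsto_lowerbound[OF lim] by blast
qed

text \<open>What the two maximum principles use of a scaled solution.\<close>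

locale strip_flow =
  fixes T \<kappa> k G B :: real and g g' :: "real \<Rightarrow> real \<Rightarrow> real"
  assumes T: "0 < T" and \<kappa>: "0 < \<kappa>" and k: "0 < k" and B: "0 \<le> B"
    and profile: "t \<in> {0..T} \<Longrightarrow> strip_profile (g t) (g' t) G"
    and taylor: "t \<in> {0..T} \<Longrightarrow> \<bar>g t x - g t y - g' t x * (x - y)\<bar> \<le> B * (x - y)^2"
    and time_continuous: "t \<in> {0..T} \<Longrightarrow> 0 < e \<Longrightarrow>
      \<exists>d>0. \<forall>s\<in>{0..T}. \<bar>s - t\<bar> < d \<longrightarrow> (\<forall>x. \<bar>g s x - g t x\<bar> < e)"
    and evolution: "t \<in> {0..T} \<Longrightarrow> \<exists>c. has_PV_integral (\<lambda>\<eta>. strip_integrand (g t) (g' t) x (k * \<eta>)) c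
      \<and> ((\<lambda>s. g s x) has_real_derivative \<kappa> * c) (at t within {0..T})"
begin

lemma continuous_space: "t \<in> {0..T} \<Longrightarrow> continuous_on S (g t)"
  using strip_profile.deriv_g[OF profile] by (auto intro: DERIV_isCont continuous_at_imp_continuous_on)

lemma small_outside_compact:
  assumes t: "t \<in> {0..T}" and e: "0 < e"
  obtains N where "0 < N" "\<And>x. N \<le> \<bar>x\<bar> \<Longrightarrow> \<bar>g t x\<bar> < e"
proof -
  interpret strip_profile "g t" "g' t" G by (rule profile[OF t])
  obtain a where a: "\<And>x. a \<le> x \<Longrightarrow> \<bar>g t x\<bar> < e"
    using tendstoD[OF decay_top e] by (auto simp: eventually_at_top_linorder)
  obtain b where b: "\<And>x. x \<le> b \<Longrightarrow> \<bar>g t x\<bar> < e"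
    using tendstoD[OF decay_bot e] by (auto simp: eventually_at_bot_linorder)
  show ?thesis
  proof (rule that[of "max 1 (max \<bar>a\<bar> \<bar>b\<bar>)"])
    fix x assume "max 1 (max \<bar>a\<bar> \<bar>b\<bar>) \<le> \<bar>x\<bar>"
    then have "a \<le> x \<or> x \<le> b" by (auto simp: abs_if split: if_splits)
    then show "\<bar>g t x\<bar> < e" using a b by blast
  qed auto
qed

lemma maximum_principle_upper:
  assumes A: "0 \<le> A" and init: "\<And>x. g 0 x \<le> A" and t: "t \<in> {0..T}"
  shows "g t x \<le> A"
proof (rule field_le_epsilon)
  fix \<delta> :: real assume \<delta>: "0 < \<delta>"
  define \<epsilon> where "\<epsilon> = \<delta> / (1 + T)"
  have \<epsilon>: "0 < \<epsilon>" using \<delta> T by (simp add: \<epsilon>_def)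
  define h where "h = (\<lambda>t x. g t x - (A + \<epsilon> * (1 + t)))"
  have "h t x < 0"
  proof (rule no_first_touching[of h, OF _ _ _ _ t])
    show "h 0 x < 0" for x using init[of x] \<epsilon> by (simp add: h_def)
  next
    fix t e :: real assume t: "t \<in> {0..T}" and e: "0 < e"
    obtain d where d: "0 < d" "\<And>s x. s \<in> {0..T} \<Longrightarrow> \<bar>s - t\<bar> < d \<Longrightarrow> \<bar>g s x - g t x\<bar> < e/2"
      using time_continuous[OF t, of "e/2"] e by auto
    show "\<exists>d>0. \<forall>s\<in>{0..T}. \<bar>s - t\<bar> < d \<longrightarrow> (\<forall>p. \<bar>h s p - h t p\<bar> < e)"
    proof (intro exI[of _ "min d (e/(2*\<epsilon>))"] conjI ballI impI allI)
      fix s p assume s: "s \<in> {0..T}" "\<bar>s - t\<bar> < min d (e/(2*\<epsilon>))"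
      have "\<epsilon> * \<bar>s - t\<bar> < e/2" using s \<epsilon> by (simp add: field_simps)
      moreover have "\<bar>g s p - g t p\<bar> < e/2" using d s by simp
      moreover have "\<bar>h s p - h t p\<bar> \<le> \<bar>g s p - g t p\<bar> + \<bar>\<epsilon> * (t - s)\<bar>"
        unfolding h_def by (simp add: algebra_simps)
      ultimately show "\<bar>h s p - h t p\<bar> < e" using \<epsilon> by (simp add: abs_mult abs_minus_commute)
    qed (use d e \<epsilon> in auto)
  next
    fix t assume t: "t \<in> {0..T}" and near: "\<And>e. 0 < e \<Longrightarrow> \<exists>p. - e < h t p"
    obtain N where N: "0 < N" "\<And>x. N \<le> \<bar>x\<bar> \<Longrightarrow> \<bar>g t x\<bar> < \<epsilon>/2"
      using small_outside_compact[OF t, of "\<epsilon>/2"] \<epsilon> by auto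
    show "\<exists>p. 0 \<le> h t p"
    proof (rule supremum_attained_near_compact[of "{-N..N}" "h t" "\<epsilon>/2"])
      show "continuous_on {-N..N} (h t)" unfolding h_def by (intro continuous_intros continuous_space t)
      fix p assume "p \<notin> {-N..N}"
      then have "\<bar>g t p\<bar> < \<epsilon>/2" by (intro N) (auto simp: abs_if)
      moreover have "\<epsilon> * 1 \<le> \<epsilon> * (1 + t)" using \<epsilon> t by (intro mult_left_mono) auto
      ultimately show "h t p \<le> - (\<epsilon>/2)" using A by (simp add: h_def abs_less_iff)
    qed (use near \<epsilon> in auto)
  next
    fix t x assume t: "0 < t" "t \<le> T" and eq: "h t x = 0" and max: "\<And>q. h t q \<le> 0"
      and before: "\<And>s. 0 \<le> s \<Longrightarrow> s < t \<Longrightarrow> h s x < 0"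
    have tT: "t \<in> {0..T}" using t by simp
    interpret strip_profile "g t" "g' t" G by (rule profile[OF tT])
    have m: "g t y \<le> g t x" for y using eq max[of y] by (simp add: h_def)
    have z: "g' t x = 0" by (rule DERIV_local_max[OF deriv_g, of 1 x]) (use m in auto)
    obtain c where c: "has_PV_integral (\<lambda>\<eta>. strip_integrand (g t) (g' t) x (k * \<eta>)) c"
      "((\<lambda>s. g s x) has_real_derivative \<kappa> * c) (at t within {0..T})"
      using evolution[OF tT] by blast
    have "((\<lambda>s. h s x) has_real_derivative (\<kappa> * c - \<epsilon>)) (at t within {0..T})"
      unfolding h_def by (auto intro!: derivative_eq_intros c)
    then have "0 \<le> \<kappa> * c - \<epsilon>"
      by (rule left_derivative_nonneg[OF _ t]) (use before eq in \<open>simp add: less_imp_le\<close>)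
    moreover have "c \<le> 0" by (rule rate_at_maximum[OF k m z c(1)])
    then have "\<kappa> * c \<le> 0" using \<kappa> by (simp add: mult_nonneg_nonpos)
    ultimately show False using \<epsilon> by linarith
  qed
  then have "g t x < A + \<epsilon> * (1 + t)" by (simp add: h_def)
  also have "\<epsilon> * (1 + t) \<le> \<epsilon> * (1 + T)" using \<epsilon> t by (intro mult_left_mono) auto
  also have "\<epsilon> * (1 + T) = \<delta>" using T by (simp add: \<epsilon>_def)
  finally show "g t x \<le> A + \<delta>" by simp
qed

lemma no_touching_of_slope_barrier:
  assumes M: "0 < M" "M \<le> 1" and A: "0 \<le> A" "A < pi/2" "tan A \<le> M"
    and \<eta>0: "0 < \<eta>0" "\<eta>0 \<le> 1/4" "4 * B * \<eta>0 \<le> M"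
    and \<epsilon>: "0 < \<epsilon>" "\<epsilon> * exp (\<Lambda> * t) \<le> M * \<eta>0" and \<Lambda>: "8 * vertical_const \<eta>0 * \<kappa> / k < \<Lambda>"
    and t: "0 < t" "t \<le> T" and gA: "\<And>x. \<bar>g t x\<bar> \<le> A"
    and lip: "\<And>x y. \<bar>g t x - g t y\<bar> \<le> M * \<bar>x - y\<bar> + \<epsilon> * exp (\<Lambda> * t)"
    and x: "x2 < x1" and touch: "g t x1 - g t x2 = M * (x1 - x2) + \<epsilon> * exp (\<Lambda> * t)"
    and before: "\<And>s. 0 \<le> s \<Longrightarrow> s < t \<Longrightarrow> g s x1 - g s x2 < M * (x1 - x2) + \<epsilon> * exp (\<Lambda> * s)"
  shows False
proof -
  have tT: "t \<in> {0..T}" using t by simp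
  interpret strip_profile "g t" "g' t" G by (rule profile[OF tT])
  define E where "E = \<epsilon> * exp (\<Lambda> * t)"
  have E: "0 < E" using \<epsilon> by (simp add: E_def)
  have s1: "g' t x1 = M"
  proof -
    have "((\<lambda>x. g t x - M * x) has_real_derivative g' t x1 - M) (at x1)"
      by (auto intro!: derivative_eq_intros deriv_g)
    moreover have "g t y - M * y \<le> g t x1 - M * x1" if "\<bar>x1 - y\<bar> < x1 - x2" for y
      using lip[of y x2] touch that by (auto simp: abs_if algebra_simps split: if_splits)
    ultimately have "g' t x1 - M = 0"
      by (intro DERIV_local_max[of _ _ x1 "x1 - x2"]) (use x in auto)
    then show ?thesis by simp
  qed
  have s2: "g' t x2 = M"
  proof -
    have "((\<lambda>x. g t x - M * x) has_real_derivative g' t x2 - M) (at x2)"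
      by (auto intro!: derivative_eq_intros deriv_g)
    moreover have "g t x2 - M * x2 \<le> g t y - M * y" if "\<bar>x2 - y\<bar> < x1 - x2" for y
      using lip[of x1 y] touch that by (auto simp: abs_if algebra_simps split: if_splits)
    ultimately have "g' t x2 - M = 0"
      by (intro DERIV_local_min[of _ _ x2 "x1 - x2"]) (use x in auto)
    then show ?thesis by simp
  qed
  obtain c1 where c1: "has_PV_integral (\<lambda>\<eta>. strip_integrand (g t) (g' t) x1 (k * \<eta>)) c1"
      "((\<lambda>s. g s x1) has_real_derivative \<kappa> * c1) (at t within {0..T})" using evolution[OF tT] by blast
  obtain c2 where c2: "has_PV_integral (\<lambda>\<eta>. strip_integrand (g t) (g' t) x2 (k * \<eta>)) c2"
      "((\<lambda>s. g s x2) has_real_derivative \<kappa> * c2) (at t within {0..T})" using evolution[OF tT] by blast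
  have "((\<lambda>s. g s x1 - g s x2 - (M * (x1 - x2) + \<epsilon> * exp (\<Lambda> * s))) has_real_derivative
      (\<kappa> * c1 - \<kappa> * c2 - \<Lambda> * E)) (at t within {0..T})"
    unfolding E_def by (auto intro!: derivative_eq_intros c1 c2)
  then have "0 \<le> \<kappa> * c1 - \<kappa> * c2 - \<Lambda> * E"
    by (rule left_derivative_nonneg[OF _ t]) (use before touch in \<open>simp add: less_imp_le\<close>)
  then have 1: "\<Lambda> * E \<le> \<kappa> * (c1 - c2)" by (simp add: algebra_simps)
  have "k * (c1 - c2) \<le> 8 * vertical_const \<eta>0 * E"
    using taylor[OF tT]
    by (intro rate_difference_at_touching[OF k M A gA lip[folded E_def] E \<epsilon>(2)[folded E_def] x touch[folded E_def] s1 s2 B _ \<eta>0 c1(1) c2(1)])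
  then have "c1 - c2 \<le> 8 * vertical_const \<eta>0 * E / k" using k by (simp add: pos_le_divide_eq mult.commute)
  then have "\<kappa> * (c1 - c2) \<le> \<kappa> * (8 * vertical_const \<eta>0 * E / k)" using \<kappa> by (intro mult_left_mono) auto
  also have "\<dots> = (8 * vertical_const \<eta>0 * \<kappa> / k) * E" by simp
  also have "\<dots> < \<Lambda> * E" using \<Lambda> E by (intro mult_strict_right_mono)
  finally show False using 1 by simp
qed

end

text \<open>Reflecting the strip gives the lower bounds and the pairs that touch from the other side.\<close>

lemma strip_flow_minus:
  assumes "strip_flow T \<kappa> k G B g g'"
  shows "strip_flow T \<kappa> k G B (\<lambda>t x. - g t x) (\<lambda>t x. - g' t x)"
proof -
  interpret strip_flow T \<kappa> k G B g g' by fact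
  have p1: "strip_profile (\<lambda>x. - g t x) (\<lambda>x. - g' t x) G" if t: "t \<in> {0..T}" for t
  proof -
    interpret strip_profile "g t" "g' t" G by (rule profile[OF t])
    show ?thesis
    proof
      show "\<bar>- g t x\<bar> < pi/2" for x using in_strip[of x] by simp
      show "((\<lambda>x. - g t x) has_real_derivative - g' t x) (at x)" for x by (intro DERIV_minus deriv_g)
      show "continuous_on UNIV (\<lambda>x. - g' t x)" by (intro continuous_intros cont_g')
      show "\<bar>- g' t x\<bar> \<le> G" for x using bound_g'[of x] by simp
      show "((\<lambda>x. - g t x) \<longlongrightarrow> 0) at_top" using tendsto_minus[OF decay_top] by simp
      show "((\<lambda>x. - g t x) \<longlongrightarrow> 0) at_bot" using tendsto_minus[OF decay_bot] by simp
    qed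
  qed
  have p2: "\<bar>- g t x - - g t y - - g' t x * (x - y)\<bar> \<le> B * (x - y)^2" if "t \<in> {0..T}" for t x y
    using taylor[OF that, of x y] by (simp add: abs_if split: if_splits)
  have p3: "\<exists>d>0. \<forall>s\<in>{0..T}. \<bar>s - t\<bar> < d \<longrightarrow> (\<forall>x. \<bar>- g s x - - g t x\<bar> < e)" if "t \<in> {0..T}" "0 < e" for t e
    using time_continuous[OF that] by (simp add: abs_minus_commute)
  have p4: "\<exists>c. has_PV_integral (\<lambda>\<eta>. strip_integrand (\<lambda>x. - g t x) (\<lambda>x. - g' t x) x (k * \<eta>)) c
      \<and> ((\<lambda>s. - g s x) has_real_derivative \<kappa> * c) (at t within {0..T})" if t: "t \<in> {0..T}" for t x
  proof -
      obtain c where c: "has_PV_integral (\<lambda>\<eta>. strip_integrand (g t) (g' t) x (k * \<eta>)) c"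
        "((\<lambda>s. g s x) has_real_derivative \<kappa> * c) (at t within {0..T})" using evolution[OF t] by blast
      have "strip_integrand (\<lambda>x. - g t x) (\<lambda>x. - g' t x) x = (\<lambda>\<eta>. - strip_integrand (g t) (g' t) x \<eta>)"
      proof
        fix \<eta>
        have c: "cos (- a - - b) = cos (a - b)" "cos (- a + - b) = cos (a + b)" for a b :: real
          using cos_minus[of "a - b"] cos_minus[of "a + b"] by simp_all
        have "(- a - - b) * X + (- a + - b) * Y = - ((a - b) * X + (a + b) * Y)" for a b X Y :: real
          by (simp add: algebra_simps)
        then show "strip_integrand (\<lambda>x. - g t x) (\<lambda>x. - g' t x) x \<eta> = - strip_integrand (g t) (g' t) x \<eta>"
          unfolding strip_integrand_def c .
      qed
      moreover have "has_PV_integral (\<lambda>\<eta>. - strip_integrand (g t) (g' t) x (k * \<eta>)) (- c)"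
        using c(1) tendsto_minus[of "\<lambda>(\<epsilon>, R). LINT \<eta>:{\<eta>. \<epsilon> < \<bar>\<eta>\<bar> \<and> \<bar>\<eta>\<bar> < R}|lborel. strip_integrand (g t) (g' t) x (k * \<eta>)" c]
        unfolding has_PV_integral_def
        by (auto simp: case_prod_unfold set_integrable_def set_lebesgue_integral_def)
      ultimately show ?thesis using DERIV_minus[OF c(2)] by (intro exI[of _ "- c"]) auto
  qed
  show ?thesis by (rule strip_flow.intro[OF T \<kappa> k B p1 p2 p3 p4])
qed

context strip_flow
begin

lemma amplitude_maximum_principle:
  assumes A: "0 \<le> A" and init: "\<And>x. \<bar>g 0 x\<bar> \<le> A" and t: "t \<in> {0..T}"
  shows "\<bar>g t x\<bar> \<le> A"
proof -
  interpret neg: strip_flow T \<kappa> k G B "\<lambda>t x. - g t x" "\<lambda>t x. - g' t x"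
    by (rule strip_flow_minus) unfold_locales
  have "g t x \<le> A" using init by (intro maximum_principle_upper[OF A _ t]) (simp add: abs_le_iff)
  moreover have "- g t x \<le> A" using init by (intro neg.maximum_principle_upper[OF A _ t]) (simp add: abs_le_iff)
  ultimately show ?thesis by simp
qed

lemma slope_maximum_principle:
  assumes M: "0 < M" "M \<le> 1" and A: "0 \<le> A" "A < pi/2" "tan A \<le> M"
    and init: "\<And>x. \<bar>g 0 x\<bar> \<le> A" "\<And>x y. \<bar>g 0 x - g 0 y\<bar> \<le> M * \<bar>x - y\<bar>"
    and t: "t \<in> {0..T}"
  shows "\<bar>g t x - g t y\<bar> \<le> M * \<bar>x - y\<bar>"
proof -
\<comment> \<open>within \<open>\<eta>0\<close> of a touching point the graph deviates from its tangent by at most \<open>M/4 * \<bar>x - y\<bar>\<close>\<close>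
  define \<eta>0 where "\<eta>0 = min (1/4) (M / (4 * B + 1))"
  have \<eta>0: "0 < \<eta>0" "\<eta>0 \<le> 1/4" "4 * B * \<eta>0 \<le> M"
  proof -
    show "0 < \<eta>0" using M B by (simp add: \<eta>0_def)
    show "\<eta>0 \<le> 1/4" unfolding \<eta>0_def by (rule min.cobounded1)
    have "4 * B * \<eta>0 \<le> 4 * B * (M / (4 * B + 1))" using B by (intro mult_left_mono) (auto simp: \<eta>0_def)
    also have "\<dots> \<le> M" using B M by (simp add: field_simps)
    finally show "4 * B * \<eta>0 \<le> M" .
  qed
  define \<Lambda> where "\<Lambda> = 8 * vertical_const \<eta>0 * \<kappa> / k + 1"
  have \<Lambda>: "8 * vertical_const \<eta>0 * \<kappa> / k < \<Lambda>" "0 < \<Lambda>"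
    using k \<kappa> by (auto simp: \<Lambda>_def vertical_const_def intro!: add_nonneg_pos divide_nonneg_pos)
  have amp: "\<bar>g t x\<bar> \<le> A" if "t \<in> {0..T}" for t x using amplitude_maximum_principle[OF A(1) init(1) that] .
  have barrier: "g t x - g t y - M * \<bar>x - y\<bar> - \<epsilon> * exp (\<Lambda> * t) < 0"
    if \<epsilon>: "0 < \<epsilon>" "\<epsilon> * exp (\<Lambda> * T) \<le> M * \<eta>0" and t: "t \<in> {0..T}" for \<epsilon> t x y
  proof -
    define h where "h = (\<lambda>t (p :: real \<times> real). g t (fst p) - g t (snd p) - M * \<bar>fst p - snd p\<bar> - \<epsilon> * exp (\<Lambda> * t))"
    have "h t (x, y) < 0"
    proof (rule no_first_touching[of h, OF _ _ _ _ t])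
      show "h 0 p < 0" for p using init(2)[of "fst p" "snd p"] \<epsilon> by (simp add: h_def abs_le_iff)
    next
      fix t e :: real assume t: "t \<in> {0..T}" and e: "0 < e"
      obtain d1 where d1: "0 < d1" "\<And>s x. s \<in> {0..T} \<Longrightarrow> \<bar>s - t\<bar> < d1 \<Longrightarrow> \<bar>g s x - g t x\<bar> < e/3"
        using time_continuous[OF t, of "e/3"] e by auto
      have "isCont (\<lambda>s. \<epsilon> * exp (\<Lambda> * s)) t" by (intro continuous_intros)
      then obtain d2 where d2: "0 < d2" "\<And>s. \<bar>s - t\<bar> < d2 \<Longrightarrow> \<bar>\<epsilon> * exp (\<Lambda> * s) - \<epsilon> * exp (\<Lambda> * t)\<bar> < e/3"
        unfolding continuous_at_eps_delta dist_real_def using e by (metis zero_less_divide_iff zero_less_numeral)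
      show "\<exists>d>0. \<forall>s\<in>{0..T}. \<bar>s - t\<bar> < d \<longrightarrow> (\<forall>p. \<bar>h s p - h t p\<bar> < e)"
      proof (intro exI[of _ "min d1 d2"] conjI ballI impI allI)
        fix s p assume s: "s \<in> {0..T}" "\<bar>s - t\<bar> < min d1 d2"
        have "\<bar>g s (fst p) - g t (fst p)\<bar> < e/3" "\<bar>g s (snd p) - g t (snd p)\<bar> < e/3"
          "\<bar>\<epsilon> * exp (\<Lambda> * s) - \<epsilon> * exp (\<Lambda> * t)\<bar> < e/3" using d1 d2 s by auto
        then show "\<bar>h s p - h t p\<bar> < e" unfolding h_def by linarith
      qed (use d1 d2 in auto)
    next
      fix t assume t: "t \<in> {0..T}" and near: "\<And>e. 0 < e \<Longrightarrow> \<exists>p. - e < h t p"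
      obtain N where N: "0 < N" "\<And>x. N \<le> \<bar>x\<bar> \<Longrightarrow> \<bar>g t x\<bar> < \<epsilon>/4"
        using small_outside_compact[OF t, of "\<epsilon>/4"] \<epsilon> by auto
      define D where "D = 2 * A / M"
      have D: "0 \<le> D" "M * D = 2 * A" using A M by (auto simp: D_def)
      have ex: "\<epsilon> \<le> \<epsilon> * exp (\<Lambda> * t)" using \<epsilon> \<Lambda> t by simp
      let ?K = "{-(N + D)..N + D} \<times> {-(N + D)..N + D}"
      show "\<exists>p. 0 \<le> h t p"
      proof (rule supremum_attained_near_compact[of ?K "h t" "\<epsilon>/2"])
        show "compact ?K" by (intro compact_Times) auto
        show "continuous_on ?K (h t)" unfolding h_def
          by (intro continuous_intros continuous_on_compose2[OF continuous_space[OF t, of UNIV]]) auto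
        fix p assume p: "p \<notin> ?K"
        show "h t p \<le> - (\<epsilon>/2)"
        proof (rule ccontr)
          assume "\<not> h t p \<le> - (\<epsilon>/2)"
          then have *: "M * \<bar>fst p - snd p\<bar> + \<epsilon>/2 < g t (fst p) - g t (snd p)" using ex by (simp add: h_def)
          have Mnn: "0 \<le> M * \<bar>fst p - snd p\<bar>" using M by simp
          have "M * \<bar>fst p - snd p\<bar> < M * D" using * amp[OF t, of "fst p"] amp[OF t, of "snd p"] \<epsilon> D by linarith
          then have close: "\<bar>fst p - snd p\<bar> < D" using M by simp
          have "\<bar>fst p\<bar> < N \<or> \<bar>snd p\<bar> < N" using N(2)[of "fst p"] N(2)[of "snd p"] * Mnn \<epsilon> by linarith
          then have "\<bar>fst p\<bar> \<le> N + D" "\<bar>snd p\<bar> \<le> N + D" using close by linarith+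
          then show False using p by (auto simp: mem_Times_iff abs_le_iff)
        qed
      qed (use near \<epsilon> in auto)
    next
      fix t p assume t: "0 < t" "t \<le> T" and eq: "h t p = 0" and max: "\<And>q. h t q \<le> 0"
        and before: "\<And>s. 0 \<le> s \<Longrightarrow> s < t \<Longrightarrow> h s p < 0"
      have tT: "t \<in> {0..T}" using t by simp
      have "\<epsilon> * exp (\<Lambda> * t) \<le> \<epsilon> * exp (\<Lambda> * T)" using \<epsilon> \<Lambda> t by simp
      then have \<epsilon>t: "\<epsilon> * exp (\<Lambda> * t) \<le> M * \<eta>0" using \<epsilon> by linarith
      have lip: "\<bar>g t x - g t y\<bar> \<le> M * \<bar>x - y\<bar> + \<epsilon> * exp (\<Lambda> * t)" for x y
        using max[of "(x, y)"] max[of "(y, x)"] by (simp add: h_def abs_minus_commute abs_le_iff)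
      interpret neg: strip_flow T \<kappa> k G B "\<lambda>t x. - g t x" "\<lambda>t x. - g' t x"
        by (rule strip_flow_minus) unfold_locales
      consider "snd p < fst p" | "fst p < snd p" | "fst p = snd p" by linarith
      then show False
      proof cases
        case 1
        show False
        proof (rule no_touching_of_slope_barrier[OF M A \<eta>0 \<epsilon>(1) \<epsilon>t \<Lambda>(1) t amp[OF tT] lip 1])
          show "g t (fst p) - g t (snd p) = M * (fst p - snd p) + \<epsilon> * exp (\<Lambda> * t)"
            using eq 1 by (simp add: h_def)
          show "g s (fst p) - g s (snd p) < M * (fst p - snd p) + \<epsilon> * exp (\<Lambda> * s)" if "0 \<le> s" "s < t" for s
            using before[OF that] 1 by (simp add: h_def)
        qed
      next
        case 2
        show False
        proof (rule neg.no_touching_of_slope_barrier[OF M A \<eta>0 \<epsilon>(1) \<epsilon>t \<Lambda>(1) t _ _ 2])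
          show "\<bar>- g t x\<bar> \<le> A" for x using amp[OF tT, of x] by simp
          show "\<bar>- g t x - - g t y\<bar> \<le> M * \<bar>x - y\<bar> + \<epsilon> * exp (\<Lambda> * t)" for x y
            using lip[of y x] by (simp add: abs_minus_commute)
          show "- g t (snd p) - - g t (fst p) = M * (snd p - fst p) + \<epsilon> * exp (\<Lambda> * t)"
            using eq 2 by (simp add: h_def)
          show "- g s (snd p) - - g s (fst p) < M * (snd p - fst p) + \<epsilon> * exp (\<Lambda> * s)" if "0 \<le> s" "s < t" for s
            using before[OF that] 2 by (simp add: h_def)
        qed
      next
        case 3
        then show False using eq \<epsilon> by (simp add: h_def)
      qed
    qed
    then show ?thesis by (simp add: h_def)
  qed
  have one: "g t x - g t y \<le> M * \<bar>x - y\<bar>" for x y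
  proof (rule field_le_epsilon)
    fix \<delta> :: real assume \<delta>: "0 < \<delta>"
    define \<epsilon> where "\<epsilon> = min \<delta> (M * \<eta>0) / exp (\<Lambda> * T)"
    have \<epsilon>: "0 < \<epsilon>" "\<epsilon> * exp (\<Lambda> * T) = min \<delta> (M * \<eta>0)" using \<delta> M \<eta>0 by (auto simp: \<epsilon>_def)
    have "g t x - g t y - M * \<bar>x - y\<bar> - \<epsilon> * exp (\<Lambda> * t) < 0" using \<epsilon> t by (intro barrier) auto
    moreover have "exp (\<Lambda> * t) \<le> exp (\<Lambda> * T)" using \<Lambda> t by simp
    then have "\<epsilon> * exp (\<Lambda> * t) \<le> \<epsilon> * exp (\<Lambda> * T)" using \<epsilon>(1) by (intro mult_left_mono) auto
    ultimately show "g t x - g t y \<le> M * \<bar>x - y\<bar> + \<delta>" using \<epsilon> by linarith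
  qed
  show ?thesis using one[of x y] one[of y x] by (simp add: abs_le_iff abs_minus_commute)
qed

end

section \<open>Decay of square-integrable Lipschitz functions\<close>

text \<open>A form of repeated differentiability that is stable under products without mentioning the higher derivatives.\<close>

primrec times_differentiable :: "nat \<Rightarrow> (real \<Rightarrow> real) \<Rightarrow> bool" where
  "times_differentiable 0 f \<longleftrightarrow> True"
| "times_differentiable (Suc n) f \<longleftrightarrow> (\<exists>f'. (\<forall>x. (f has_real_derivative f' x) (at x)) \<and> times_differentiable n f')"

lemma times_differentiable_SucI:
  "(\<And>x. (f has_real_derivative f' x) (at x)) \<Longrightarrow> times_differentiable n f' \<Longrightarrow> times_differentiable (Suc n) f"
  by auto

lemma times_differentiable_SucE:
  assumes "times_differentiable (Suc n) f"
  obtains f' where "\<And>x. (f has_real_derivative f' x) (at x)" "times_differentiable n f'"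
  using assms by auto

lemma times_differentiable_Suc_imp: "times_differentiable (Suc n) f \<Longrightarrow> times_differentiable n f"
proof (induction n arbitrary: f)
  case (Suc n)
  obtain f' where f: "\<And>x. (f has_real_derivative f' x) (at x)" "times_differentiable (Suc n) f'"
    using Suc.prems by (rule times_differentiable_SucE) blast
  show ?case by (rule times_differentiable_SucI[OF f(1) Suc.IH[OF f(2)]])
qed simp

lemma times_differentiable_add:
  "times_differentiable n f \<Longrightarrow> times_differentiable n g \<Longrightarrow> times_differentiable n (\<lambda>x. f x + g x)"
proof (induction n arbitrary: f g)
  case (Suc n)
  obtain f' g' where f: "\<And>x. (f has_real_derivative f' x) (at x)" "times_differentiable n f'"
    and g: "\<And>x. (g has_real_derivative g' x) (at x)" "times_differentiable n g'"
    using Suc.prems by auto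
  have "((\<lambda>x. f x + g x) has_real_derivative f' x + g' x) (at x)" for x by (intro DERIV_add f g)
  then show ?case using Suc.IH[OF f(2) g(2)] by (rule times_differentiable_SucI)
qed simp

lemma times_differentiable_mult:
  "times_differentiable n f \<Longrightarrow> times_differentiable n g \<Longrightarrow> times_differentiable n (\<lambda>x. f x * g x)"
proof (induction n arbitrary: f g)
  case (Suc n)
  obtain f' g' where f: "\<And>x. (f has_real_derivative f' x) (at x)" "times_differentiable n f'"
    and g: "\<And>x. (g has_real_derivative g' x) (at x)" "times_differentiable n g'"
    using Suc.prems by auto
  have "((\<lambda>x. f x * g x) has_real_derivative f' x * g x + g' x * f x) (at x)" for x by (intro DERIV_mult f g)
  moreover have "times_differentiable n (\<lambda>x. f' x * g x + g' x * f x)"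
    using Suc.prems[THEN times_differentiable_Suc_imp] f g by (intro times_differentiable_add Suc.IH)
  ultimately show ?case by (rule times_differentiable_SucI)
qed simp

lemma times_differentiable_const: "times_differentiable n (\<lambda>x. c)"
proof (induction n arbitrary: c)
  case (Suc n)
  show ?case by (rule times_differentiable_SucI[OF _ Suc[of 0]]) simp
qed simp

lemma times_differentiable_affine:
  "times_differentiable n f \<Longrightarrow> times_differentiable n (\<lambda>x. f (a * x + b))"
proof (induction n arbitrary: f)
  case (Suc n)
  obtain f' where f: "\<And>x. (f has_real_derivative f' x) (at x)" "times_differentiable n f'"
    using Suc.prems by auto
  have "((\<lambda>x. f (a * x + b)) has_real_derivative f' (a * x + b) * a) (at x)" for x
  proof -
    have "((\<lambda>x. a * x + b) has_real_derivative a) (at x)" by (auto intro!: derivative_eq_intros)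
    from DERIV_chain2[OF f(1) this] show ?thesis .
  qed
  moreover have "times_differentiable n (\<lambda>x. f' (a * x + b) * a)"
    by (rule times_differentiable_mult[OF Suc.IH[OF f(2)] times_differentiable_const])
  ultimately show ?case by (rule times_differentiable_SucI)
qed simp

lemma times_differentiable_funpow_deriv:
  "times_differentiable (m + n) f \<Longrightarrow> times_differentiable m ((deriv ^^ n) f)"
proof (induction n arbitrary: f)
  case (Suc n)
  obtain f' where f: "\<And>x. (f has_real_derivative f' x) (at x)" "times_differentiable (m + n) f'"
    using Suc.prems by auto
  have "deriv f = f'" using f(1) by (auto intro!: DERIV_imp_deriv)
  then show ?case using Suc.IH[OF f(2)] by (simp add: funpow_swap1)
qed simp

lemma times_differentiable_imp_test_function:
  assumes "\<And>n. times_differentiable n f" "compact (closure {x. f x \<noteq> 0})"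
  shows "test_function f"
  unfolding test_function_def
proof (intro conjI allI assms(2))
  fix n x
  have "times_differentiable (Suc 0) ((deriv ^^ n) f)"
    by (rule times_differentiable_funpow_deriv) (rule assms)
  then show "(deriv ^^ n) f field_differentiable (at x)"
    by (auto simp: field_differentiable_def)
qed

text \<open>The functions \<open>p (1/x) * exp (- 1/x)\<close>, extended by \<open>0\<close> to \<open>x \<le> 0\<close>, are closed under differentiation; this gives smooth bumps.\<close>

definition flat_exp :: "real poly \<Rightarrow> real \<Rightarrow> real" where
  "flat_exp p x = (if 0 < x then poly p (1/x) * exp (- (1/x)) else 0)"

lemma poly_times_exp_minus_tendsto_0: "((\<lambda>y. poly p y * exp (- y)) \<longlongrightarrow> (0::real)) at_top"
proof -
  have "((\<lambda>y. y ^ k * poly p y * exp (- y)) \<longlongrightarrow> (0::real)) at_top" for k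
  proof (induction p arbitrary: k)
    case (pCons a p)
    have "((\<lambda>y::real. a * (y ^ k / exp y) + y ^ Suc k * poly p y * exp (- y)) \<longlongrightarrow> a * 0 + 0) at_top"
      by (intro tendsto_intros tendsto_power_div_exp_0 pCons.IH)
    then show ?case by (simp add: algebra_simps exp_minus divide_inverse)
  qed simp
  from this[of 0] show ?thesis by simp
qed

lemma flat_exp_deriv: "(flat_exp p has_real_derivative flat_exp ([:0, 0, 1:] * (p - pderiv p)) x) (at x)"
proof -
  consider "0 < x" | "x < 0" | "x = 0" by linarith
  then show ?thesis
  proof cases
    case 1
    have i: "((\<lambda>x. 1 / x) has_real_derivative - (1 / x^2)) (at x)"
      using 1 by (auto intro!: derivative_eq_intros simp: power2_eq_square)
    have "((\<lambda>x. poly p (1/x) * exp (- (1/x))) has_real_derivative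
        poly (pderiv p) (1/x) * (- (1/x^2)) * exp (- (1/x)) + exp (- (1/x)) * (- (- (1/x^2))) * poly p (1/x)) (at x)"
      by (intro DERIV_mult DERIV_chain2[OF poly_DERIV i] DERIV_fun_exp DERIV_minus i)
    moreover have "poly (pderiv p) (1/x) * (- (1/x^2)) * exp (- (1/x)) + exp (- (1/x)) * (- (- (1/x^2))) * poly p (1/x)
        = flat_exp ([:0, 0, 1:] * (p - pderiv p)) x"
      using 1 by (simp add: flat_exp_def algebra_simps power2_eq_square)
    ultimately have "((\<lambda>x. poly p (1/x) * exp (- (1/x))) has_real_derivative flat_exp ([:0, 0, 1:] * (p - pderiv p)) x) (at x)"
      by simp
    then show ?thesis
      by (rule has_field_derivative_transform_within_open[where S = "{0<..}"]) (use 1 in \<open>auto simp: flat_exp_def\<close>)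
  next
    case 2
    have "((\<lambda>x. 0) has_real_derivative 0) (at x)" by simp
    then have "(flat_exp p has_real_derivative 0) (at x)"
      by (rule has_field_derivative_transform_within_open[where S = "{..<0}"]) (use 2 in \<open>auto simp: flat_exp_def\<close>)
    then show ?thesis using 2 by (simp add: flat_exp_def)
  next
    case 3
    have "((\<lambda>y. poly ([:0, 1:] * p) y * exp (- y)) \<longlongrightarrow> 0) at_top" by (rule poly_times_exp_minus_tendsto_0)
    moreover have "filterlim (\<lambda>h::real. 1 / h) at_top (at_right 0)" by real_asymp
    ultimately have "((\<lambda>h. poly ([:0, 1:] * p) (1/h) * exp (- (1/h))) \<longlongrightarrow> 0) (at_right 0)" by (rule filterlim_compose)
    then have r: "((\<lambda>h. flat_exp p h / h) \<longlongrightarrow> 0) (at_right 0)"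
      by (rule Lim_transform_eventually) (auto simp: eventually_at_filter flat_exp_def)
    have l: "((\<lambda>h. flat_exp p h / h) \<longlongrightarrow> 0) (at_left 0)"
      by (rule Lim_transform_eventually[OF tendsto_const]) (auto simp: eventually_at_filter flat_exp_def)
    have "((\<lambda>h. flat_exp p h / h) \<longlongrightarrow> 0) (at 0)" using l r by (rule filterlim_split_at)
    then show ?thesis using 3 by (simp add: DERIV_def flat_exp_def)
  qed
qed

lemma times_differentiable_flat_exp: "times_differentiable n (flat_exp p)"
proof (induction n arbitrary: p)
  case (Suc n)
  show ?case by (rule times_differentiable_SucI[OF flat_exp_deriv Suc])
qed simp

definition bump :: "real \<Rightarrow> real \<Rightarrow> real \<Rightarrow> real" where
  "bump r a x = flat_exp 1 (x - a + r) * flat_exp 1 (a + r - x)"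

lemma bump_nonneg: "0 \<le> bump r a x"
  by (simp add: bump_def flat_exp_def)

lemma bump_pos: "0 < r \<Longrightarrow> 0 < bump r a a"
  by (simp add: bump_def flat_exp_def)

lemma bump_eq_0: "r \<le> \<bar>x - a\<bar> \<Longrightarrow> bump r a x = 0"
  by (auto simp: bump_def flat_exp_def abs_if split: if_splits)

lemma bump_shift: "bump r a x = bump r 0 (x - a)"
  by (simp add: bump_def algebra_simps)

lemma bump_test_function: "test_function (bump r a)"
proof (rule times_differentiable_imp_test_function)
  fix n
  have "times_differentiable n (\<lambda>x. flat_exp 1 (1 * x + (r - a)) * flat_exp 1 ((-1) * x + (a + r)))"
    by (rule times_differentiable_mult[OF times_differentiable_affine[OF times_differentiable_flat_exp]
          times_differentiable_affine[OF times_differentiable_flat_exp]])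
  then show "times_differentiable n (bump r a)" by (simp add: bump_def[abs_def] algebra_simps)
next
  have "{x. bump r a x \<noteq> 0} \<subseteq> {a - r..a + r}" 
  proof
    fix x assume "x \<in> {x. bump r a x \<noteq> 0}"
    then have "\<not> r \<le> \<bar>x - a\<bar>" using bump_eq_0[of r x a] by blast
    then show "x \<in> {a - r..a + r}" by (auto simp: abs_if split: if_splits)
  qed
  then have "closure {x. bump r a x \<noteq> 0} \<subseteq> {a - r..a + r}" by (intro closure_minimal) auto
  then show "compact (closure {x. bump r a x \<noteq> 0})"
    by (meson closed_closure compact_Icc compact_Int_closed inf.absorb_iff2 compact_eq_bounded_closed bounded_subset)
qed

lemma bump_continuous: "continuous_on S (bump r a)"
proof -
  have c: "continuous_on UNIV (flat_exp 1)"
    using flat_exp_deriv[of 1] by (intro continuous_at_imp_continuous_on ballI) (rule DERIV_isCont)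
  have "continuous_on S (\<lambda>x. flat_exp 1 (x - a + r))"
    by (rule continuous_on_compose2[OF c]) (intro continuous_intros, simp)
  moreover have "continuous_on S (\<lambda>x. flat_exp 1 (a + r - x))"
    by (rule continuous_on_compose2[OF c]) (intro continuous_intros, simp)
  ultimately show ?thesis unfolding bump_def[abs_def] by (rule continuous_on_mult)
qed

lemma integrable_continuous_compact_support:
  fixes F :: "real \<Rightarrow> real"
  assumes F: "continuous_on UNIV F" and supp: "\<And>x. x \<notin> {a..b} \<Longrightarrow> F x = 0"
  shows "integrable lborel F"
proof -
  have "set_integrable lborel {a..b} F"
    using F by (intro borel_integrable_atLeastAtMost') (rule continuous_on_subset, auto)
  moreover have "(\<lambda>x. indicat_real {a..b} x *\<^sub>R F x) = F"
  proof
    fix x show "indicat_real {a..b} x *\<^sub>R F x = F x" using supp[of x] by (cases "x \<in> {a..b}") auto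
  qed
  ultimately show ?thesis by (simp add: set_integrable_def)
qed

lemma L2_tail:
  assumes h: "h \<in> borel_measurable lborel" "integrable lborel (\<lambda>x. (h x)\<^sup>2 :: real)" and e: "0 < e"
  obtains N :: real where "0 < N" "(LINT x|lborel. indicator {x. N \<le> \<bar>x\<bar>} x * (h x)\<^sup>2) < e"
proof -
  have hb[measurable]: "h \<in> borel_measurable borel" using h(1) by simp
  have "(\<lambda>n. LINT x|lborel. indicator {x. real n \<le> \<bar>x\<bar>} x * (h x)\<^sup>2) \<longlonglongrightarrow> (LINT x|(lborel :: real measure). 0)"
  proof (rule Bochner_Integration.integral_dominated_convergence[where w = "\<lambda>x. (h x)\<^sup>2" and f = "\<lambda>_. 0"
        and s = "\<lambda>n x. indicator {x. real n \<le> \<bar>x\<bar>} x * (h x)\<^sup>2"])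
    show "AE x in lborel. (\<lambda>n. indicator {x. real n \<le> \<bar>x\<bar>} x * (h x)\<^sup>2) \<longlonglongrightarrow> 0"
    proof (rule AE_I2)
      fix x :: real
      obtain n0 where n0: "\<bar>x\<bar> < real n0" using reals_Archimedean2 by blast
      have "\<forall>\<^sub>F n in sequentially. 0 = indicator {x. real n \<le> \<bar>x\<bar>} x * (h x)\<^sup>2"
        using eventually_ge_at_top[of n0]
      proof eventually_elim
        case (elim n)
        then have "real n0 \<le> real n" by simp
        then show ?case using n0 by (simp add: indicator_def)
      qed
      then show "(\<lambda>n. indicator {x. real n \<le> \<bar>x\<bar>} x * (h x)\<^sup>2) \<longlonglongrightarrow> 0"
        by (rule Lim_transform_eventually[OF tendsto_const])
    qed
    show "AE x in lborel. norm (indicator {x. real n \<le> \<bar>x\<bar>} x * (h x)\<^sup>2) \<le> (h x)\<^sup>2" for n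
      by (auto simp: indicator_def)
  qed (use h in auto)
  then have "\<forall>\<^sub>F n in sequentially. (LINT x|lborel. indicator {x. real n \<le> \<bar>x\<bar>} x * (h x)\<^sup>2) < e"
    using e by (auto dest: order_tendstoD(2))
  then obtain n0 where "\<And>n. n0 \<le> n \<Longrightarrow> (LINT x|lborel. indicator {x. real n \<le> \<bar>x\<bar>} x * (h x)\<^sup>2) < e"
    by (auto simp: eventually_sequentially)
  then show ?thesis using that[of "real (Suc n0)"] by (metis Suc_n_not_le_n linorder_le_cases of_nat_0_less_iff zero_less_Suc)
qed

text \<open>If \<open>\<bar>f a\<bar> \<ge> c\<close>, then \<open>f\<close> stays away from \<open>0\<close> on an interval around \<open>a\<close> of a length that depends only on \<open>c\<close> and \<open>G\<close>. Testing with a bump supported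
there contradicts that the \<open>L\<^sup>2\<close> function \<open>h\<close>, which has the same integrals against test functions, has small tails.\<close>

lemma lipschitz_L2_decay:
  fixes f h :: "real \<Rightarrow> real"
  assumes lip: "\<And>x y. \<bar>f x - f y\<bar> \<le> G * \<bar>x - y\<bar>" and bnd: "\<And>x. \<bar>f x\<bar> \<le> A"
    and weak: "\<And>\<phi>. test_function \<phi> \<Longrightarrow> (LINT x|lborel. f x * \<phi> x) = (LINT x|lborel. h x * \<phi> x)"
    and h: "h \<in> borel_measurable lborel" "integrable lborel (\<lambda>x. (h x)\<^sup>2)" and c: "0 < c"
  shows "\<exists>N. \<forall>x. N \<le> \<bar>x\<bar> \<longrightarrow> \<bar>f x\<bar> < c"
proof -
  have hb[measurable]: "h \<in> borel_measurable borel" using h(1) by simp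
  have G: "0 \<le> G" using lip[of 1 0] by simp
  define r where "r = c / (2 * (G + 1))"
  have r: "0 < r" "G * r \<le> c/2" using c G by (auto simp: r_def field_simps)
  have fc: "continuous_on UNIV f"
  proof (rule continuous_onI)
    fix x e :: real assume e: "0 < e"
    show "\<exists>d>0. \<forall>x'\<in>UNIV. dist x' x < d \<longrightarrow> dist (f x') (f x) \<le> e"
    proof (intro exI[of _ "e / (G + 1)"] conjI ballI impI)
      fix y assume "dist y x < e / (G + 1)"
      then have "(G + 1) * \<bar>y - x\<bar> \<le> e" using G by (simp add: dist_real_def field_simps)
      then show "dist (f y) (f x) \<le> e" using lip[of y x] by (simp add: dist_real_def algebra_simps)
    qed (use e G in auto)
  qed
  have b: "integrable lborel (bump r a)" "integrable lborel (\<lambda>x. (bump r a x)\<^sup>2)"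
    "integrable lborel (\<lambda>x. f x * bump r a x)" for a
    by (rule integrable_continuous_compact_support[of _ "a - r" "a + r"];
        (intro continuous_intros bump_continuous fc)?; (auto simp: abs_if intro!: bump_eq_0)?)+
  define I where "I = (LINT x|lborel. bump r 0 x)"
  define Q where "Q = (LINT x|lborel. (bump r 0 x)\<^sup>2)"
  have shift: "(LINT x|lborel. F (x - a)) = (LINT x|lborel. F x)" for F :: "real \<Rightarrow> real" and a
    using lborel_integral_real_affine[of 1 F "- a"] by (simp add: add.commute)
  have I: "(LINT x|lborel. bump r a x) = I" and Q: "(LINT x|lborel. (bump r a x)\<^sup>2) = Q" for a
    unfolding I_def Q_def bump_shift[of r a] using shift[of "bump r 0" a] shift[of "\<lambda>x. (bump r 0 x)\<^sup>2" a] by auto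
  have I0: "0 < I"
  proof -
    have "0 \<le> I" unfolding I_def by (intro integral_nonneg_AE) (auto simp: bump_nonneg)
    moreover have "I \<noteq> 0"
    proof
      assume "I = 0"
      then have "AE x in lborel. bump r 0 x = 0"
        unfolding I_def using b(1)[of 0] by (subst (asm) integral_nonneg_eq_0_iff_AE) (auto simp: bump_nonneg)
      then have "AE x in lborel. x \<notin> {x. 0 < bump r 0 x}" by eventually_elim auto
      moreover have op: "open {x. 0 < bump r 0 x}" by (intro open_Collect_less continuous_intros bump_continuous)
      ultimately have "{x. 0 < bump r 0 x} \<in> null_sets lborel" by (subst AE_iff_null_sets) auto
      then have "negligible {x. 0 < bump r 0 x}"
        using negligible_iff_null_sets null_sets_completionI by blast
      then show False using open_not_negligible[OF op] bump_pos[OF r(1), of 0] by blast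
    qed
    ultimately show ?thesis by simp
  qed
  have Q0: "0 \<le> Q" unfolding Q_def by (intro integral_nonneg_AE) auto
\<comment> \<open>the weight in \<open>\<bar>h\<bar> * b \<le> L/2 * h^2 + b^2 / (2 * L)\<close>, so large that the second term integrates to less than \<open>c * I / 4\<close>\<close>
  define L where "L = (2 * Q + 1) / (c * I)"
  have L: "0 < L" using Q0 c I0 by (auto simp: L_def intro!: divide_pos_pos)
  have QL: "Q / (2 * L) < c * I / 4" using Q0 c I0 by (simp add: L_def field_simps)
  obtain N where N: "0 < N" "(LINT x|lborel. indicator {x. N \<le> \<bar>x\<bar>} x * (h x)\<^sup>2) < c * I / (2 * L)"
    using L2_tail[OF h, of "c * I / (2 * L)"] c I0 L by auto
  have "\<bar>f a\<bar> < c" if a: "N + r \<le> \<bar>a\<bar>" for a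
  proof (rule ccontr)
    assume "\<not> \<bar>f a\<bar> < c"
    then have fa: "c \<le> \<bar>f a\<bar>" by simp
    define s where "s = (if 0 \<le> f a then 1 else (-1::real))"
    have low: "c/2 * bump r a x \<le> s * (f x * bump r a x)" for x
    proof (cases "\<bar>x - a\<bar> < r")
      case True
      have "G * \<bar>x - a\<bar> \<le> G * r" using True G by (intro mult_left_mono) auto
      then have "\<bar>f x - f a\<bar> \<le> c/2" using lip[of x a] r by linarith
      then have "c/2 \<le> s * f x" using fa by (auto simp: s_def abs_if split: if_splits)
      from mult_right_mono[OF this bump_nonneg[of r a x]] show ?thesis by (simp add: mult.assoc)
    next
      case False
      then show ?thesis by (simp add: bump_eq_0)
    qed
    have "c/2 * I = (LINT x|lborel. c/2 * bump r a x)" by (simp add: I)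
    also have "\<dots> \<le> (LINT x|lborel. s * (f x * bump r a x))"
      by (rule integral_mono) (use b low in auto)
    also have "\<dots> = s * (LINT x|lborel. h x * bump r a x)"
      using weak[OF bump_test_function, of r a] by simp
    also have "\<dots> \<le> \<bar>LINT x|lborel. h x * bump r a x\<bar>"
      unfolding s_def by (simp add: abs_ge_self abs_ge_minus_self)
    also have "\<dots> \<le> (LINT x|lborel. \<bar>h x * bump r a x\<bar>)"
      using integral_norm_bound[of lborel "\<lambda>x. h x * bump r a x"] by simp
    also have "\<dots> \<le> (LINT x|lborel. L/2 * (indicator {x. N \<le> \<bar>x\<bar>} x * (h x)\<^sup>2) + 1/(2*L) * (bump r a x)\<^sup>2)"
    proof (rule integral_mono')
      have "integrable lborel (\<lambda>x. indicator {x. N \<le> \<bar>x\<bar>} x * (h x)\<^sup>2)"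
        using integrable_mult_indicator[of "{x. N \<le> \<bar>x\<bar>}" lborel "\<lambda>x. (h x)\<^sup>2"] h by simp
      then show "integrable lborel (\<lambda>x. L/2 * (indicator {x. N \<le> \<bar>x\<bar>} x * (h x)\<^sup>2) + 1/(2*L) * (bump r a x)\<^sup>2)"
        using b by (intro Bochner_Integration.integrable_add integrable_mult_right) auto
      fix x
      show "\<bar>h x * bump r a x\<bar> \<le> L/2 * (indicator {x. N \<le> \<bar>x\<bar>} x * (h x)\<^sup>2) + 1/(2*L) * (bump r a x)\<^sup>2"
      proof (cases "\<bar>x - a\<bar> < r")
        case True
        then have "N \<le> \<bar>x\<bar>" using a by linarith
        moreover have "\<bar>h x\<bar> * bump r a x \<le> L/2 * (h x)\<^sup>2 + 1/(2*L) * (bump r a x)\<^sup>2"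
        proof -
          have "0 \<le> (L * \<bar>h x\<bar> - bump r a x)\<^sup>2 / (2 * L)" using L by simp
          also have "\<dots> = L/2 * (h x)\<^sup>2 + 1/(2*L) * (bump r a x)\<^sup>2 - \<bar>h x\<bar> * bump r a x"
            using L by (simp add: field_simps power2_eq_square)
          finally show ?thesis by simp
        qed
        ultimately show ?thesis by (simp add: abs_mult bump_nonneg)
      next
        case False
        then show ?thesis using L by (simp add: bump_eq_0)
      qed
    qed (use L in \<open>auto simp: indicator_def\<close>)
    also have "\<dots> = L/2 * (LINT x|lborel. indicator {x. N \<le> \<bar>x\<bar>} x * (h x)\<^sup>2) + 1/(2*L) * Q"
    proof -
      have "integrable lborel (\<lambda>x. indicator {x. N \<le> \<bar>x\<bar>} x * (h x)\<^sup>2)"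
        using integrable_mult_indicator[of "{x. N \<le> \<bar>x\<bar>}" lborel "\<lambda>x. (h x)\<^sup>2"] h by simp
      then show ?thesis using b Q[of a] by (subst Bochner_Integration.integral_add) auto
    qed
    also have "\<dots> < L/2 * (c * I / (2 * L)) + c * I / 4"
      using N L QL by (intro add_strict_mono mult_strict_left_mono) auto
    also have "\<dots> = c/2 * I" using L by (simp add: field_simps)
    finally show False by simp
  qed
  then show ?thesis by (intro exI[of _ "N + r"]) auto
qed

section \<open>Essential supremum of a continuous function\<close>

lemma Linf_norm_pointwise:
  assumes g: "continuous_on UNIV g" and le: "Linf_norm g \<le> ereal a"
  shows "\<bar>g x\<bar> \<le> a"
proof (rule ccontr)
  assume x: "\<not> \<bar>g x\<bar> \<le> a"
  define S where "S = {y. a < \<bar>g y\<bar>}"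
  have op: "open S" unfolding S_def by (intro open_Collect_less continuous_intros g)
  have "AE y in lborel. ereal \<bar>g y\<bar> \<le> Linf_norm g" unfolding Linf_norm_def by (rule esssup_AE)
  then have "AE y in lborel. y \<notin> S"
  proof eventually_elim
    case (elim y)
    then have "ereal \<bar>g y\<bar> \<le> ereal a" using le by (rule order_trans)
    then show ?case by (simp add: S_def)
  qed
  then have "S \<in> null_sets lborel" using op by (subst AE_iff_null_sets) auto
  then have "negligible S" using negligible_iff_null_sets null_sets_completionI by blast
  moreover have "x \<in> S" using x by (simp add: S_def)
  ultimately show False using open_not_negligible[OF op] by blast
qed

lemma Linf_norm_le:
  assumes g: "continuous_on UNIV g" and le: "\<And>x. \<bar>g x\<bar> \<le> a"
  shows "Linf_norm g \<le> ereal a"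
proof -
  have [measurable]: "g \<in> borel_measurable borel" using g by (rule borel_measurable_continuous_onI)
  show ?thesis unfolding Linf_norm_def by (rule esssup_I) (use le in auto)
qed

lemma Linf_norm_nonneg: "0 \<le> Linf_norm g"
proof -
  have "AE x in lborel. ereal \<bar>g x\<bar> \<le> Linf_norm g" unfolding Linf_norm_def by (rule esssup_AE)
  then have "AE x in (lborel :: real measure). 0 \<le> Linf_norm g"
    by eventually_elim (metis abs_ge_zero ereal_less_eq(5) order_trans)
  moreover have "ae_filter (lborel :: real measure) \<noteq> bot"
    by (simp add: ae_filter_eq_bot_iff emeasure_lborel_UNIV)
  ultimately show ?thesis by (simp add: eventually_const_iff)
qed

section \<open>Classical solutions\<close>

lemma has_derivative_bound_imp_lipschitz:
  fixes f :: "real \<Rightarrow> real"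
  assumes "\<And>x. (f has_real_derivative f' x) (at x)" "\<And>x. \<bar>f' x\<bar> \<le> M"
  shows "\<bar>f x - f y\<bar> \<le> M * \<bar>x - y\<bar>"
  using field_differentiable_bound[of UNIV f f' M x y] assms by simp

lemma lipschitz_imp_derivative_bound:
  fixes f :: "real \<Rightarrow> real"
  assumes d: "(f has_real_derivative D) (at x)" and lip: "\<And>y. \<bar>f x - f y\<bar> \<le> M * \<bar>x - y\<bar>"
  shows "\<bar>D\<bar> \<le> M"
proof -
  have "((\<lambda>h. \<bar>(f (x + h) - f x) / h\<bar>) \<longlongrightarrow> \<bar>D\<bar>) (at 0)"
    using d by (intro tendsto_rabs) (simp add: DERIV_def)
  moreover have "\<forall>\<^sub>F h in at 0. \<bar>(f (x + h) - f x) / h\<bar> \<le> M"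
    unfolding eventually_at_filter
  proof (intro always_eventually allI impI)
    fix h :: real assume "h \<noteq> 0"
    then show "\<bar>(f (x + h) - f x) / h\<bar> \<le> M"
      using lip[of "x + h"] by (simp add: abs_minus_commute pos_divide_le_eq)
  qed
  ultimately show ?thesis by (rule tendsto_upperbound) simp
qed

lemma second_derivative_bound_imp_taylor:
  fixes f :: "real \<Rightarrow> real"
  assumes f: "\<And>x. (f has_real_derivative f' x) (at x)" and f': "\<And>x. (f' has_real_derivative f'' x) (at x)"
    and B: "\<And>x. \<bar>f'' x\<bar> \<le> B"
  shows "\<bar>f x - f y - f' x * (x - y)\<bar> \<le> B * (x - y)^2"
proof -
  have B0: "0 \<le> B" using B[of 0] by linarith
  define S where "S = {min x y..max x y}"
  have n1: "norm ((f x - f' x * x) - (f y - f' x * y)) \<le> (B * \<bar>x - y\<bar>) * norm (x - y)"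
  proof (rule field_differentiable_bound[of S _ "\<lambda>z. f' z - f' x"])
    show "convex S" unfolding S_def by (rule convex_real_interval)
    show "x \<in> S" "y \<in> S" by (auto simp: S_def)
    fix z assume z: "z \<in> S"
    show "((\<lambda>z. f z - f' x * z) has_field_derivative f' z - f' x) (at z within S)"
      by (rule has_field_derivative_at_within) (auto intro!: derivative_eq_intros f)
    have "\<bar>f' z - f' x\<bar> \<le> B * \<bar>z - x\<bar>" using has_derivative_bound_imp_lipschitz[OF f' B] .
    also have "\<dots> \<le> B * \<bar>x - y\<bar>" using z B0 by (intro mult_left_mono) (auto simp: S_def)
    finally show "norm (f' z - f' x) \<le> B * \<bar>x - y\<bar>" by simp
  qed
  have n2: "B * \<bar>x - y\<bar> * norm (x - y) = B * (x - y)^2"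
    by (simp add: power2_eq_square mult.assoc)
  have n3: "(f x - f' x * x) - (f y - f' x * y) = f x - f y - f' x * (x - y)" by (simp add: algebra_simps)
  show ?thesis using n1 unfolding n2 n3 by simp
qed

lemma muskat_integrand_scaled:
  assumes "0 < l" and k: "k = pi / (2 * l)"
  shows "strip_integrand (\<lambda>X. k * f (X / k)) (\<lambda>X. deriv f (X / k)) (k * x) (k * \<eta>) = muskat_integrand l f x \<eta>"
proof -
  have k0: "0 < k" using assms by simp
  have "(k * x - k * \<eta>) / k = x - \<eta>" using k0 by (simp add: field_simps)
  moreover have "k * a - k * b = k * (a - b)" "k * a + k * b = k * (a + b)" for a b by (simp_all add: algebra_simps)
  ultimately show ?thesis
    using k0 unfolding strip_integrand_def muskat_integrand_def Xi1_def Xi2_def k[symmetric] by simp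
qed

lemma classical_solution_regularity:
  assumes "classical_solution l rho1 rho2 T f0 f"
  obtains f' f'' B0 B1 B2 where
    "\<And>t x. t \<in> {0..T} \<Longrightarrow> (f t has_real_derivative f' t x) (at x)"
    "\<And>t x. t \<in> {0..T} \<Longrightarrow> (f' t has_real_derivative f'' t x) (at x)"
    "\<And>t x. t \<in> {0..T} \<Longrightarrow> \<bar>f t x\<bar> \<le> B0" "\<And>t x. t \<in> {0..T} \<Longrightarrow> \<bar>f' t x\<bar> \<le> B1"
    "\<And>t x. t \<in> {0..T} \<Longrightarrow> \<bar>f'' t x\<bar> \<le> B2"
    "\<And>t e. t \<in> {0..T} \<Longrightarrow> 0 < e \<Longrightarrow> \<exists>d>0. \<forall>s\<in>{0..T}. \<bar>s - t\<bar> < d \<longrightarrow> (\<forall>x. \<bar>f s x - f t x\<bar> < e)"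
proof -
  obtain F :: "nat \<Rightarrow> real \<Rightarrow> (real \<Rightarrow>\<^sub>C real)" where
    cont: "\<And>j. j \<le> 2 \<Longrightarrow> continuous_on {0..T} (F j)" and F0: "\<And>t. t \<in> {0..T} \<Longrightarrow> apply_bcontfun (F 0 t) = f t"
    and F': "\<And>t j x. t \<in> {0..T} \<Longrightarrow> j < 2 \<Longrightarrow> (apply_bcontfun (F j t) has_real_derivative apply_bcontfun (F (Suc j) t) x) (at x)"
    using assms unfolding classical_solution_def continuous_in_Ck_def by blast
  have bound: "\<exists>B. \<forall>t\<in>{0..T}. \<forall>x. \<bar>apply_bcontfun (F j t) x\<bar> \<le> B" if "j \<le> 2" for j
  proof -
    have "bounded (F j ` {0..T})" by (intro compact_imp_bounded compact_continuous_image cont that) auto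
    then obtain B where B: "\<forall>y\<in>F j ` {0..T}. norm y \<le> B" unfolding bounded_iff by blast
    show ?thesis
    proof (intro exI[of _ B] ballI allI)
      fix t x assume "t \<in> {0..T}"
      then have "norm (F j t) \<le> B" using B by blast
      moreover have "norm (apply_bcontfun (F j t) x) \<le> norm (F j t)" by (rule norm_bounded)
      ultimately show "\<bar>apply_bcontfun (F j t) x\<bar> \<le> B" by simp
    qed
  qed
  obtain B0 where B0: "\<forall>t\<in>{0..T}. \<forall>x. \<bar>apply_bcontfun (F 0 t) x\<bar> \<le> B0" using bound[of 0] by auto
  obtain B1 where B1: "\<forall>t\<in>{0..T}. \<forall>x. \<bar>apply_bcontfun (F 1 t) x\<bar> \<le> B1" using bound[of 1] by auto
  obtain B2 where B2: "\<forall>t\<in>{0..T}. \<forall>x. \<bar>apply_bcontfun (F 2 t) x\<bar> \<le> B2" using bound[of 2] by auto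
  show ?thesis
  proof (rule that[of "\<lambda>t. apply_bcontfun (F 1 t)" "\<lambda>t. apply_bcontfun (F 2 t)" B0 B1 B2])
    fix t x assume t: "t \<in> {0..T}"
    show "(f t has_real_derivative apply_bcontfun (F 1 t) x) (at x)" using F'[OF t, of 0] F0[OF t] by simp
    show "(apply_bcontfun (F 1 t) has_real_derivative apply_bcontfun (F 2 t) x) (at x)"
      using F'[OF t, of 1] by (simp add: numeral_2_eq_2)
    show "\<bar>f t x\<bar> \<le> B0" using bspec[OF B0 t] F0[OF t] by simp
    show "\<bar>apply_bcontfun (F 1 t) x\<bar> \<le> B1" "\<bar>apply_bcontfun (F 2 t) x\<bar> \<le> B2" using bspec[OF B1 t] bspec[OF B2 t] by blast+
  next
    fix t e :: real assume t: "t \<in> {0..T}" and e: "0 < e"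
    obtain d where d: "0 < d" "\<And>s. s \<in> {0..T} \<Longrightarrow> dist s t < d \<Longrightarrow> dist (F 0 s) (F 0 t) < e"
      using cont[of 0] t e unfolding continuous_on_iff by (metis zero_le)
    show "\<exists>d>0. \<forall>s\<in>{0..T}. \<bar>s - t\<bar> < d \<longrightarrow> (\<forall>x. \<bar>f s x - f t x\<bar> < e)"
    proof (intro exI[of _ d] conjI ballI impI allI d(1))
      fix s x assume s: "s \<in> {0..T}" "\<bar>s - t\<bar> < d"
      have "dist (apply_bcontfun (F 0 s) x) (apply_bcontfun (F 0 t) x) \<le> dist (F 0 s) (F 0 t)" by (rule dist_bounded)
      also have "\<dots> < e" using d(2)[of s] s by (simp add: dist_real_def)
      finally show "\<bar>f s x - f t x\<bar> < e" using F0 s t by (simp add: dist_real_def)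
    qed
  qed
qed

lemma classical_solution_decay:
  assumes sol: "classical_solution l rho1 rho2 T f0 f" and t: "t \<in> {0..T}"
  shows "(f t \<longlongrightarrow> 0) at_top" "(f t \<longlongrightarrow> 0) at_bot"
proof -
  obtain f' f'' and B0 B1 B2 :: real where reg: "\<And>t x. t \<in> {0..T} \<Longrightarrow> (f t has_real_derivative f' t x) (at x)"
    "\<And>t x. t \<in> {0..T} \<Longrightarrow> (f' t has_real_derivative f'' t x) (at x)"
    "\<And>t x. t \<in> {0..T} \<Longrightarrow> \<bar>f t x\<bar> \<le> B0" "\<And>t x. t \<in> {0..T} \<Longrightarrow> \<bar>f' t x\<bar> \<le> B1"
    by (rule classical_solution_regularity[OF sol]) blast
  have "f t \<in> sobolev 3"
    using sol t by (simp add: classical_solution_def continuous_in_sobolev_strip_def sobolev_strip_def)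
  then obtain h where h: "is_weak_deriv 0 (f t) h" "L2_function h" unfolding sobolev_def by blast
  have N: "\<exists>N. \<forall>x. N \<le> \<bar>x\<bar> \<longrightarrow> \<bar>f t x\<bar> < c" if "0 < c" for c
  proof (rule lipschitz_L2_decay[OF _ _ _ _ _ that, of "f t" B1 B0 h])
    show "\<bar>f t x - f t y\<bar> \<le> B1 * \<bar>x - y\<bar>" for x y
      using has_derivative_bound_imp_lipschitz[OF reg(1)[OF t] reg(4)[OF t]] .
    show "\<bar>f t x\<bar> \<le> B0" for x by (rule reg(3)[OF t])
    show "(LINT x|lborel. f t x * \<phi> x) = (LINT x|lborel. h x * \<phi> x)" if "test_function \<phi>" for \<phi>
      using h(1) that by (simp add: is_weak_deriv_def)
  qed (use h(2) in \<open>simp_all add: L2_function_def\<close>)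
  show "(f t \<longlongrightarrow> 0) at_top"
  proof (rule tendstoI)
    fix c :: real assume "0 < c"
    then obtain N where N: "\<And>x. N \<le> \<bar>x\<bar> \<Longrightarrow> \<bar>f t x\<bar> < c" using N by blast
    show "\<forall>\<^sub>F x in at_top. dist (f t x) 0 < c"
      using eventually_ge_at_top[of "\<bar>N\<bar>"] by eventually_elim (auto intro!: N)
  qed
  show "(f t \<longlongrightarrow> 0) at_bot"
  proof (rule tendstoI)
    fix c :: real assume "0 < c"
    then obtain N where N: "\<And>x. N \<le> \<bar>x\<bar> \<Longrightarrow> \<bar>f t x\<bar> < c" using N by blast
    show "\<forall>\<^sub>F x in at_bot. dist (f t x) 0 < c"
      using eventually_le_at_bot[of "- \<bar>N\<bar>"] by eventually_elim (auto intro!: N)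
  qed
qed

lemma classical_solution_imp_strip_flow:
  assumes l: "0 < l" and rho: "0 < rho2 - rho1" and T: "0 < T"
    and sol: "classical_solution l rho1 rho2 T f0 f" and k: "k = pi / (2 * l)"
  shows "\<exists>G B. strip_flow T (k * ((rho2 - rho1) / (8 * l))) k G B (\<lambda>t X. k * f t (X / k)) (\<lambda>t X. deriv (f t) (X / k))"
proof -
  have k0: "0 < k" using l by (simp add: k)
  obtain f' f'' and B0 B1 B2 :: real where reg: "\<And>t x. t \<in> {0..T} \<Longrightarrow> (f t has_real_derivative f' t x) (at x)"
    "\<And>t x. t \<in> {0..T} \<Longrightarrow> (f' t has_real_derivative f'' t x) (at x)"
    "\<And>t x. t \<in> {0..T} \<Longrightarrow> \<bar>f t x\<bar> \<le> B0" "\<And>t x. t \<in> {0..T} \<Longrightarrow> \<bar>f' t x\<bar> \<le> B1"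
    "\<And>t x. t \<in> {0..T} \<Longrightarrow> \<bar>f'' t x\<bar> \<le> B2"
    "\<And>t e. t \<in> {0..T} \<Longrightarrow> 0 < e \<Longrightarrow> \<exists>d>0. \<forall>s\<in>{0..T}. \<bar>s - t\<bar> < d \<longrightarrow> (\<forall>x. \<bar>f s x - f t x\<bar> < e)"
    by (rule classical_solution_regularity[OF sol]) blast
  have df: "deriv (f t) = f' t" if "t \<in> {0..T}" for t using reg(1)[OF that] by (auto intro!: DERIV_imp_deriv)
  have contf: "continuous_on S (f t)" if "t \<in> {0..T}" for t S
    using reg(1)[OF that] by (intro continuous_at_imp_continuous_on ballI) (rule DERIV_isCont)
  have B2: "0 \<le> B2" using reg(5)[of 0 0] T by (meson abs_ge_zero atLeastAtMost_iff less_imp_le order_refl order_trans)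
  have strip: "\<bar>f t x\<bar> < l" if t: "t \<in> {0..T}" for t x
  proof -
    have L: "Linf_norm (f t) < ereal l"
      using sol t by (simp add: classical_solution_def continuous_in_sobolev_strip_def sobolev_strip_def)
    then obtain a where a: "Linf_norm (f t) = ereal a" using Linf_norm_nonneg[of "f t"] by (cases "Linf_norm (f t)") auto
    then have "\<bar>f t x\<bar> \<le> a" using contf[OF t] by (intro Linf_norm_pointwise) auto
    then show ?thesis using L a by simp
  qed
  have "strip_flow T (k * ((rho2 - rho1) / (8 * l))) k B1 (B2 / k) (\<lambda>t X. k * f t (X / k)) (\<lambda>t X. deriv (f t) (X / k))"
  proof (rule strip_flow.intro[OF T _ k0])
    show "0 < k * ((rho2 - rho1) / (8 * l))" using k0 rho l by simp
    show "0 \<le> B2 / k" using B2 k0 by simp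
  next
    fix t assume t: "t \<in> {0..T}"
    have xk: "filterlim (\<lambda>X. X / k) at_top at_top" "filterlim (\<lambda>X. X / k) at_bot at_bot" using k0 by real_asymp+
    show "strip_profile (\<lambda>X. k * f t (X / k)) (\<lambda>X. deriv (f t) (X / k)) B1"
    proof
      fix X :: real
      have "k * \<bar>f t (X / k)\<bar> < k * l" using strip[OF t] k0 by simp
      also have "k * l = pi/2" using l by (simp add: k)
      finally show "\<bar>k * f t (X / k)\<bar> < pi/2" using k0 by (simp add: abs_mult)
      have "((\<lambda>X. X / k) has_real_derivative 1 / k) (at X)" using k0 by (auto intro!: derivative_eq_intros)
      from DERIV_cmult[OF DERIV_chain2[OF reg(1)[OF t] this], of k]
      show "((\<lambda>X. k * f t (X / k)) has_real_derivative deriv (f t) (X / k)) (at X)" using k0 by (simp add: df[OF t])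
      show "\<bar>deriv (f t) (X / k)\<bar> \<le> B1" using reg(4)[OF t] by (simp add: df[OF t])
    next
      have "continuous_on UNIV (f' t)"
        using reg(2)[OF t] by (intro continuous_at_imp_continuous_on ballI) (rule DERIV_isCont)
      then show "continuous_on UNIV (\<lambda>X. deriv (f t) (X / k))" unfolding df[OF t]
        by (rule continuous_on_compose2) (use k0 in \<open>auto intro!: continuous_intros\<close>)
      show "((\<lambda>X. k * f t (X / k)) \<longlongrightarrow> 0) at_top" "((\<lambda>X. k * f t (X / k)) \<longlongrightarrow> 0) at_bot"
        using tendsto_mult[OF tendsto_const filterlim_compose[OF classical_solution_decay(1)[OF sol t] xk(1)], of k]
          tendsto_mult[OF tendsto_const filterlim_compose[OF classical_solution_decay(2)[OF sol t] xk(2)], of k] by simp_all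
    qed
    show "\<bar>k * f t (X / k) - k * f t (Y / k) - deriv (f t) (X / k) * (X - Y)\<bar> \<le> B2 / k * (X - Y)^2" for X Y
    proof -
      define x where "x = X / k"
      define y where "y = Y / k"
      have XY: "X = k * x" "Y = k * y" using k0 by (auto simp: x_def y_def)
      have "\<bar>f t x - f t y - f' t x * (x - y)\<bar> \<le> B2 * (x - y)^2"
        using second_derivative_bound_imp_taylor[OF reg(1)[OF t] reg(2)[OF t] reg(5)[OF t]] .
      then have "k * \<bar>f t x - f t y - f' t x * (x - y)\<bar> \<le> k * (B2 * (x - y)^2)" using k0 by (intro mult_left_mono) auto
      moreover have "k * \<bar>f t x - f t y - f' t x * (x - y)\<bar> = \<bar>k * f t x - k * f t y - f' t x * (X - Y)\<bar>"
      proof -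
        have "k * f t x - k * f t y - f' t x * (X - Y) = k * (f t x - f t y - f' t x * (x - y))" by (simp add: XY algebra_simps)
        then show ?thesis using k0 by (simp add: abs_mult)
      qed
      moreover have "k * (B2 * (x - y)^2) = B2 / k * (X - Y)^2"
        using k0 by (simp add: XY power2_eq_square field_simps)
      ultimately show ?thesis by (simp add: df[OF t] x_def y_def)
    qed
    show "\<exists>d>0. \<forall>s\<in>{0..T}. \<bar>s - t\<bar> < d \<longrightarrow> (\<forall>X. \<bar>k * f s (X / k) - k * f t (X / k)\<bar> < e)" if e: "0 < e" for e
    proof -
      obtain d where d: "0 < d" "\<And>s x. s \<in> {0..T} \<Longrightarrow> \<bar>s - t\<bar> < d \<Longrightarrow> \<bar>f s x - f t x\<bar> < e / k"
        using reg(6)[OF t, of "e / k"] e k0 by auto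
      show ?thesis
      proof (intro exI[of _ d] conjI ballI impI allI d(1))
        fix s X assume "s \<in> {0..T}" "\<bar>s - t\<bar> < d"
        then have "\<bar>f s (X / k) - f t (X / k)\<bar> < e / k" by (rule d)
        then have "k * \<bar>f s (X / k) - f t (X / k)\<bar> < e" using k0 by (simp add: pos_less_divide_eq mult.commute)
        then show "\<bar>k * f s (X / k) - k * f t (X / k)\<bar> < e" using k0 by (simp add: abs_mult flip: right_diff_distrib)
      qed
    qed
    show "\<exists>c. has_PV_integral (\<lambda>\<eta>. strip_integrand (\<lambda>X. k * f t (X / k)) (\<lambda>X. deriv (f t) (X / k)) X (k * \<eta>)) c \<and>
      ((\<lambda>s. k * f s (X / k)) has_real_derivative k * ((rho2 - rho1) / (8 * l)) * c) (at t within {0..T})" for X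
    proof -
      obtain c where c: "has_PV_integral (muskat_integrand l (f t) (X / k)) c"
        "((\<lambda>s. f s (X / k)) has_real_derivative (rho2 - rho1) / (8 * l) * c) (at t within {0..T})"
        using sol t unfolding classical_solution_def muskat_equation_def by blast
      have "(\<lambda>\<eta>. strip_integrand (\<lambda>X. k * f t (X / k)) (\<lambda>X. deriv (f t) (X / k)) X (k * \<eta>)) = muskat_integrand l (f t) (X / k)"
        using muskat_integrand_scaled[OF l k, of "f t" "X / k"] k0 by auto
      then show ?thesis using c(1) DERIV_cmult[OF c(2), of k] by (auto simp: mult.assoc)
    qed
  qed
  then show ?thesis by blast
qed

text \<open>The maximum principle of the introduction, in the original variables.\<close>

lemma classical_solution_slope_bound:
  assumes l: "0 < l" and rho: "0 < rho2 - rho1" and T: "0 < T"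
    and sol: "classical_solution l rho1 rho2 T f0 f"
    and M: "0 < M" "M \<le> 1" and a: "0 \<le> a" "a < l" "tan (pi / (2 * l) * a) \<le> M"
    and init: "\<And>x. \<bar>f0 x\<bar> \<le> a" "\<And>x. \<bar>deriv f0 x\<bar> \<le> M" and t: "t \<in> {0..T}"
  shows "\<bar>deriv (f t) x\<bar> \<le> M"
proof -
  define k where "k = pi / (2 * l)"
  have k0: "0 < k" using l by (simp add: k_def)
  obtain f' where f': "\<And>t x. t \<in> {0..T} \<Longrightarrow> (f t has_real_derivative f' t x) (at x)"
    by (rule classical_solution_regularity[OF sol]) blast
  have df: "deriv (f t) = f' t" if "t \<in> {0..T}" for t using f'[OF that] by (auto intro!: DERIV_imp_deriv)
  have f0: "f 0 = f0" using sol by (simp add: classical_solution_def)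
  have T0: "0 \<in> {0..T}" using T by simp
  obtain G B where flow: "strip_flow T (k * ((rho2 - rho1) / (8 * l))) k G B (\<lambda>t X. k * f t (X / k)) (\<lambda>t X. deriv (f t) (X / k))"
    using classical_solution_imp_strip_flow[OF l rho T sol k_def] by blast
  have lip: "\<bar>f t x - f t y\<bar> \<le> M * \<bar>x - y\<bar>" for x y
  proof -
    have "\<bar>k * f t (k * x / k) - k * f t (k * y / k)\<bar> \<le> M * \<bar>k * x - k * y\<bar>"
    proof (rule strip_flow.slope_maximum_principle[OF flow M, of "k * a"])
      show "0 \<le> k * a" using k0 a by simp
      have "k * a < k * l" using k0 a by simp
      then show "k * a < pi/2" using l by (simp add: k_def)
      show "tan (k * a) \<le> M" using a by (simp add: k_def)
      show "\<bar>k * f 0 (x / k)\<bar> \<le> k * a" for x using init(1)[of "x / k"] k0 by (simp add: f0 abs_mult)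
      show "\<bar>k * f 0 (x / k) - k * f 0 (y / k)\<bar> \<le> M * \<bar>x - y\<bar>" for x y
      proof -
        have "\<bar>f 0 (x / k) - f 0 (y / k)\<bar> \<le> M * \<bar>x / k - y / k\<bar>"
          using init(2) by (intro has_derivative_bound_imp_lipschitz[OF f'[OF T0]]) (simp add: f0[symmetric] df[OF T0])
        also have "\<bar>x / k - y / k\<bar> = \<bar>x - y\<bar> / k" using k0 by (simp flip: diff_divide_distrib)
        finally have "k * \<bar>f 0 (x / k) - f 0 (y / k)\<bar> \<le> M * \<bar>x - y\<bar>" using k0 by (simp add: pos_le_divide_eq mult.commute)
        then show ?thesis using k0 by (simp add: abs_mult flip: right_diff_distrib)
      qed
    qed (rule t)
    then have "k * \<bar>f t x - f t y\<bar> \<le> k * (M * \<bar>x - y\<bar>)"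
      using k0 by (simp add: abs_mult mult.left_commute flip: right_diff_distrib)
    then show ?thesis using k0 by simp
  qed
  show ?thesis unfolding df[OF t] by (rule lipschitz_imp_derivative_bound[OF f'[OF t] lip])
qed

theorem theorem7:
  fixes l rho1 rho2 T :: real
    and f0 :: "real \<Rightarrow> real"
    and f :: "real \<Rightarrow> real \<Rightarrow> real"
  assumes "l > 0"
    and "rho2 - rho1 > 0"
    and "f0 \<in> sobolev_strip 3 l"
    and "T > 0"
    and "classical_solution l rho1 rho2 T f0 f"
  shows
    "let a = real_of_ereal (Linf_norm f0);
         d = real_of_ereal (Linf_norm (deriv f0))
     in
      (cos (pi / (4*l)) \<noteq> 0 \<and> cos (pi / (2*l) * (d / 2)) \<noteq> 0 \<and>
       d \<le> 1 \<and>
       tan (pi * a / (2*l)) < d * tanh (pi / (4*l)) \<and>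
       (d + \<bar>2 * (cos (pi / (2*l)) - 2) * (1 / cos (pi / (4*l))) ^ 4\<bar> * d ^ 3)
          * (pi ^ 3 / (8 * l ^ 3))
          * ((1 + d * (d + tan (pi / (2*l) * (d / 2)) / tanh (pi / (4*l))))
             / (6 * tanh (pi / (4*l))))
          * (pi ^ 2 / (4 * l ^ 2))
         + 4 * tan (pi / (2*l) * a) - 4 * d * cos (pi / l * a) \<le> 0
       \<longrightarrow> (\<forall>t\<in>{0..T}. Linf_norm (deriv (f t)) \<le> Linf_norm (deriv f0)))
      \<and>
      (\<forall>x y :: real.
        0 < x \<and> x < l \<and> 0 < y \<and> y \<le> 1 \<and>
        cos (pi / (4*l)) \<noteq> 0 \<and> cos (pi / (2*l) * (y / 2)) \<noteq> 0 \<and>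
        tan (pi * x / (2*l)) - y * tanh (pi / (4*l)) = 0 \<and>
        (y + \<bar>2 * (cos (pi / (2*l)) - 2) * (1 / cos (pi / (4*l))) ^ 4\<bar> * y ^ 3)
          * ((1 + y * (y + tan (pi / (2*l) * (y / 2)) / tanh (pi / (4*l))))
             / (6 * tanh (pi / (4*l))))
          * (pi / (2*l)) ^ 5
         + 4 * tan (pi / (2*l) * x) - 4 * y * cos (pi / l * x) = 0 \<and>
        a < x \<and> d < y
        \<longrightarrow> (\<forall>t\<in>{0..T}. Linf_norm (deriv (f t)) \<le> 1))"
proof -
  note l = assms(1) and rho = assms(2) and T = assms(4) and sol = assms(5)
  define a where "a = real_of_ereal (Linf_norm f0)"
  define d where "d = real_of_ereal (Linf_norm (deriv f0))"
  obtain f' f'' and B0 B1 B2 :: real where reg: "\<And>t x. t \<in> {0..T} \<Longrightarrow> (f t has_real_derivative f' t x) (at x)"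
    "\<And>t x. t \<in> {0..T} \<Longrightarrow> (f' t has_real_derivative f'' t x) (at x)"
    "\<And>t x. t \<in> {0..T} \<Longrightarrow> \<bar>f' t x\<bar> \<le> B1"
    by (rule classical_solution_regularity[OF sol]) blast
  have df: "deriv (f t) = f' t" if "t \<in> {0..T}" for t using reg(1)[OF that] by (auto intro!: DERIV_imp_deriv)
  have cf: "continuous_on UNIV (f t)" "continuous_on UNIV (deriv (f t))" if "t \<in> {0..T}" for t
    unfolding df[OF that] using reg(1,2)[OF that]
    by (auto intro!: continuous_at_imp_continuous_on intro: DERIV_isCont)
  have f0: "f 0 = f0" using sol by (simp add: classical_solution_def)
  have T0: "0 \<in> {0..T}" using T by simp
  have "Linf_norm f0 < ereal l" using assms(3) by (simp add: sobolev_strip_def)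
  then have a: "Linf_norm f0 = ereal a" "0 \<le> a" "a < l"
    using Linf_norm_nonneg[of f0] unfolding a_def by (cases "Linf_norm f0"; simp)+
  have fa: "\<bar>f0 x\<bar> \<le> a" for x
    using cf(1)[OF T0] a(1) by (intro Linf_norm_pointwise) (simp_all add: f0)
  have "Linf_norm (deriv f0) \<le> ereal B1"
    using cf(2)[OF T0] reg(3)[OF T0] by (intro Linf_norm_le) (simp_all add: f0[symmetric] df[OF T0])
  then have d: "Linf_norm (deriv f0) = ereal d" "0 \<le> d"
    using Linf_norm_nonneg[of "deriv f0"] unfolding d_def by (cases "Linf_norm (deriv f0)"; simp)+
  have fd: "\<bar>deriv f0 x\<bar> \<le> d" for x
    using cf(2)[OF T0] d(1) by (intro Linf_norm_pointwise) (simp_all add: f0)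
  have ka: "0 \<le> pi * a / (2*l)" "pi * a / (2*l) < pi/2" using a l by (simp_all add: field_simps)
  have th: "0 < tanh (pi / (4*l))" "tanh (pi / (4*l)) < 1" using l by (auto simp: tanh_real_lt_1)
  have bound: "Linf_norm (deriv (f t)) \<le> ereal M"
    if "0 < M" "M \<le> 1" "tan (pi * a / (2*l)) \<le> M" "d \<le> M" "t \<in> {0..T}" for M t
  proof (rule Linf_norm_le)
    show "continuous_on UNIV (deriv (f t))" using cf(2) that by blast
    have init: "\<bar>deriv f0 x\<bar> \<le> M" for x using fd[of x] that(4) by linarith
    show "\<bar>deriv (f t) x\<bar> \<le> M" for x
      using that by (intro classical_solution_slope_bound[OF l rho T sol _ _ a(2,3) _ fa init]) simp_all
  qed
  have i: "Linf_norm (deriv (f t)) \<le> Linf_norm (deriv f0)"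
    if "d \<le> 1" "tan (pi * a / (2*l)) < d * tanh (pi / (4*l))" "t \<in> {0..T}" for t
  proof -
    have "0 \<le> tan (pi * a / (2*l))" using ka by (rule tan_pos_pi2_le)
    then have "0 < d * tanh (pi / (4*l))" using that by linarith
    then have "0 < d" using th by (simp add: zero_less_mult_iff)
    moreover have "d * tanh (pi / (4*l)) \<le> d" using th d by (simp add: mult_left_le)
    moreover from this have "tan (pi * a / (2*l)) \<le> d" using that by linarith
    ultimately show ?thesis using bound[of d t] that(1,3) d(1) by simp
  qed
  have ii: "Linf_norm (deriv (f t)) \<le> 1"
    if "0 < x" "x < l" "0 < y" "y \<le> 1" "tan (pi * x / (2*l)) - y * tanh (pi / (4*l)) = 0" "a < x" "d < y" "t \<in> {0..T}" for x y t
  proof -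
    have "tan (pi * a / (2*l)) \<le> tan (pi * x / (2*l))"
    proof (rule tan_mono_le)
      show "- (pi/2) < pi * a / (2*l)" using ka(1) pi_gt_zero by linarith
      show "pi * a / (2*l) \<le> pi * x / (2*l)" "pi * x / (2*l) < pi/2" using that l by (simp_all add: field_simps)
    qed
    also have "\<dots> \<le> y" using that th by (simp add: mult_left_le)
    finally have "Linf_norm (deriv (f t)) \<le> ereal y" using that by (intro bound) auto
    also have "\<dots> \<le> 1" using that by simp
    finally show ?thesis .
  qed
  show ?thesis unfolding Let_def a_def[symmetric] d_def[symmetric] 
    by (intro conjI impI allI ballI; elim conjE; (rule i | rule ii); assumption)
qed

end
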